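(* Let $K$ be a Lie group with a smooth (at least $C^2$) exponential map, $\mu=|\cdot|$ an $\mathrm{Ad}_K$-invariant Finsler norm on $\mathrm{Lie}(K)$, and let $R>0$ be such that, with $B_R=\{v\in\mathrm{Lie}(K):|v|<R\}$ and $V_R=\exp(B_R)$, the set $V_R$ is open in $K$ and $\exp:B_R\to V_R$ is a $C^1$-diffeomorphism. Assume that $\mu$ is strictly convex. Let $u_0,u_1\in K$ and let $\gamma:[a,b]\to K$ be a short rectifiable path joining $u_0,u_1$. Then there exists $z\in\mathrm{Lie}(K)$ such that $u_1=u_0e^z$ and $\gamma$ is a reparametrization of the segment $\delta(t)=u_0e^{tz}$. If $\mathrm{dist}_\mu(u_0,u_1)<R$, then this segment is unique.
   Context: Lie groups are modeled on Hausdorff locally convex topological vector spaces, with $(x,y)\mapsto xy^{-1}$ smooth (at least $C^2$); $e^v=\exp(v)$. A Finsler semi-norm on $\mathrm{Lie}(K)$ is a continuous function $|\cdot|\ge0$ with $|v+w|\le|v|+|w|$ and $|\lambda v|=\lambda|v|$ for real $\lambda\ge0$. Strict convexity means that it is non-degenerate ($|v|=0$ implies $v=0$) and that $|x+y|=|x|+|y|$ with $x,y\neq0$ forces $y=\lambda x$ for some $\lambda>0$. It is $\mathrm{Ad}_K$-invariant if $|\mathrm{Ad}_uv|=|v|$ for $u\in K$; the metric on $TK$ is the left-invariant one it induces, $|v|_g=|g^{-1}v|$ for $v\in T_gK$, which is then bi-invariant. A curve $\alpha:[a,b]\to K$ is rectifiable if it is differentiable a.e. in some chart of $K$ and $t\mapsto|\dot\alpha(t)|_{\alpha(t)}$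 is Lebesgue integrable. For piecewise smooth or rectifiable arcs, $\mathrm{Length}_\mu(\alpha)=\int_a^b|\dot\alpha(t)|_{\alpha(t)}dt$; $\mathrm{dist}_\mu(g,h)$ is the infimum of the lengths of rectifiable arcs in $K$ from $g$ to $h$. A path is short if its length equals the distance $\mathrm{dist}_\mu$ between its endpoints.
   Formalization: Rectifiable curves are also required to be continuous and locally absolutely continuous in charts, both for the path and in the infimum defining the distance; otherwise Cantor staircases have length zero, all distances in the Euclidean plane vanish, and the claim fails. *)

theory Defs
  imports "HOL-Analysis.Analysis" "HOL-Algebra.Group"
begin

section \<open>Hausdorff locally convex spaces and their differential calculus\<close>

class hausdorff_lcs = real_vector + t2_space + topological_ab_group_add +
  assumes tendsto_scaleR_nhds:
    "LIM p (nhds c \<times>\<^sub>F nhds x). fst p *\<^sub>R snd p :> nhds (c *\<^sub>R x)"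
  and locally_convex_zero:
    "open U \<Longrightarrow> 0 \<in> U \<Longrightarrow>
      \<exists>V. open V \<and> 0 \<in> V \<and> V \<subseteq> U \<and>
        (\<forall>x\<in>V. \<forall>y\<in>V. \<forall>s\<ge>0. \<forall>t\<ge>0. s + t = 1 \<longrightarrow> s *\<^sub>R x + t *\<^sub>R y \<in> V)"

instance real_normed_vector \<subseteq> hausdorff_lcs
proof
  fix c :: real and x :: 'a
  show "LIM p (nhds c \<times>\<^sub>F nhds x). fst p *\<^sub>R snd p :> nhds (c *\<^sub>R x)"
    by (intro tendsto_scaleR filterlim_fst filterlim_snd)
next
  fix U :: "'a set"
  assume "open U" "0 \<in> U"
  then obtain e where "e > 0" "ball 0 e \<subseteq> U"
    by (meson openE)
  then show "\<exists>V. open V \<and> 0 \<in> V \<and> V \<subseteq> U \<and>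
        (\<forall>x\<in>V. \<forall>y\<in>V. \<forall>s\<ge>0. \<forall>t\<ge>0. s + t = 1 \<longrightarrow> s *\<^sub>R x + t *\<^sub>R y \<in> V)"
    using convex_ball[of "0::'a" e] unfolding convex_def
    by (intro exI[of _ "ball 0 e"]) auto
qed

definition has_dir_deriv ::
    "('e::{real_vector,topological_space} \<Rightarrow> 'f::{real_vector,topological_space}) \<Rightarrow> 'e \<Rightarrow> 'e \<Rightarrow> 'f \<Rightarrow> bool"
  where "has_dir_deriv f x v w \<longleftrightarrow> ((\<lambda>h. (f (x + h *\<^sub>R v) - f x) /\<^sub>R h) \<longlongrightarrow> w) (at 0)"

text \<open>For \<open>f\<close> defined on the real line, \<open>dir_deriv f t 1\<close> is the derivative of the curve \<open>f\<close>
  at \<open>t\<close>.\<close>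

definition dir_deriv ::
    "('e::{real_vector,topological_space} \<Rightarrow> 'f::{real_vector,t2_space}) \<Rightarrow> 'e \<Rightarrow> 'e \<Rightarrow> 'f"
  where "dir_deriv f x v = Lim (at 0) (\<lambda>h. (f (x + h *\<^sub>R v) - f x) /\<^sub>R h)"

text \<open>Differentiability on open sets is that of Michal and Bastiani, the usual one for Lie groups
  modeled on locally convex spaces.\<close>

definition C1_on ::
    "'e::{real_vector,topological_space} set \<Rightarrow> ('e \<Rightarrow> 'f::{real_vector,t2_space}) \<Rightarrow> bool"
  where "C1_on U f \<longleftrightarrow> continuous_on U f \<and>
    (\<forall>x\<in>U. \<forall>v. has_dir_deriv f x v (dir_deriv f x v)) \<and>
    continuous_on (U \<times> UNIV) (\<lambda>(x, v). dir_deriv f x v)"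

definition C2_on ::
    "'e::{real_vector,topological_space} set \<Rightarrow> ('e \<Rightarrow> 'f::{real_vector,t2_space}) \<Rightarrow> bool"
  where "C2_on U f \<longleftrightarrow> C1_on U f \<and> C1_on (U \<times> UNIV) (\<lambda>(x, v). dir_deriv f x v)"

definition continuous_seminorm :: "('e::{real_vector,topological_space} \<Rightarrow> real) \<Rightarrow> bool"
  where "continuous_seminorm p \<longleftrightarrow> continuous_on UNIV p \<and>
    (\<forall>x y. p (x + y) \<le> p x + p y) \<and> (\<forall>c x. p (c *\<^sub>R x) = \<bar>c\<bar> * p x)"

definition abs_continuous_on :: "real set \<Rightarrow> (real \<Rightarrow> 'e::{real_vector,topological_space}) \<Rightarrow> bool"
  where "abs_continuous_on J f \<longleftrightarrow>
    (\<forall>p. continuous_seminorm p \<longrightarrow>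
      (\<forall>\<epsilon>>0. \<exists>\<delta>>0. \<forall>I. finite I \<and> (\<forall>(x, y)\<in>I. x \<le> y \<and> {x..y} \<subseteq> J) \<and>
          pairwise (\<lambda>i j. {fst i<..<snd i} \<inter> {fst j<..<snd j} = {}) I \<and>
          (\<Sum>(x, y)\<in>I. y - x) < \<delta> \<longrightarrow>
        (\<Sum>(x, y)\<in>I. p (f y - f x)) < \<epsilon>))"


section \<open>Manifolds and Lie groups\<close>

text \<open>A chart consists of its domain and its coordinate map; the latter is only relevant on the
  domain.\<close>

type_synonym ('m, 'e) chart = "'m set \<times> ('m \<Rightarrow> 'e)"

definition chart_inv :: "('m, 'e) chart \<Rightarrow> 'e \<Rightarrow> 'm"
  where "chart_inv c = inv_into (fst c) (snd c)"

definition is_chart :: "('m::topological_space, 'e::topological_space) chart \<Rightarrow> bool"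
  where "is_chart c \<longleftrightarrow> open (fst c) \<and> open (snd c ` fst c) \<and>
    homeomorphism (fst c) (snd c ` fst c) (snd c) (chart_inv c)"

definition C2_atlas ::
    "('m::topological_space, 'e::{real_vector,t2_space}) chart set \<Rightarrow> bool"
  where "C2_atlas A \<longleftrightarrow> (\<forall>c\<in>A. is_chart c) \<and> (\<Union>c\<in>A. fst c) = UNIV \<and>
    (\<forall>c\<in>A. \<forall>d\<in>A. C2_on (snd c ` (fst c \<inter> fst d)) (snd d \<circ> chart_inv c))"

definition vector_atlas :: "('e, 'e) chart set"
  where "vector_atlas = {(UNIV, id)}"

definition prod_atlas ::
    "('m, 'e) chart set \<Rightarrow> ('n, 'f) chart set \<Rightarrow> ('m \<times> 'n, 'e \<times> 'f) chart set"
  where "prod_atlas A B = {(fst c \<times> fst d, map_prod (snd c) (snd d)) | c d. c \<in> A \<and> d \<in> B}"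

text \<open>The regularity \<open>R\<close>, \<open>C1_on\<close> or \<open>C2_on\<close> below, of a map between manifolds on the open set
  \<open>S\<close>, in terms of the atlases of the two manifolds.\<close>

definition mfd_map ::
    "('e set \<Rightarrow> ('e \<Rightarrow> 'f) \<Rightarrow> bool) \<Rightarrow> ('m::topological_space, 'e) chart set \<Rightarrow> 'm set \<Rightarrow>
      ('n::topological_space, 'f) chart set \<Rightarrow> ('m \<Rightarrow> 'n) \<Rightarrow> bool"
  where "mfd_map R A S B f \<longleftrightarrow> continuous_on S f \<and>
    (\<forall>c\<in>A. \<forall>d\<in>B. R (snd c ` (fst c \<inter> S \<inter> f -` fst d)) (snd d \<circ> f \<circ> chart_inv c))"

definition lie_group ::
    "'k::t2_space monoid \<Rightarrow> ('k, 'e::hausdorff_lcs) chart set \<Rightarrow> bool"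
  where "lie_group G A \<longleftrightarrow> group G \<and> carrier G = UNIV \<and> C2_atlas A \<and>
    mfd_map C2_on (prod_atlas A A) UNIV A (\<lambda>(x, y). x \<otimes>\<^bsub>G\<^esub> inv\<^bsub>G\<^esub> y)"

text \<open>A tangent vector at \<open>g\<close> is given by its coordinates in some chart at \<open>g\<close>. Throughout,
  \<open>c0\<close> is a chart at the identity, and Lie(K) is the model space \<open>'e\<close>, that is, the tangent space
  at the identity read in \<open>c0\<close>. Another choice of \<open>c0\<close> changes this identification by a linear
  homeomorphism.\<close>

definition Ad ::
    "'k::t2_space monoid \<Rightarrow> ('k, 'e::hausdorff_lcs) chart \<Rightarrow> 'k \<Rightarrow> 'e \<Rightarrow> 'e"
  where "Ad G c0 u v =
    dir_deriv (snd c0 \<circ> (\<lambda>x. u \<otimes>\<^bsub>G\<^esub> x \<otimes>\<^bsub>G\<^esub> inv\<^bsub>G\<^esub> u) \<circ> chart_inv c0) (snd c0 \<one>\<^bsub>G\<^esub>) v"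

definition one_parameter_group ::
    "'k::t2_space monoid \<Rightarrow> ('k, 'e::hausdorff_lcs) chart set \<Rightarrow> ('k, 'e) chart \<Rightarrow> 'e \<Rightarrow> (real \<Rightarrow> 'k) \<Rightarrow> bool"
  where "one_parameter_group G A c0 v \<gamma> \<longleftrightarrow>
    (\<forall>s t. \<gamma> (s + t) = \<gamma> s \<otimes>\<^bsub>G\<^esub> \<gamma> t) \<and> mfd_map C2_on vector_atlas UNIV A \<gamma> \<and>
    has_dir_deriv (snd c0 \<circ> \<gamma>) 0 1 v"

definition is_exponential ::
    "'k::t2_space monoid \<Rightarrow> ('k, 'e::hausdorff_lcs) chart set \<Rightarrow> ('k, 'e) chart \<Rightarrow> ('e \<Rightarrow> 'k) \<Rightarrow> bool"
  where "is_exponential G A c0 ex \<longleftrightarrow>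
    (\<forall>v. \<exists>\<gamma>. one_parameter_group G A c0 v \<gamma> \<and> ex v = \<gamma> 1)"


section \<open>Finsler metrics\<close>

definition finsler_seminorm :: "('e::{real_vector,topological_space} \<Rightarrow> real) \<Rightarrow> bool"
  where "finsler_seminorm \<mu> \<longleftrightarrow> continuous_on UNIV \<mu> \<and> (\<forall>v. 0 \<le> \<mu> v) \<and>
    (\<forall>v w. \<mu> (v + w) \<le> \<mu> v + \<mu> w) \<and> (\<forall>r\<ge>0. \<forall>v. \<mu> (r *\<^sub>R v) = r * \<mu> v)"

definition finsler_norm :: "('e::{real_vector,topological_space} \<Rightarrow> real) \<Rightarrow> bool"
  where "finsler_norm \<mu> \<longleftrightarrow> finsler_seminorm \<mu> \<and> (\<forall>v. \<mu> v = 0 \<longrightarrow> v = 0)"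

definition strictly_convex :: "('e::real_vector \<Rightarrow> real) \<Rightarrow> bool"
  where "strictly_convex \<mu> \<longleftrightarrow> (\<forall>v. \<mu> v = 0 \<longrightarrow> v = 0) \<and>
    (\<forall>x y. x \<noteq> 0 \<and> y \<noteq> 0 \<and> \<mu> (x + y) = \<mu> x + \<mu> y \<longrightarrow> (\<exists>r>0. y = r *\<^sub>R x))"

definition Ad_invariant ::
    "'k::t2_space monoid \<Rightarrow> ('k, 'e::hausdorff_lcs) chart \<Rightarrow> ('e \<Rightarrow> real) \<Rightarrow> bool"
  where "Ad_invariant G c0 \<mu> \<longleftrightarrow> (\<forall>u v. \<mu> (Ad G c0 u v) = \<mu> v)"

text \<open>The left-invariant metric on the tangent vector at \<open>g\<close> that has coordinates \<open>w\<close> in the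
  chart \<open>c\<close>.\<close>

definition tangent_norm ::
    "'k::t2_space monoid \<Rightarrow> ('k, 'e::hausdorff_lcs) chart \<Rightarrow> ('e \<Rightarrow> real) \<Rightarrow> ('k, 'e) chart \<Rightarrow>
      'k \<Rightarrow> 'e \<Rightarrow> real"
  where "tangent_norm G c0 \<mu> c g w =
    \<mu> (dir_deriv (snd c0 \<circ> (\<lambda>x. inv\<^bsub>G\<^esub> g \<otimes>\<^bsub>G\<^esub> x) \<circ> chart_inv c) (snd c g) w)"

definition chart_at :: "('m, 'e) chart set \<Rightarrow> 'm \<Rightarrow> ('m, 'e) chart"
  where "chart_at A g = (SOME c. c \<in> A \<and> g \<in> fst c)"

text \<open>By the chain rule the speed does not depend on the chart chosen at \<open>\<gamma> t\<close>. It is only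
  meaningful where \<open>\<gamma>\<close> is differentiable.\<close>

definition speed ::
    "'k::t2_space monoid \<Rightarrow> ('k, 'e::hausdorff_lcs) chart set \<Rightarrow> ('k, 'e) chart \<Rightarrow> ('e \<Rightarrow> real) \<Rightarrow>
      (real \<Rightarrow> 'k) \<Rightarrow> real \<Rightarrow> real"
  where "speed G A c0 \<mu> \<gamma> t =
    (let c = chart_at A (\<gamma> t) in tangent_norm G c0 \<mu> c (\<gamma> t) (dir_deriv (snd c \<circ> \<gamma>) t 1))"

definition arc_length ::
    "'k::t2_space monoid \<Rightarrow> ('k, 'e::hausdorff_lcs) chart set \<Rightarrow> ('k, 'e) chart \<Rightarrow> ('e \<Rightarrow> real) \<Rightarrow>
      real \<Rightarrow> real \<Rightarrow> (real \<Rightarrow> 'k) \<Rightarrow> real"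
  where "arc_length G A c0 \<mu> a b \<gamma> = set_lebesgue_integral lebesgue {a..b} (speed G A c0 \<mu> \<gamma>)"

text \<open>Besides differentiability almost everywhere, local absolute continuity in charts is
  required, as always for rectifiable curves: without it Cantor staircases would be admitted as
  curves of length zero, and for instance all distances in the Euclidean plane would vanish.\<close>

definition chart_abs_continuous ::
    "('m, 'e::{real_vector,topological_space}) chart set \<Rightarrow> real \<Rightarrow> real \<Rightarrow> (real \<Rightarrow> 'm) \<Rightarrow> bool"
  where "chart_abs_continuous A a b \<gamma> \<longleftrightarrow>
    (\<forall>t\<in>{a..b}. \<exists>\<epsilon>>0. \<exists>c\<in>A. \<gamma> ` ({a..b} \<inter> {t - \<epsilon>..t + \<epsilon>}) \<subseteq> fst c \<and>
      abs_continuous_on ({a..b} \<inter> {t - \<epsilon>..t + \<epsilon>}) (snd c \<circ> \<gamma>))"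

definition rectifiable ::
    "'k::t2_space monoid \<Rightarrow> ('k, 'e::hausdorff_lcs) chart set \<Rightarrow> ('k, 'e) chart \<Rightarrow> ('e \<Rightarrow> real) \<Rightarrow>
      real \<Rightarrow> real \<Rightarrow> (real \<Rightarrow> 'k) \<Rightarrow> bool"
  where "rectifiable G A c0 \<mu> a b \<gamma> \<longleftrightarrow> continuous_on {a..b} \<gamma> \<and> chart_abs_continuous A a b \<gamma> \<and>
    (AE t in lebesgue. t \<in> {a..b} \<longrightarrow>
      (\<exists>c\<in>A. \<gamma> t \<in> fst c \<and> (\<exists>w. has_dir_deriv (snd c \<circ> \<gamma>) t 1 w))) \<and>
    set_integrable lebesgue {a..b} (speed G A c0 \<mu> \<gamma>)"

text \<open>Infinite if there is no rectifiable arc from \<open>g\<close> to \<open>h\<close>.\<close>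

definition finsler_dist ::
    "'k::t2_space monoid \<Rightarrow> ('k, 'e::hausdorff_lcs) chart set \<Rightarrow> ('k, 'e) chart \<Rightarrow> ('e \<Rightarrow> real) \<Rightarrow>
      'k \<Rightarrow> 'k \<Rightarrow> ereal"
  where "finsler_dist G A c0 \<mu> g h =
    Inf {ereal (arc_length G A c0 \<mu> a b \<gamma>) | a b \<gamma>.
      a < b \<and> rectifiable G A c0 \<mu> a b \<gamma> \<and> \<gamma> a = g \<and> \<gamma> b = h}"

definition short ::
    "'k::t2_space monoid \<Rightarrow> ('k, 'e::hausdorff_lcs) chart set \<Rightarrow> ('k, 'e) chart \<Rightarrow> ('e \<Rightarrow> real) \<Rightarrow>
      real \<Rightarrow> real \<Rightarrow> (real \<Rightarrow> 'k) \<Rightarrow> bool"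
  where "short G A c0 \<mu> a b \<gamma> \<longleftrightarrow>
    ereal (arc_length G A c0 \<mu> a b \<gamma>) = finsler_dist G A c0 \<mu> (\<gamma> a) (\<gamma> b)"

text \<open>\<open>\<gamma>\<close> on \<open>{a..b}\<close> as a reparametrization of \<open>\<delta>\<close> on \<open>{0..1}\<close>. The change of parameter need not
  be strictly increasing, as a short path may rest.\<close>

definition reparametrization :: "real \<Rightarrow> real \<Rightarrow> (real \<Rightarrow> 'k) \<Rightarrow> (real \<Rightarrow> 'k) \<Rightarrow> bool"
  where "reparametrization a b \<gamma> \<delta> \<longleftrightarrow>
    (\<exists>s. continuous_on {a..b} s \<and> mono_on {a..b} s \<and> s a = 0 \<and> s b = 1 \<and>
      (\<forall>t\<in>{a..b}. \<gamma> t = \<delta> (s t)))"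

definition segment :: "'k monoid \<Rightarrow> ('e::real_vector \<Rightarrow> 'k) \<Rightarrow> 'k \<Rightarrow> 'e \<Rightarrow> real \<Rightarrow> 'k"
  where "segment G ex u z t = u \<otimes>\<^bsub>G\<^esub> ex (t *\<^sub>R z)"

definition C1_diffeo_onto_open ::
    "('m::topological_space, 'e::{real_vector,t2_space}) chart set \<Rightarrow> 'm set \<Rightarrow>
      ('n::topological_space, 'f::{real_vector,t2_space}) chart set \<Rightarrow> ('m \<Rightarrow> 'n) \<Rightarrow> bool"
  where "C1_diffeo_onto_open A S B f \<longleftrightarrow> open (f ` S) \<and> inj_on f S \<and>
    mfd_map C1_on A S B f \<and> mfd_map C1_on B (f ` S) A (inv_into S f)"

end

theory Submission
  imports Defs
begin

text \<open>
  Let \<open>D\<^sub>x u\<close> be the derivative at \<open>t = 0\<close> of \<open>log (e\<^sup>x e\<^sup>t\<^sup>u)\<close>, and \<open>\<mu>'\<^sub>x\<close> the right derivative of \<open>\<mu>\<close> at \<open>x\<close>,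
  a sublinear function. The heart of the proof is \<open>\<mu>'\<^sub>x (D\<^sub>x u) \<le> \<mu>'\<^sub>x u\<close>. Since \<open>\<mu>\<close> is constant on
  \<open>Ad (e\<^sup>t\<^sup>v) x\<close>, whose exponential is \<open>e\<^sup>x\<close> times a commutator, \<open>\<mu>'\<^sub>x \<circ> D\<^sub>x\<close> is invariant under
  \<open>Ad (e\<^sup>-\<^sup>x)\<close>; writing \<open>e\<^sup>x e\<^sup>t\<^sup>u\<close> as a square then gives \<open>\<mu>'\<^sub>x \<circ> D\<^sub>x = \<mu>'\<^sub>x \<circ> D\<^sub>x\<^sub>/\<^sub>2\<close>, and \<open>D\<^sub>y\<close> tends to the
  identity as \<open>y\<close> tends to 0. No brackets, integrals of operators or norming functionals are needed.

  Consequently the norm of the logarithm of an arc grows at most with the speed of the arc. On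
  sufficiently small pieces of a short arc the length therefore equals the norm of the
  logarithm, because the piece may be replaced by a segment. If \<open>\<mu>\<close> of the logarithm of \<open>e\<^sup>x e\<^sup>y\<close> is
  \<open>\<mu> x + \<mu> y\<close>, then \<open>\<mu> y \<le> \<mu>'\<^sub>x (D\<^sub>x y) \<le> \<mu>'\<^sub>x y\<close>, so \<open>\<mu> (x + y) = \<mu> x + \<mu> y\<close> and \<open>y\<close> is a multiple of \<open>x\<close> by
  strict convexity: consecutive pieces have the same direction. The arc may rest, so the pieces
  are cut by arc length and not by the parameter.
\<close>

section \<open>Calculus in locally convex spaces\<close>

text \<open>The model space need not be complete, and \<mu> is only positively homogeneous: it may
  lack symmetry, and its balls are not assumed to generate the topology. So derivatives of \<mu> are
  one-sided and enter as inequalities, neighbourhoods are taken in the topology of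
  \<open>'e\<close>, and absolute continuity is measured by continuous seminorms. Moreover, small
  length does not at once mean closeness in the group: pieces that are small in the parameter serve
  to show that a stretch of zero length is a rest, and only then does compactness make pieces of
  small length close. Squares help because conjugation reorders factors: with
  \<open>g = e^(x/2)\<close>, the curve \<open>(g k)^2\<close> is \<open>g^2 (g^-1 k g) k\<close>,
  so \<open>u\<close> is \<open>Ad (g^-1) w + w\<close>, which a functional invariant under
  \<open>Ad (g^-1)\<close> cannot tell from \<open>2 w\<close>. Repeated halving thus does the work
  of the power series for the derivative of the exponential.\<close>

lemma tendsto_scaleR_lcs [tendsto_intros]:
  fixes g :: "'a \<Rightarrow> 'e::hausdorff_lcs"
  assumes "(f \<longlongrightarrow> c) F" "(g \<longlongrightarrow> x) F"
  shows "((\<lambda>t. f t *\<^sub>R g t) \<longlongrightarrow> c *\<^sub>R x) F"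
proof -
  have "filterlim (\<lambda>t. (f t, g t)) (nhds c \<times>\<^sub>F nhds x) F"
    using assms by (rule filterlim_Pair)
  from filterlim_compose[OF tendsto_scaleR_nhds this] show ?thesis by simp
qed

lemma open_translation_lcs:
  fixes V :: "'e::topological_ab_group_add set"
  assumes "open V"
  shows "open ((+) a ` V)"
proof -
  have "(+) a ` V = (\<lambda>x. x - a) -` V"
    by (auto simp: image_iff intro!: bexI[of _ "_ - a"])
  moreover have "continuous_on UNIV (\<lambda>x. x - a)"
    by (auto simp: continuous_on_def intro!: tendsto_intros)
  ultimately show ?thesis
    using assms by (simp add: open_vimage)
qed

lemma open_convex_nbhd:
  fixes x :: "'e::hausdorff_lcs"
  assumes "open U" "x \<in> U"
  obtains V where "open V" "0 \<in> V" "convex V" "(+) x ` V \<subseteq> U"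
proof -
  have *: "open ((+) (- x) ` U)" "0 \<in> (+) (- x) ` U"
    using assms by (rule_tac open_translation_lcs) (use assms in \<open>auto intro: image_eqI[of _ _ x]\<close>)
  obtain V where V: "open V" "0 \<in> V" "V \<subseteq> (+) (- x) ` U"
      "\<forall>x\<in>V. \<forall>y\<in>V. \<forall>s\<ge>0. \<forall>t\<ge>0. s + t = 1 \<longrightarrow> s *\<^sub>R x + t *\<^sub>R y \<in> V"
    using locally_convex_zero[OF *] by blast
  show ?thesis
  proof
    show "convex V" using V(4) by (auto simp: convex_def)
    show "(+) x ` V \<subseteq> U" using V(3) by auto
  qed (use V in auto)
qed

lemma open_convex_nbhd_diff:
  fixes x :: "'e::hausdorff_lcs"
  assumes "open U" "x \<in> U"
  obtains V where "open V" "0 \<in> V" "convex V" "\<And>y. y - x \<in> V \<Longrightarrow> y \<in> U"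
proof -
  from open_convex_nbhd[OF assms] obtain V where "open V" "0 \<in> V" "convex V" "(+) x ` V \<subseteq> U" .
  then show ?thesis
    by (intro that[of V]) (auto simp: image_subset_iff dest: bspec)
qed

section \<open>Products of Hausdorff locally convex spaces\<close>

instance prod :: (topological_monoid_add, topological_monoid_add) topological_monoid_add
proof
  fix a b :: "'a \<times> 'b"
  have "((\<lambda>x. (fst (fst x) + fst (snd x), snd (fst x) + snd (snd x))) \<longlongrightarrow>
      (fst a + fst b, snd a + snd b)) (nhds a \<times>\<^sub>F nhds b)"
    by (intro tendsto_Pair tendsto_add tendsto_fst tendsto_snd filterlim_fst filterlim_snd)
  then show "LIM x (nhds a \<times>\<^sub>F nhds b). fst x + snd x :> nhds (a + b)"
    by (simp add: plus_prod_def)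
qed

instance prod :: (topological_comm_monoid_add, topological_comm_monoid_add) topological_comm_monoid_add ..

instance prod :: (topological_group_add, topological_group_add) topological_group_add
proof
  fix a :: "'a \<times> 'b"
  have "((\<lambda>x. (- fst x, - snd x)) \<longlongrightarrow> (- fst a, - snd a)) (nhds a)"
    by (intro tendsto_Pair tendsto_minus tendsto_fst tendsto_snd filterlim_ident)
  then show "(uminus \<longlongrightarrow> - a) (nhds a)"
    by (simp add: uminus_prod_def[abs_def])
qed

instance prod :: (topological_ab_group_add, topological_ab_group_add) topological_ab_group_add ..

instance prod :: (hausdorff_lcs, hausdorff_lcs) hausdorff_lcs
proof
  fix c :: real and x :: "'a \<times> 'b"
  have "((\<lambda>p. (fst p *\<^sub>R fst (snd p), fst p *\<^sub>R snd (snd p))) \<longlongrightarrow>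
      (c *\<^sub>R fst x, c *\<^sub>R snd x)) (nhds c \<times>\<^sub>F nhds x)"
    by (intro tendsto_Pair tendsto_scaleR_lcs tendsto_fst tendsto_snd filterlim_fst filterlim_snd)
  then show "LIM p (nhds c \<times>\<^sub>F nhds x). fst p *\<^sub>R snd p :> nhds (c *\<^sub>R x)"
    by (simp add: scaleR_prod_def)
next
  fix U :: "('a \<times> 'b) set"
  assume U: "open U" "0 \<in> U"
  then obtain S T where ST: "open S" "open T" "0 \<in> S" "0 \<in> T" "S \<times> T \<subseteq> U"
    by (metis open_prod_elim mem_Sigma_iff zero_prod_def)
  obtain V where V: "open V" "0 \<in> V" "V \<subseteq> S"
      "\<forall>x\<in>V. \<forall>y\<in>V. \<forall>s\<ge>0. \<forall>t\<ge>0. s + t = 1 \<longrightarrow> s *\<^sub>R x + t *\<^sub>R y \<in> V"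
    using locally_convex_zero[OF ST(1,3)] by blast
  obtain W where W: "open W" "0 \<in> W" "W \<subseteq> T"
      "\<forall>x\<in>W. \<forall>y\<in>W. \<forall>s\<ge>0. \<forall>t\<ge>0. s + t = 1 \<longrightarrow> s *\<^sub>R x + t *\<^sub>R y \<in> W"
    using locally_convex_zero[OF ST(2,4)] by blast
  show "\<exists>V. open V \<and> 0 \<in> V \<and> V \<subseteq> U \<and>
        (\<forall>x\<in>V. \<forall>y\<in>V. \<forall>s\<ge>0. \<forall>t\<ge>0. s + t = 1 \<longrightarrow> s *\<^sub>R x + t *\<^sub>R y \<in> V)"
    using V W ST by (intro exI[of _ "V \<times> W"]) (auto simp: open_Times zero_prod_def)
qed

text \<open>In this form the mean value theorem needs neither integrals nor the Hahn-Banach theorem.\<close>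

lemma mean_value_convex:
  fixes g :: "real \<Rightarrow> 'e::hausdorff_lcs"
  assumes ab: "a \<le> b" and V: "open V" "convex V"
    and g': "\<And>s. s \<in> {a..b} \<Longrightarrow> has_dir_deriv g s 1 (g' s)" "\<And>s. s \<in> {a..b} \<Longrightarrow> g' s \<in> V"
  shows "\<exists>c\<in>V. g b - g a = (b - a) *\<^sub>R c"
proof -
  define P where "P u v \<longleftrightarrow> (a \<le> u \<and> v \<le> b \<longrightarrow> (\<exists>c\<in>V. g v - g u = (v - u) *\<^sub>R c))" for u v
  \<comment> \<open>The slope over a union of two adjacent intervals is the mean of the two slopes
    weighted by their lengths, so convexity of \<open>V\<close> passes the claim on and bisection
    reduces it to short intervals.\<close>
  have comb: "\<exists>c\<in>V. g w - g u = (w - u) *\<^sub>R c"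
    if "\<exists>c\<in>V. g v - g u = (v - u) *\<^sub>R c" "\<exists>c\<in>V. g w - g v = (w - v) *\<^sub>R c" "u \<le> v" "v \<le> w" for u v w
  proof (cases "u = w")
    case True
    then show ?thesis using that by auto
  next
    case False
    then have uw: "u < w" using that by auto
    from that obtain c d where c: "c \<in> V" "g v - g u = (v - u) *\<^sub>R c"
      and d: "d \<in> V" "g w - g v = (w - v) *\<^sub>R d" by auto
    have "((v - u) / (w - u)) *\<^sub>R c + ((w - v) / (w - u)) *\<^sub>R d \<in> V"
      using V(2) c d uw that
      by (intro convexD) (auto simp: field_simps add_divide_distrib[symmetric])
    moreover have "g w - g u = (w - u) *\<^sub>R (((v - u) / (w - u)) *\<^sub>R c + ((w - v) / (w - u)) *\<^sub>R d)"
    proof -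
      have "g w - g u = (v - u) *\<^sub>R c + (w - v) *\<^sub>R d"
        using c(2) d(2) by (metis add_diff_eq diff_add_cancel add.commute)
      then show ?thesis using uw by (simp add: scaleR_add_right)
    qed
    ultimately show ?thesis by blast
  qed
  have "P a b"
    using ab
  proof (induction rule: Bolzano)
    case (trans u v w)
    then show ?case unfolding P_def using comb[where u=u and v=v and w=w] by auto
  next
    case (local x)
    then have x: "x \<in> {a..b}" by simp
    have "eventually (\<lambda>h. (g (x + h *\<^sub>R 1) - g x) /\<^sub>R h \<in> V) (at 0)"
      using g'(1)[OF x, unfolded has_dir_deriv_def] V(1) g'(2)[OF x] by (rule topological_tendstoD)
    then obtain d where d: "d > 0" "\<And>h. h \<noteq> 0 \<Longrightarrow> \<bar>h\<bar> < d \<Longrightarrow> (g (x + h) - g x) /\<^sub>R h \<in> V"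
      unfolding eventually_at by (auto simp: dist_real_def)
    have *: "\<exists>c\<in>V. g (x + h) - g x = h *\<^sub>R c" if "\<bar>h\<bar> < d" for h
    proof (cases "h = 0")
      case True
      then show ?thesis using g'(2)[OF x] by auto
    next
      case False
      then show ?thesis using d(2)[OF False that]
        by (intro bexI[of _ "(g (x + h) - g x) /\<^sub>R h"]) auto
    qed
    have "P u v" if "u \<le> x" "x \<le> v" "v - u < d" for u v
      unfolding P_def
    proof
      show "\<exists>c\<in>V. g v - g u = (v - u) *\<^sub>R c"
      proof (rule comb)
        have "\<bar>u - x\<bar> < d" using that by arith
        from *[OF this] obtain c where c: "c \<in> V" "g u - g x = (u - x) *\<^sub>R c"
          by auto
        then have "g x - g u = (x - u) *\<^sub>R c"
          by (metis minus_diff_eq scaleR_minus_left)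
        with c show "\<exists>c\<in>V. g x - g u = (x - u) *\<^sub>R c" by auto
        show "\<exists>c\<in>V. g v - g x = (v - x) *\<^sub>R c"
          using *[of "v - x"] that by auto
      qed (use that in auto)
    qed
    then show ?case using d(1) by blast
  qed
  then show ?thesis by (simp add: P_def)
qed

text \<open>Strict differentiability composes without any estimate, and it follows from continuous
  differentiability.\<close>

definition sdiff ::
    "('e::{real_vector,topological_space} \<Rightarrow> 'f::{real_vector,topological_space}) \<Rightarrow> 'e \<Rightarrow> ('e \<Rightarrow> 'f) \<Rightarrow> bool"
  where "sdiff f x D \<longleftrightarrow>
    (\<forall>v. ((\<lambda>(y, w, h). (f (y + h *\<^sub>R w) - f y) /\<^sub>R h) \<longlongrightarrow> D v) (nhds x \<times>\<^sub>F nhds v \<times>\<^sub>F at (0::real)))"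

lemma sdiffD:
  assumes "sdiff f x D" "(y \<longlongrightarrow> x) F" "(w \<longlongrightarrow> v) F" "filterlim h (at (0::real)) F"
  shows "((\<lambda>t. (f (y t + h t *\<^sub>R w t) - f (y t)) /\<^sub>R h t) \<longlongrightarrow> D v) F"
proof -
  have "filterlim (\<lambda>t. (y t, w t, h t)) (nhds x \<times>\<^sub>F nhds v \<times>\<^sub>F at 0) F"
    using assms by (intro filterlim_Pair)
  from filterlim_compose[OF assms(1)[unfolded sdiff_def, rule_format] this]
  show ?thesis by simp
qed

lemma sdiff_imp_has_dir_deriv: "sdiff f x D \<Longrightarrow> has_dir_deriv f x v (D v)"
  unfolding has_dir_deriv_def by (rule sdiffD) (auto intro: tendsto_const filterlim_ident)

lemma has_dir_deriv_unique:
  fixes f :: "'e::{real_vector,topological_space} \<Rightarrow> 'f::{real_vector,t2_space}"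
  assumes "has_dir_deriv f x v w" "has_dir_deriv f x v w'"
  shows "w = w'"
  using assms unfolding has_dir_deriv_def by (intro tendsto_unique[of "at (0::real)"]) auto

lemma dir_deriv_eqI:
  fixes f :: "'e::{real_vector,topological_space} \<Rightarrow> 'f::{real_vector,t2_space}"
  assumes "has_dir_deriv f x v w"
  shows "dir_deriv f x v = w"
  using assms unfolding has_dir_deriv_def dir_deriv_def by (intro tendsto_Lim) auto

text \<open>The increment along \<open>v + w\<close> is split at \<open>x + h v\<close>. The second
  part starts at a moving base point, which is exactly what strictness admits.\<close>

lemma sdiff_add:
  fixes f :: "'e::hausdorff_lcs \<Rightarrow> 'f::hausdorff_lcs"
  assumes "sdiff f x D"
  shows "D (v + w) = D v + D w"
proof -
  have id: "filterlim (\<lambda>h. h) (at 0) (at (0::real))" by (rule filterlim_ident)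
  have tid: "((\<lambda>h. h) \<longlongrightarrow> 0) (at (0::real))" by (rule tendsto_ident_at)
  have "((\<lambda>h. x + h *\<^sub>R v) \<longlongrightarrow> x + 0 *\<^sub>R v) (at (0::real))"
    by (intro tendsto_add tendsto_scaleR_lcs tendsto_const tid)
  then have *: "((\<lambda>h. x + h *\<^sub>R v) \<longlongrightarrow> x) (at (0::real))" by simp
  have "((\<lambda>h. (f ((x + h *\<^sub>R v) + h *\<^sub>R w) - f (x + h *\<^sub>R v)) /\<^sub>R h) \<longlongrightarrow> D w) (at 0)"
    by (rule sdiffD[OF assms * tendsto_const id])
  moreover have "((\<lambda>h. (f (x + h *\<^sub>R v) - f x) /\<^sub>R h) \<longlongrightarrow> D v) (at 0)"
    by (rule sdiffD[OF assms tendsto_const tendsto_const id])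
  ultimately have "((\<lambda>h. (f (x + h *\<^sub>R v) - f x) /\<^sub>R h +
      (f ((x + h *\<^sub>R v) + h *\<^sub>R w) - f (x + h *\<^sub>R v)) /\<^sub>R h) \<longlongrightarrow> D v + D w) (at 0)"
    by (intro tendsto_add)
  then have "((\<lambda>h. (f (x + h *\<^sub>R (v + w)) - f x) /\<^sub>R h) \<longlongrightarrow> D v + D w) (at 0)"
    by (simp add: scaleR_right_diff_distrib scaleR_add_right add.assoc)
  moreover have "((\<lambda>h. (f (x + h *\<^sub>R (v + w)) - f x) /\<^sub>R h) \<longlongrightarrow> D (v + w)) (at 0)"
    by (rule sdiffD[OF assms tendsto_const tendsto_const id])
  ultimately show ?thesis
    using tendsto_unique[of "at (0::real)"] by fastforce
qed

lemma sdiff_zero: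
  fixes f :: "'e::hausdorff_lcs \<Rightarrow> 'f::hausdorff_lcs"
  assumes "sdiff f x D"
  shows "D 0 = 0"
  using sdiff_add[OF assms, of 0 0] by simp

lemma sdiff_minus:
  fixes f :: "'e::hausdorff_lcs \<Rightarrow> 'f::hausdorff_lcs"
  assumes "sdiff f x D"
  shows "D (- v) = - D v"
  using sdiff_add[OF assms, of v "- v"] sdiff_zero[OF assms] by (simp add: minus_unique)

lemma sdiff_diff:
  fixes f :: "'e::hausdorff_lcs \<Rightarrow> 'f::hausdorff_lcs"
  assumes "sdiff f x D"
  shows "D (v - w) = D v - D w"
  using sdiff_add[OF assms, of v "- w"] sdiff_minus[OF assms, of w] by simp

lemma eventually_at_neq_0: "filterlim h (at (0::real)) F \<Longrightarrow> eventually (\<lambda>t. h t \<noteq> 0) F"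
  by (auto simp: filterlim_at)

text \<open>The difference quotient of \<open>f\<close> serves as the moving direction in the
  quotient of \<open>g\<close>, and \<open>f y\<close> as its moving base point; continuity of
  \<open>f\<close> makes the latter converge.\<close>

lemma sdiff_compose:
  fixes f :: "'e::{real_vector,t2_space} \<Rightarrow> 'f::{real_vector,topological_space}"
  assumes f: "sdiff f x D" "isCont f x" and g: "sdiff g (f x) D'"
  shows "sdiff (g \<circ> f) x (D' \<circ> D)"
  unfolding sdiff_def
proof
  fix v :: 'e
  let ?F = "nhds x \<times>\<^sub>F nhds v \<times>\<^sub>F at (0::real)"
  have y: "(fst \<longlongrightarrow> x) ?F" by (rule filterlim_fst)
  have h: "filterlim (\<lambda>p. snd (snd p)) (at 0) ?F"
    by (rule filterlim_compose[OF filterlim_snd filterlim_snd])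
  have "(f \<longlongrightarrow> f x) (nhds x)"
    using f(2) by (simp add: isCont_def tendsto_at_iff_tendsto_nhds)
  from filterlim_compose[OF this y] have fy: "((\<lambda>p. f (fst p)) \<longlongrightarrow> f x) ?F" .
  have "((\<lambda>p. (f (fst p + snd (snd p) *\<^sub>R fst (snd p)) - f (fst p)) /\<^sub>R snd (snd p)) \<longlongrightarrow> D v) ?F"
    using f(1) unfolding sdiff_def by (simp add: case_prod_beta')
  from sdiffD[OF g fy this h]
  show "((\<lambda>(y, w, h). ((g \<circ> f) (y + h *\<^sub>R w) - (g \<circ> f) y) /\<^sub>R h) \<longlongrightarrow> (D' \<circ> D) v) ?F"
    unfolding case_prod_beta comp_apply
    by (rule Lim_transform_eventually) (use eventually_at_neq_0[OF h] in \<open>auto elim!: eventually_mono\<close>)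
qed

lemma has_dir_deriv_compose:
  assumes f: "has_dir_deriv f x v w" and g: "sdiff g (f x) D'"
  shows "has_dir_deriv (g \<circ> f) x v (D' w)"
proof -
  have id: "filterlim (\<lambda>h. h) (at 0) (at (0::real))" by (rule filterlim_ident)
  from sdiffD[OF g tendsto_const f[unfolded has_dir_deriv_def] id]
  show ?thesis unfolding has_dir_deriv_def
    by (rule Lim_transform_eventually) (use eventually_at_neq_0[OF id] in \<open>auto elim!: eventually_mono\<close>)
qed

lemma has_dir_deriv_cong:
  assumes "has_dir_deriv f t 1 w" "eventually (\<lambda>s. f s = g s) (nhds t)"
  shows "has_dir_deriv g (t::real) 1 w"
proof -
  have ft: "f t = g t" using assms(2) by (rule eventually_nhds_x_imp_x)
  have "((\<lambda>h. t + h) \<longlongrightarrow> t + 0) (at 0)" by (intro tendsto_intros)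
  then have "filterlim (\<lambda>h. t + h) (nhds t) (at 0)" by simp
  from eventually_compose_filterlim[OF assms(2) this]
  have "eventually (\<lambda>h. f (t + h) = g (t + h)) (at 0)" .
  then have "eventually (\<lambda>h. (f (t + h *\<^sub>R 1) - f t) /\<^sub>R h = (g (t + h *\<^sub>R 1) - g t) /\<^sub>R h) (at 0)"
    by eventually_elim (simp add: ft)
  from Lim_transform_eventually[OF assms(1)[unfolded has_dir_deriv_def] this]
  show ?thesis unfolding has_dir_deriv_def .
qed

lemma sdiff_cong:
  fixes f :: "'e::hausdorff_lcs \<Rightarrow> 'f::hausdorff_lcs"
  assumes "sdiff f x D" "eventually (\<lambda>y. f y = g y) (nhds x)"
  shows "sdiff g x D"
  unfolding sdiff_def
proof
  fix v :: 'e
  let ?F = "nhds x \<times>\<^sub>F nhds v \<times>\<^sub>F at (0::real)"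
  have y: "(fst \<longlongrightarrow> x) ?F" by (rule filterlim_fst)
  have h: "filterlim (\<lambda>p. snd (snd p)) (at 0) ?F"
    by (rule filterlim_compose[OF filterlim_snd filterlim_snd])
  have h': "((\<lambda>p. snd (snd p)) \<longlongrightarrow> 0) ?F" using h by (simp add: filterlim_at)
  have w: "((\<lambda>p. fst (snd p)) \<longlongrightarrow> v) ?F"
    by (rule filterlim_compose[OF filterlim_fst filterlim_snd])
  have "((\<lambda>p. fst p + snd (snd p) *\<^sub>R fst (snd p)) \<longlongrightarrow> x + 0 *\<^sub>R v) ?F"
    by (intro tendsto_add tendsto_scaleR_lcs h' y w)
  then have "((\<lambda>p. fst p + snd (snd p) *\<^sub>R fst (snd p)) \<longlongrightarrow> x) ?F" by simp
  from eventually_compose_filterlim[OF assms(2) this]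
  have "eventually (\<lambda>p. f (fst p + snd (snd p) *\<^sub>R fst (snd p)) = g (fst p + snd (snd p) *\<^sub>R fst (snd p))) ?F" .
  moreover have "eventually (\<lambda>p. f (fst p) = g (fst p)) ?F"
    by (rule eventually_compose_filterlim[OF assms(2) y])
  ultimately have "eventually (\<lambda>p. (f (fst p + snd (snd p) *\<^sub>R fst (snd p)) - f (fst p)) /\<^sub>R snd (snd p) =
     (g (fst p + snd (snd p) *\<^sub>R fst (snd p)) - g (fst p)) /\<^sub>R snd (snd p)) ?F"
    by eventually_elim simp
  moreover have "((\<lambda>p. (f (fst p + snd (snd p) *\<^sub>R fst (snd p)) - f (fst p)) /\<^sub>R snd (snd p)) \<longlongrightarrow> D v) ?F"
    using assms(1) unfolding sdiff_def by (simp add: case_prod_beta')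
  ultimately show "((\<lambda>(y, w, h). (g (y + h *\<^sub>R w) - g y) /\<^sub>R h) \<longlongrightarrow> D v) ?F"
    unfolding case_prod_beta by (rule Lim_transform_eventually[rotated])
qed

lemma sdiff_id:
  fixes x :: "'e::{real_vector,topological_space}"
  shows "sdiff id x id"
  unfolding sdiff_def
proof
  fix v :: 'e
  let ?F = "nhds x \<times>\<^sub>F nhds v \<times>\<^sub>F at (0::real)"
  have h: "filterlim (\<lambda>p. snd (snd p)) (at 0) ?F"
    by (rule filterlim_compose[OF filterlim_snd filterlim_snd])
  have w: "((\<lambda>p. fst (snd p)) \<longlongrightarrow> v) ?F"
    by (rule filterlim_compose[OF filterlim_fst filterlim_snd])
  show "((\<lambda>(y, w, h). (id (y + h *\<^sub>R w) - id y) /\<^sub>R h) \<longlongrightarrow> id v) ?F"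
    unfolding case_prod_beta
    by (rule Lim_transform_eventually[where f="\<lambda>p. fst (snd p)"])
      (use w eventually_at_neq_0[OF h] in \<open>auto elim!: eventually_mono\<close>)
qed

lemma sdiff_const: "sdiff (\<lambda>_. c) x (\<lambda>_. 0)"
  unfolding sdiff_def by (simp add: case_prod_beta' tendsto_const)

lemma sdiff_Pair:
  assumes "sdiff f x D" "sdiff g x D'"
  shows "sdiff (\<lambda>y. (f y, g y)) x (\<lambda>v. (D v, D' v))"
  using assms unfolding sdiff_def case_prod_beta
  by (auto intro!: tendsto_Pair simp: scaleR_prod_def)

lemma sdiff_scaleR_left:
  fixes v :: "'e::hausdorff_lcs"
  shows "sdiff (\<lambda>y. c *\<^sub>R y) v (\<lambda>w. c *\<^sub>R w)"
  unfolding sdiff_def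
proof
  fix u :: 'e
  let ?F = "nhds v \<times>\<^sub>F nhds u \<times>\<^sub>F at (0::real)"
  have h: "filterlim (\<lambda>p. snd (snd p)) (at 0) ?F"
    by (rule filterlim_compose[OF filterlim_snd filterlim_snd])
  have w: "((\<lambda>p. fst (snd p)) \<longlongrightarrow> u) ?F"
    by (rule filterlim_compose[OF filterlim_fst filterlim_snd])
  have "((\<lambda>p. c *\<^sub>R fst (snd p)) \<longlongrightarrow> c *\<^sub>R u) ?F"
    by (intro tendsto_scaleR_lcs tendsto_const w)
  then show "((\<lambda>(y, w, h). (c *\<^sub>R (y + h *\<^sub>R w) - c *\<^sub>R y) /\<^sub>R h) \<longlongrightarrow> c *\<^sub>R u) ?F"
    unfolding case_prod_beta
    by (rule Lim_transform_eventually)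
      (rule eventually_mono[OF eventually_at_neq_0[OF h]], simp add: scaleR_add_right)
qed

lemma sdiff_fst: "sdiff f x D \<Longrightarrow> sdiff (\<lambda>y. fst (f y)) x (\<lambda>v. fst (D v))"
  and sdiff_snd: "sdiff f x D \<Longrightarrow> sdiff (\<lambda>y. snd (f y)) x (\<lambda>v. snd (D v))"
proof -
  assume *: "sdiff f x D"
  show "sdiff (\<lambda>y. fst (f y)) x (\<lambda>v. fst (D v))"
    unfolding sdiff_def
  proof
    fix v
    from tendsto_fst[OF *[unfolded sdiff_def, rule_format, of v]]
    show "((\<lambda>(y, w, h). (fst (f (y + h *\<^sub>R w)) - fst (f y)) /\<^sub>R h) \<longlongrightarrow> fst (D v)) (nhds x \<times>\<^sub>F nhds v \<times>\<^sub>F at 0)"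
      by (simp add: case_prod_beta')
  qed
  show "sdiff (\<lambda>y. snd (f y)) x (\<lambda>v. snd (D v))"
    unfolding sdiff_def
  proof
    fix v
    from tendsto_snd[OF *[unfolded sdiff_def, rule_format, of v]]
    show "((\<lambda>(y, w, h). (snd (f (y + h *\<^sub>R w)) - snd (f y)) /\<^sub>R h) \<longlongrightarrow> snd (D v)) (nhds x \<times>\<^sub>F nhds v \<times>\<^sub>F at 0)"
      by (simp add: case_prod_beta')
  qed
qed

lemma sdiff_real_scaleR: "sdiff (\<lambda>r::real. (r - s) *\<^sub>R w) r (\<lambda>k. k *\<^sub>R (w::'e::hausdorff_lcs))"
  unfolding sdiff_def
proof
  fix u :: real
  let ?F = "nhds r \<times>\<^sub>F nhds u \<times>\<^sub>F at (0::real)"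
  have h: "filterlim (\<lambda>p. snd (snd p)) (at 0) ?F"
    by (rule filterlim_compose[OF filterlim_snd filterlim_snd])
  have k: "((\<lambda>p. fst (snd p)) \<longlongrightarrow> u) ?F"
    by (rule filterlim_compose[OF filterlim_fst filterlim_snd])
  have "((\<lambda>p. fst (snd p) *\<^sub>R w) \<longlongrightarrow> u *\<^sub>R w) ?F"
    by (intro tendsto_scaleR_lcs tendsto_const k)
  then show "((\<lambda>(y, k, h). ((y + h *\<^sub>R k - s) *\<^sub>R w - (y - s) *\<^sub>R w) /\<^sub>R h) \<longlongrightarrow> u *\<^sub>R w) ?F"
    unfolding case_prod_beta
    by (rule Lim_transform_eventually)
      (rule eventually_mono[OF eventually_at_neq_0[OF h]], simp add: scaleR_diff_left[symmetric])
qed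

text \<open>By the mean value theorem the difference quotient lies in any open convex set that
  contains the derivatives along the segment from \<open>y\<close> to \<open>y + h w\<close>. Joint
  continuity of the derivative provides a product neighbourhood on which these are close to the
  derivative at \<open>x\<close>, and a convex neighbourhood keeps the whole segment inside.\<close>

lemma C1_on_imp_sdiff:
  fixes f :: "'e::hausdorff_lcs \<Rightarrow> 'f::hausdorff_lcs"
  assumes f: "C1_on U f" and U: "open U" "x \<in> U"
  shows "sdiff f x (dir_deriv f x)"
  unfolding sdiff_def
proof
  fix v :: 'e
  let ?F = "nhds x \<times>\<^sub>F nhds v \<times>\<^sub>F at (0::real)"
  show "((\<lambda>(y, w, h). (f (y + h *\<^sub>R w) - f y) /\<^sub>R h) \<longlongrightarrow> dir_deriv f x v) ?F"
  proof (rule topological_tendstoI)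
    fix S assume S: "open S" "dir_deriv f x v \<in> S"
    from open_convex_nbhd[OF S] obtain W where W: "open W" "0 \<in> W" "convex W"
      "(+) (dir_deriv f x v) ` W \<subseteq> S" .
    let ?W = "(+) (dir_deriv f x v) ` W"
    have oW: "open ?W" "convex ?W" "dir_deriv f x v \<in> ?W"
      using W by (auto intro: open_translation_lcs convex_translation simp: image_iff intro!: bexI[of _ 0])
    have "continuous_on (U \<times> UNIV) (\<lambda>(x, v). dir_deriv f x v)"
      using f by (simp add: C1_on_def)
    then have "open ((\<lambda>(x, v). dir_deriv f x v) -` ?W \<inter> U \<times> UNIV)"
      using U oW(1) by (simp add: continuous_on_open_vimage open_Times)
    moreover have "(x, v) \<in> (\<lambda>(x, v). dir_deriv f x v) -` ?W \<inter> U \<times> UNIV"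
      using U oW by auto
    ultimately obtain A B where AB': "open A" "open B" "(x, v) \<in> A \<times> B"
        "A \<times> B \<subseteq> (\<lambda>(x, v). dir_deriv f x v) -` ?W \<inter> U \<times> UNIV"
      by (rule open_prod_elim)
    then have AB: "open A" "open B" "x \<in> A" "v \<in> B"
        "A \<times> B \<subseteq> (\<lambda>(x, v). dir_deriv f x v) -` ?W \<inter> U \<times> UNIV" by auto
    have df: "y \<in> U" "dir_deriv f y w \<in> ?W" if "y \<in> A" "w \<in> B" for y w
      using AB(5) that by (auto simp: subset_iff)
    obtain V where V: "open V" "0 \<in> V" "convex V" "\<And>y. y - x \<in> V \<Longrightarrow> y \<in> A"
      using open_convex_nbhd_diff[OF AB(1,3)] by blast
    have y: "(fst \<longlongrightarrow> x) ?F" by (rule filterlim_fst)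
    have h: "filterlim (\<lambda>p. snd (snd p)) (at 0) ?F"
      by (rule filterlim_compose[OF filterlim_snd filterlim_snd])
    have h': "((\<lambda>p. snd (snd p)) \<longlongrightarrow> 0) ?F" using h by (simp add: filterlim_at)
    have w: "((\<lambda>p. fst (snd p)) \<longlongrightarrow> v) ?F"
      by (rule filterlim_compose[OF filterlim_fst filterlim_snd])
    have "((\<lambda>p. fst p + snd (snd p) *\<^sub>R fst (snd p) - x) \<longlongrightarrow> x + 0 *\<^sub>R v - x) ?F"
      by (intro tendsto_add tendsto_diff tendsto_scaleR_lcs h' y w tendsto_const)
    then have e1: "eventually (\<lambda>p. fst p + snd (snd p) *\<^sub>R fst (snd p) - x \<in> V) ?F"
      using V by (intro topological_tendstoD) auto
    have "((\<lambda>p. fst p - x) \<longlongrightarrow> x - x) ?F"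
      by (intro tendsto_diff y tendsto_const)
    then have e2: "eventually (\<lambda>p. fst p - x \<in> V) ?F"
      using V by (intro topological_tendstoD) auto
    have e3: "eventually (\<lambda>p. fst (snd p) \<in> B) ?F"
      using w AB by (intro topological_tendstoD) auto
    have e4: "eventually (\<lambda>p. snd (snd p) \<noteq> 0) ?F"
      by (rule eventually_at_neq_0[OF h])
    from e1 e2 e3 e4
    show "eventually (\<lambda>p. (case p of (y, w, h) \<Rightarrow> (f (y + h *\<^sub>R w) - f y) /\<^sub>R h) \<in> S) ?F"
    proof eventually_elim
      case (elim p)
      obtain y w h where p: "p = (y, w, h)" by (cases p)
      \<comment> \<open>Dividing by \<open>h\<close> lets \<open>s\<close> run over the unit
        interval for either sign of \<open>h\<close>, and makes the derivative of \<open>g\<close>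
        that of \<open>f\<close> in direction \<open>w\<close>.\<close>
      define g where "g s = (f (y + (s * h) *\<^sub>R w)) /\<^sub>R h" for s
      have inA: "y + (s * h) *\<^sub>R w \<in> A" if s: "s \<in> {0..1}" for s
      proof (rule V(4))
        have "(1 - s) *\<^sub>R (y - x) + s *\<^sub>R (y + h *\<^sub>R w - x) \<in> V"
          using V(3) elim p s by (intro convexD) auto
        then show "y + (s * h) *\<^sub>R w - x \<in> V"
          by (simp add: algebra_simps)
      qed
      have "\<exists>c\<in>?W. g 1 - g 0 = (1 - 0) *\<^sub>R c"
      proof (rule mean_value_convex)
        fix s :: real assume s: "s \<in> {0..1}"
        let ?y = "y + (s * h) *\<^sub>R w"
        show "dir_deriv f ?y w \<in> ?W"
          using df(2)[OF inA[OF s]] elim p by auto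
        have "has_dir_deriv f ?y w (dir_deriv f ?y w)"
          using f df(1)[OF inA[OF s]] elim p by (auto simp: C1_on_def)
        then have *: "((\<lambda>k. (f (?y + k *\<^sub>R w) - f ?y) /\<^sub>R k) \<longlongrightarrow> dir_deriv f ?y w) (at 0)"
          by (simp add: has_dir_deriv_def)
        have h0: "h \<noteq> 0" using elim p by auto
        have "((\<lambda>k. k * h) \<longlongrightarrow> 0 * h) (at 0)"
          by (intro tendsto_intros)
        then have "filterlim (\<lambda>k. k * h) (at 0) (at 0)"
          using h0 by (auto simp: filterlim_at eventually_at intro: exI[of _ 1])
        from filterlim_compose[OF * this]
        have "((\<lambda>k. (f (?y + (k * h) *\<^sub>R w) - f ?y) /\<^sub>R (k * h)) \<longlongrightarrow> dir_deriv f ?y w) (at 0)" .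
        then show "has_dir_deriv g s 1 (dir_deriv f ?y w)"
          unfolding has_dir_deriv_def g_def
          by (simp add: scaleR_right_diff_distrib scaleR_add_left add.assoc distrib_right)
      qed (use oW in auto)
      then have "g 1 - g 0 \<in> ?W" by auto
      then have "(f (y + h *\<^sub>R w) - f y) /\<^sub>R h \<in> ?W"
        by (simp add: g_def scaleR_diff_right)
      then show ?case using W(4) p by auto
    qed
  qed
qed

lemma has_dir_deriv_imp_isCont:
  fixes f :: "real \<Rightarrow> 'e::hausdorff_lcs"
  assumes "has_dir_deriv f t 1 w"
  shows "isCont f t"
proof -
  have "((\<lambda>h. h *\<^sub>R ((f (t + h) - f t) /\<^sub>R h) + f t) \<longlongrightarrow> 0 *\<^sub>R w + f t) (at 0)"
    using assms unfolding has_dir_deriv_def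
    by (intro tendsto_add tendsto_scaleR_lcs tendsto_ident_at tendsto_const) auto
  then have "((\<lambda>h. h *\<^sub>R ((f (t + h) - f t) /\<^sub>R h) + f t) \<longlongrightarrow> f t) (at 0)"
    by simp
  then have "((\<lambda>h. f (t + h)) \<longlongrightarrow> f t) (at 0)"
    by (rule Lim_transform_eventually) (auto simp: eventually_at intro!: exI[of _ 1])
  then show ?thesis by (simp add: isCont_iff)
qed

text \<open>A nonzero mean slope could be avoided by a convex neighbourhood of 0, as the space is
  Hausdorff and locally convex; the mean value theorem forbids this.\<close>

lemma zero_derivative_imp_const:
  fixes g :: "real \<Rightarrow> 'e::hausdorff_lcs"
  assumes "a \<le> b" "\<And>s. s \<in> {a..b} \<Longrightarrow> has_dir_deriv g s 1 0"
  shows "g b = g a"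
proof (rule ccontr)
  assume "g b \<noteq> g a"
  then have "a < b" using assms(1) by (cases "a = b") auto
  let ?z = "(g b - g a) /\<^sub>R (b - a)"
  have "?z \<noteq> 0" using \<open>g b \<noteq> g a\<close> \<open>a < b\<close> by simp
  then have "open (- {?z})" "0 \<in> - {?z}" by auto
  from open_convex_nbhd[OF this] obtain V where V: "open V" "0 \<in> V" "convex V" "(+) 0 ` V \<subseteq> - {?z}" .
  obtain c where "c \<in> V" "g b - g a = (b - a) *\<^sub>R c"
    using mean_value_convex[OF assms(1) V(1,3) assms(2) V(2)] by auto
  then have "?z = c" using \<open>a < b\<close> by simp
  then show False using V(4) \<open>c \<in> V\<close> by auto
qed

section \<open>Differentiability at a point of maps between manifolds\<close>

lemma is_chartD:
  assumes "is_chart c"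
  shows chart_open: "open (fst c)"
    and chart_open_image: "open (snd c ` fst c)"
    and chart_inv_apply [simp]: "x \<in> fst c \<Longrightarrow> chart_inv c (snd c x) = x"
    and continuous_on_chart: "continuous_on (fst c) (snd c)"
    and continuous_on_chart_inv: "continuous_on (snd c ` fst c) (chart_inv c)"
  using assms unfolding is_chart_def homeomorphism_def by blast+

lemma chart_apply_inv: "y \<in> snd c ` fst c \<Longrightarrow> snd c (chart_inv c y) = y"
  unfolding chart_inv_def by (rule f_inv_into_f)

lemma isCont_chart:
  fixes c :: "('m::t2_space, 'e::t2_space) chart"
  assumes "is_chart c" "x \<in> fst c"
  shows "isCont (snd c) x"
  using continuous_on_interior[OF continuous_on_chart[OF assms(1)]] chart_open[OF assms(1)] assms(2)
  by (simp add: interior_open)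

lemma isCont_chart_inv:
  fixes c :: "('m::t2_space, 'e::t2_space) chart"
  assumes "is_chart c" "x \<in> fst c"
  shows "isCont (chart_inv c) (snd c x)"
  using continuous_on_interior[OF continuous_on_chart_inv[OF assms(1)]] chart_open_image[OF assms(1)] assms(2)
  by (simp add: interior_open)

lemma isCont_eventually:
  fixes f :: "'a::t2_space \<Rightarrow> 'b::topological_space"
  assumes "isCont f x" "eventually P (nhds (f x))"
  shows "eventually (\<lambda>y. P (f y)) (nhds x)"
  using assms(1) by (intro eventually_compose_filterlim[OF assms(2)])
    (simp add: isCont_def tendsto_at_iff_tendsto_nhds)

lemma eventually_chart_inv:
  fixes c :: "('m::t2_space, 'e::t2_space) chart"
  assumes "is_chart c" "x \<in> fst c" "eventually P (nhds x)"
  shows "eventually (\<lambda>y. P (chart_inv c y)) (nhds (snd c x))"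
  by (rule isCont_eventually[OF isCont_chart_inv]) (use assms in auto)

text \<open>Continuity is demanded in the manifold itself: outside its domain a coordinate map has
  arbitrary values, so the coordinate expression alone would not keep \<open>f\<close> inside the
  target chart. The same holds for \<open>cdiff\<close>.\<close>

definition mdiff ::
    "('m::t2_space, 'e::hausdorff_lcs) chart \<Rightarrow> ('n::t2_space, 'f::hausdorff_lcs) chart \<Rightarrow>
      ('m \<Rightarrow> 'n) \<Rightarrow> 'm \<Rightarrow> ('e \<Rightarrow> 'f) \<Rightarrow> bool"
  where "mdiff c d f x D \<longleftrightarrow> x \<in> fst c \<and> f x \<in> fst d \<and> isCont f x \<and>
    sdiff (snd d \<circ> f \<circ> chart_inv c) (snd c x) D"

definition cdiff ::
    "('n::t2_space, 'f::hausdorff_lcs) chart \<Rightarrow> (real \<Rightarrow> 'n) \<Rightarrow> real \<Rightarrow> 'f \<Rightarrow> bool"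
  where "cdiff d \<gamma> t w \<longleftrightarrow> \<gamma> t \<in> fst d \<and> isCont \<gamma> t \<and> has_dir_deriv (snd d \<circ> \<gamma>) t 1 w"

lemma cdiff_unique: "cdiff d \<gamma> t w \<Longrightarrow> cdiff d \<gamma> t w' \<Longrightarrow> w = w'"
  unfolding cdiff_def using has_dir_deriv_unique by blast

lemma mdiff_add: "mdiff c d f x D \<Longrightarrow> D (v + w) = D v + D w"
  and mdiff_zero: "mdiff c d f x D \<Longrightarrow> D 0 = 0"
  and mdiff_diff: "mdiff c d f x D \<Longrightarrow> D (v - w) = D v - D w"
  unfolding mdiff_def using sdiff_add sdiff_zero sdiff_diff by blast+

lemma mdiff_compose:
  assumes f: "mdiff c d f x D" and g: "mdiff d e g (f x) D'" and c: "is_chart c" "is_chart d"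
  shows "mdiff c e (\<lambda>y. g (f y)) x (\<lambda>v. D' (D v))"
proof -
  let ?f = "snd d \<circ> f \<circ> chart_inv c" and ?g = "snd e \<circ> g \<circ> chart_inv d"
  have x: "x \<in> fst c" "f x \<in> fst d" "isCont f x" using f by (auto simp: mdiff_def)
  have fx: "?f (snd c x) = snd d (f x)" using x c by simp
  have "isCont (f \<circ> chart_inv c) (snd c x)"
    unfolding comp_def by (rule isCont_o2[OF isCont_chart_inv]) (use x c in auto)
  then have "isCont (snd d \<circ> (f \<circ> chart_inv c)) (snd c x)"
    unfolding comp_def by (rule isCont_o2) (use x c in \<open>auto intro: isCont_chart\<close>)
  then have "isCont ?f (snd c x)" by (simp add: o_assoc)
  moreover have "sdiff ?f (snd c x) D" using f by (simp add: mdiff_def)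
  moreover have "sdiff ?g (?f (snd c x)) D'" using g unfolding fx by (simp add: mdiff_def)
  ultimately have "sdiff (?g \<circ> ?f) (snd c x) (D' \<circ> D)" by (intro sdiff_compose)
  moreover have "eventually (\<lambda>y. (?g \<circ> ?f) y = (snd e \<circ> (\<lambda>y. g (f y)) \<circ> chart_inv c) y) (nhds (snd c x))"
  proof -
    have "eventually (\<lambda>y. f y \<in> fst d) (nhds x)"
      by (rule isCont_eventually[OF x(3), where P="\<lambda>z. z \<in> fst d"])
        (use x c in \<open>auto intro: eventually_nhds_in_open chart_open\<close>)
    from eventually_chart_inv[OF c(1) x(1) this]
    show ?thesis by eventually_elim (simp add: c)
  qed
  ultimately have "sdiff (snd e \<circ> (\<lambda>y. g (f y)) \<circ> chart_inv c) (snd c x) (D' \<circ> D)"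
    by (rule sdiff_cong)
  moreover have "isCont (\<lambda>y. g (f y)) x"
    using g by (intro isCont_o2[OF x(3)]) (simp add: mdiff_def)
  ultimately show ?thesis
    using x g by (auto simp: mdiff_def comp_def)
qed

text \<open>Strictness is asked of the outer map alone. The curve need only be differentiable at the
  single parameter \<open>t\<close>, which is all that a rectifiable arc offers almost
  everywhere.\<close>

lemma cdiff_mdiff:
  assumes f: "cdiff d f t w" and g: "mdiff d e g (f t) D'" and d: "is_chart d"
  shows "cdiff e (\<lambda>y. g (f y)) t (D' w)"
proof -
  let ?f = "snd d \<circ> f" and ?g = "snd e \<circ> g \<circ> chart_inv d"
  have x: "f t \<in> fst d" "isCont f t" using f by (auto simp: cdiff_def)
  have ft: "?f t = snd d (f t)" by (rule comp_apply)
  have 1: "has_dir_deriv ?f t 1 w" using f unfolding cdiff_def by blast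
  have 2: "sdiff ?g (?f t) D'" using g unfolding mdiff_def ft by blast
  have "has_dir_deriv (?g \<circ> ?f) t 1 (D' w)" using has_dir_deriv_compose[OF 1 2] .
  moreover have "eventually (\<lambda>y. (?g \<circ> ?f) y = (snd e \<circ> (\<lambda>y. g (f y))) y) (nhds t)"
  proof -
    have "eventually (\<lambda>y. f y \<in> fst d) (nhds t)"
      by (rule isCont_eventually[OF x(2), where P="\<lambda>z. z \<in> fst d"])
        (use x d in \<open>auto intro: eventually_nhds_in_open chart_open\<close>)
    then show ?thesis by eventually_elim (simp add: d)
  qed
  ultimately have "has_dir_deriv (snd e \<circ> (\<lambda>y. g (f y))) t 1 (D' w)"
    by (rule has_dir_deriv_cong)
  moreover have "isCont (\<lambda>y. g (f y)) t"
    using g by (intro isCont_o2[OF x(2)]) (simp add: mdiff_def)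
  ultimately show ?thesis
    using g by (auto simp: mdiff_def cdiff_def)
qed

lemma cdiff_cong:
  assumes "cdiff d f t w" "eventually (\<lambda>s. f s = g s) (nhds t)"
  shows "cdiff d g t w"
proof -
  have "f t = g t" using assms(2) by (rule eventually_nhds_x_imp_x)
  moreover have "isCont g t" by (rule isCont_cong[THEN iffD1, OF assms(2)]) (use assms(1) in \<open>simp add: cdiff_def\<close>)
  moreover have "has_dir_deriv (snd d \<circ> g) t 1 w"
  proof (rule has_dir_deriv_cong)
    show "has_dir_deriv (snd d \<circ> f) t 1 w" using assms(1) by (simp add: cdiff_def)
    show "eventually (\<lambda>s. (snd d \<circ> f) s = (snd d \<circ> g) s) (nhds t)"
      using assms(2) by eventually_elim simp
  qed
  ultimately show ?thesis using assms(1) by (simp add: cdiff_def)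
qed

lemma mdiff_const: "is_chart c \<Longrightarrow> x \<in> fst c \<Longrightarrow> y \<in> fst d \<Longrightarrow> mdiff c d (\<lambda>_. y) x (\<lambda>_. 0)"
  using sdiff_const[of "snd d y" "snd c x"] by (simp add: mdiff_def comp_def)

lemma cdiff_const: "y \<in> fst d \<Longrightarrow> cdiff d (\<lambda>_. y) t 0"
  by (simp add: cdiff_def comp_def has_dir_deriv_def)

lemma mdiff_id: "is_chart c \<Longrightarrow> x \<in> fst c \<Longrightarrow> mdiff c c (\<lambda>y. y) x (\<lambda>v. v)"
proof -
  assume c: "is_chart c" "x \<in> fst c"
  have "eventually (\<lambda>y. y \<in> snd c ` fst c) (nhds (snd c x))"
    using c by (intro eventually_nhds_in_open) (auto intro: chart_open_image)
  then have "eventually (\<lambda>y. id y = (snd c \<circ> (\<lambda>y. y) \<circ> chart_inv c) y) (nhds (snd c x))"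
    by eventually_elim (simp add: chart_apply_inv)
  from sdiff_cong[OF sdiff_id this] c show ?thesis by (simp add: mdiff_def comp_def id_def)
qed

section \<open>Product charts\<close>

definition pchart :: "('m, 'e) chart \<Rightarrow> ('n, 'f) chart \<Rightarrow> ('m \<times> 'n, 'e \<times> 'f) chart"
  where "pchart c d = (fst c \<times> fst d, map_prod (snd c) (snd d))"

lemma pchart_simps [simp]:
  "fst (pchart c d) = fst c \<times> fst d" "snd (pchart c d) = map_prod (snd c) (snd d)"
  by (auto simp: pchart_def)

lemma chart_inv_pchart:
  assumes "is_chart c" "is_chart d" "y \<in> snd c ` fst c" "z \<in> snd d ` fst d"
  shows "chart_inv (pchart c d) (y, z) = (chart_inv c y, chart_inv d z)"
proof -
  obtain x x' where x: "y = snd c x" "z = snd d x'" "x \<in> fst c" "x' \<in> fst d"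
    using assms by auto
  have inj: "inj_on (snd c) (fst c)" "inj_on (snd d) (fst d)"
    using assms(1,2) by (metis chart_inv_apply inj_on_inverseI)+
  have "inv_into (fst c \<times> fst d) (map_prod (snd c) (snd d)) (map_prod (snd c) (snd d) (x, x')) = (x, x')"
    by (rule inv_into_f_f) (use x inj in \<open>auto intro: map_prod_inj_on\<close>)
  then show ?thesis using x assms by (simp add: chart_inv_def[of "pchart c d"])
qed

lemma is_chart_pchart:
  fixes c :: "('m::t2_space, 'e::t2_space) chart" and d :: "('n::t2_space, 'f::t2_space) chart"
  assumes c: "is_chart c" and d: "is_chart d"
  shows "is_chart (pchart c d)"
proof -
  have im: "snd (pchart c d) ` fst (pchart c d) = snd c ` fst c \<times> snd d ` fst d"
    by (auto simp: image_iff)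
  have "continuous_on (snd c ` fst c \<times> snd d ` fst d) (\<lambda>p. (chart_inv c (fst p), chart_inv d (snd p)))"
    by (intro continuous_on_Pair continuous_on_compose2[OF continuous_on_chart_inv[OF c] continuous_on_fst[OF continuous_on_id]]
        continuous_on_compose2[OF continuous_on_chart_inv[OF d] continuous_on_snd[OF continuous_on_id]]) auto
  moreover have "(chart_inv c (fst p), chart_inv d (snd p)) = chart_inv (pchart c d) p"
    if "p \<in> snd c ` fst c \<times> snd d ` fst d" for p
    using that chart_inv_pchart[OF c d, of "fst p" "snd p"] by (auto simp del: pchart_simps)
  ultimately have ci: "continuous_on (snd c ` fst c \<times> snd d ` fst d) (chart_inv (pchart c d))"
    by (rule continuous_on_cong[THEN iffD1, OF refl, rotated]) auto
  have cs: "continuous_on (fst c \<times> fst d) (map_prod (snd c) (snd d))"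
  proof -
    have "continuous_on (fst c \<times> fst d) (\<lambda>p. (snd c (fst p), snd d (snd p)))"
      by (intro continuous_on_Pair continuous_on_compose2[OF continuous_on_chart[OF c] continuous_on_fst[OF continuous_on_id]]
          continuous_on_compose2[OF continuous_on_chart[OF d] continuous_on_snd[OF continuous_on_id]]) auto
    then show ?thesis by (simp add: map_prod_def case_prod_beta')
  qed
  have inv: "chart_inv (pchart c d) (snd c x, snd d y) = (x, y)" if "x \<in> fst c" "y \<in> fst d" for x y
    using that chart_inv_pchart[OF c d, of "snd c x" "snd d y"] c d by auto
  have "homeomorphism (fst c \<times> fst d) (snd c ` fst c \<times> snd d ` fst d)
      (map_prod (snd c) (snd d)) (chart_inv (pchart c d))"
    by (rule homeomorphismI[OF cs ci]) (use inv in auto)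
  then show ?thesis
    unfolding is_chart_def im using chart_open[OF c] chart_open[OF d]
      chart_open_image[OF c] chart_open_image[OF d] by (simp add: open_Times)
qed

lemma mdiff_Pair:
  assumes f: "mdiff c d f x D" and g: "mdiff c e g x D'"
  shows "mdiff c (pchart d e) (\<lambda>y. (f y, g y)) x (\<lambda>v. (D v, D' v))"
proof -
  have "sdiff (\<lambda>y. ((snd d \<circ> f \<circ> chart_inv c) y, (snd e \<circ> g \<circ> chart_inv c) y)) (snd c x) (\<lambda>v. (D v, D' v))"
    using f g unfolding mdiff_def by (intro sdiff_Pair) (auto simp: comp_def)
  moreover have "isCont (\<lambda>y. (f y, g y)) x"
    using f g by (auto simp: mdiff_def isCont_def intro: tendsto_Pair)
  ultimately show ?thesis using f g by (simp add: mdiff_def comp_def)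
qed

lemma cdiff_Pair:
  assumes f: "cdiff d f t w" and g: "cdiff e g t w'"
  shows "cdiff (pchart d e) (\<lambda>y. (f y, g y)) t (w, w')"
proof -
  have "has_dir_deriv (\<lambda>y. (snd d (f y), snd e (g y))) t 1 (w, w')"
    using f g unfolding has_dir_deriv_def cdiff_def
    by (auto intro!: tendsto_Pair simp: scaleR_prod_def)
  moreover have "isCont (\<lambda>y. (f y, g y)) t"
    using f g by (auto simp: cdiff_def isCont_def intro: tendsto_Pair)
  ultimately show ?thesis using f g by (simp add: cdiff_def comp_def)
qed

text \<open>Treats a vector space as a manifold with one chart, so that \<open>ex\<close>,
  \<open>lg\<close> and vector-valued curves fall under \<open>mdiff\<close> and
  \<open>cdiff\<close>.\<close>

definition vchart :: "('e, 'e) chart"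
  where "vchart = (UNIV, id)"

lemma vchart_simps [simp]: "fst vchart = UNIV" "snd vchart = id" "chart_inv vchart = id"
  by (auto simp: vchart_def chart_inv_def fun_eq_iff)

lemma is_chart_vchart [simp]: "is_chart (vchart :: ('e::topological_space, 'e) chart)"
  by (simp add: is_chart_def homeomorphism_def)

lemma cdiff_vchart: "cdiff vchart f t w \<longleftrightarrow> has_dir_deriv f t 1 w"
  using has_dir_deriv_imp_isCont by (auto simp: cdiff_def)

lemma mdiff_vchart: "mdiff vchart vchart f x D \<longleftrightarrow> isCont f x \<and> sdiff f x D"
  by (auto simp: mdiff_def)

text \<open>The bridge from the regularity hypotheses to calculus at a point. The domain of the
  coordinate expression is open, hence \<open>C1_on\<close> yields strict differentiability
  there.\<close>

lemma mfd_map_imp_mdiff: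
  fixes f :: "'m::t2_space \<Rightarrow> 'n::t2_space"
  assumes f: "mfd_map C1_on A S B f" and S: "open S" "x \<in> S" and cd: "c \<in> A" "d \<in> B"
    "is_chart c" "is_chart d" "x \<in> fst c" "f x \<in> fst d"
  shows "mdiff c d f x (dir_deriv (snd d \<circ> f \<circ> chart_inv c) (snd c x))"
proof -
  let ?U = "snd c ` (fst c \<inter> S \<inter> f -` fst d)"
  have cf: "continuous_on S f" using f by (simp add: mfd_map_def)
  have oS: "open (f -` fst d \<inter> S)"
    using cf S cd by (simp add: continuous_on_open_vimage chart_open)
  then have o: "open (fst c \<inter> S \<inter> f -` fst d)"
    using open_Int[OF chart_open[OF cd(3)] oS] by (simp add: Int_ac)
  have "?U = chart_inv c -` (fst c \<inter> S \<inter> f -` fst d) \<inter> snd c ` fst c"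
    using cd by (auto simp: image_iff)
  moreover have "open \<dots>"
  proof -
    have "continuous_on (snd c ` fst c) (chart_inv c)"
      by (rule continuous_on_chart_inv[OF cd(3)])
    from continuous_on_open_vimage[OF chart_open_image[OF cd(3)], THEN iffD1, OF this] o
    show ?thesis by blast
  qed
  ultimately have "open ?U" by simp
  moreover have "C1_on ?U (snd d \<circ> f \<circ> chart_inv c)"
    using f cd by (auto simp: mfd_map_def)
  moreover have "snd c x \<in> ?U" using S cd by auto
  ultimately have "sdiff (snd d \<circ> f \<circ> chart_inv c) (snd c x) (dir_deriv (snd d \<circ> f \<circ> chart_inv c) (snd c x))"
    by (intro C1_on_imp_sdiff)
  moreover have "isCont f x" using cf S by (simp add: continuous_on_eq_continuous_at)
  ultimately show ?thesis using cd by (simp add: mdiff_def)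
qed

lemma mfd_map_C2_imp_C1: "mfd_map C2_on A S B f \<Longrightarrow> mfd_map C1_on A S B f"
  by (auto simp: mfd_map_def C2_on_def)

lemma pchart_in_prod_atlas: "c \<in> A \<Longrightarrow> d \<in> B \<Longrightarrow> pchart c d \<in> prod_atlas A B"
  unfolding prod_atlas_def pchart_def by blast

lemma vchart_in_vector_atlas: "vchart \<in> vector_atlas"
  by (simp add: vector_atlas_def vchart_def)

section \<open>Lie groups and their exponential map\<close>

lemma cdiff_scale:
  fixes \<gamma> :: "real \<Rightarrow> 'm::t2_space"
  assumes "cdiff d \<gamma> (t * s) w"
  shows "cdiff d (\<lambda>s. \<gamma> (t * s)) s (t *\<^sub>R w)"
proof (cases "t = 0")
  case True
  then show ?thesis using cdiff_const[of "\<gamma> 0" d s] assms by (simp add: cdiff_def)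
next
  case False
  have "((\<lambda>h. t * h) \<longlongrightarrow> t * 0) (at 0)" by (intro tendsto_intros)
  then have fl: "filterlim (\<lambda>h. t * h) (at 0) (at 0)"
    using False by (auto simp: filterlim_at eventually_at intro: exI[of _ 1])
  have "((\<lambda>h. (snd d (\<gamma> (t * s + h)) - snd d (\<gamma> (t * s))) /\<^sub>R h) \<longlongrightarrow> w) (at 0)"
    using assms by (simp add: cdiff_def has_dir_deriv_def)
  from filterlim_compose[OF this fl]
  have "((\<lambda>h. t *\<^sub>R ((snd d (\<gamma> (t * s + t * h)) - snd d (\<gamma> (t * s))) /\<^sub>R (t * h))) \<longlongrightarrow> t *\<^sub>R w) (at 0)"
    by (intro tendsto_scaleR_lcs tendsto_const)
  moreover have "t *\<^sub>R ((snd d (\<gamma> (t * s + t * h)) - snd d (\<gamma> (t * s))) /\<^sub>R (t * h)) =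
      (snd d (\<gamma> (t * (s + h))) - snd d (\<gamma> (t * s))) /\<^sub>R h" for h
    using False by (simp add: distrib_left)
  ultimately have "has_dir_deriv (\<lambda>s. snd d (\<gamma> (t * s))) s 1 (t *\<^sub>R w)"
    by (simp add: has_dir_deriv_def)
  moreover have "isCont (\<lambda>s. \<gamma> (t * s)) s"
    by (rule isCont_o2[where g=\<gamma> and f="\<lambda>s. t * s"]) (use assms in \<open>auto simp: cdiff_def intro!: continuous_intros\<close>)
  ultimately show ?thesis using assms by (simp add: cdiff_def comp_def)
qed

lemma cdiff_shift:
  fixes \<gamma> :: "real \<Rightarrow> 'm::t2_space"
  assumes "cdiff d \<gamma> (s + a) w"
  shows "cdiff d (\<lambda>s. \<gamma> (s + a)) s w"
proof -
  have "isCont (\<lambda>s. \<gamma> (s + a)) s"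
    by (rule isCont_o2[where g=\<gamma> and f="\<lambda>s. s + a"]) (use assms in \<open>auto simp: cdiff_def intro!: continuous_intros\<close>)
  then show ?thesis using assms by (simp add: cdiff_def has_dir_deriv_def comp_def algebra_simps)
qed

lemma has_dir_deriv_line:
  fixes u :: "'e::hausdorff_lcs"
  shows "has_dir_deriv (\<lambda>s. x + s *\<^sub>R u) t 1 u"
proof -
  have "((\<lambda>h::real. u) \<longlongrightarrow> u) (at 0)" by (rule tendsto_const)
  then show ?thesis unfolding has_dir_deriv_def
    by (rule Lim_transform_eventually)
      (auto simp: eventually_at scaleR_add_left intro!: exI[of _ 1])
qed

text \<open>A straight line in the chart. Since every tangent vector is a velocity, derivatives of
  maps can be computed by testing them on curves.\<close>

lemma chart_curve:
  fixes c :: "('m::t2_space, 'e::hausdorff_lcs) chart"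
  assumes c: "is_chart c" "x \<in> fst c"
  obtains \<alpha> where "\<alpha> 0 = x" "cdiff c \<alpha> 0 u"
proof
  let ?\<alpha> = "\<lambda>s. chart_inv c (snd c x + s *\<^sub>R u)"
  show 0: "?\<alpha> 0 = x" using c by simp
  have ic: "isCont (\<lambda>s. snd c x + s *\<^sub>R u) 0"
    by (rule has_dir_deriv_imp_isCont[OF has_dir_deriv_line])
  have "eventually (\<lambda>s. snd c x + s *\<^sub>R u \<in> snd c ` fst c) (nhds 0)"
    by (rule isCont_eventually[OF ic, where P="\<lambda>y. y \<in> snd c ` fst c"])
      (use c in \<open>auto intro!: eventually_nhds_in_open chart_open_image\<close>)
  then have "eventually (\<lambda>s. snd c x + s *\<^sub>R u = (snd c \<circ> ?\<alpha>) s) (nhds 0)"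
    by eventually_elim (simp add: chart_apply_inv)
  from has_dir_deriv_cong[OF has_dir_deriv_line this]
  have "has_dir_deriv (snd c \<circ> ?\<alpha>) 0 1 u" .
  moreover have "isCont ?\<alpha> 0"
    by (rule isCont_o2[OF ic]) (use isCont_chart_inv[OF c] in simp)
  ultimately show "cdiff c ?\<alpha> 0 u" using c 0 by (simp add: cdiff_def)
qed

lemma mdiff_imp_dir_deriv:
  assumes "mdiff c d f x D"
  shows "dir_deriv (snd d \<circ> f \<circ> chart_inv c) (snd c x) = D"
proof
  fix v
  have "sdiff (snd d \<circ> f \<circ> chart_inv c) (snd c x) D" using assms by (simp add: mdiff_def)
  then show "dir_deriv (snd d \<circ> f \<circ> chart_inv c) (snd c x) v = D v"
    by (rule dir_deriv_eqI[OF sdiff_imp_has_dir_deriv])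
qed

locale lie_grp =
  fixes K :: "'k::t2_space monoid"
    and A :: "('k, 'e::hausdorff_lcs) chart set"
    and c0 :: "('k, 'e) chart"
  assumes lie: "lie_group K A"
    and c0: "c0 \<in> A" and one_c0: "\<one>\<^bsub>K\<^esub> \<in> fst c0"
begin

abbreviation mul :: "'k \<Rightarrow> 'k \<Rightarrow> 'k" (infixl "\<cdot>" 70) where "x \<cdot> y \<equiv> x \<otimes>\<^bsub>K\<^esub> y"
abbreviation iv :: "'k \<Rightarrow> 'k" where "iv x \<equiv> inv\<^bsub>K\<^esub> x"
abbreviation one :: 'k where "one \<equiv> \<one>\<^bsub>K\<^esub>"

lemma grp: "group K" and carrier_UNIV: "carrier K = UNIV" and atlas: "C2_atlas A"
  and quot_mfd: "mfd_map C2_on (prod_atlas A A) UNIV A (\<lambda>(x, y). x \<cdot> iv y)"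
  using lie by (auto simp: lie_group_def)

lemma mul_assoc: "x \<cdot> y \<cdot> z = x \<cdot> (y \<cdot> z)"
  using monoid.m_assoc[OF group.is_monoid[OF grp]] by (simp add: carrier_UNIV)

lemma grp_simps [simp]:
  "x \<cdot> one = x" "one \<cdot> x = x" "x \<cdot> iv x = one" "iv x \<cdot> x = one" "iv (iv x) = x"
  "iv (x \<cdot> y) = iv y \<cdot> iv x" "iv one = one"
  by (simp_all add: monoid.r_one[OF group.is_monoid[OF grp]] monoid.l_one[OF group.is_monoid[OF grp]]
      group.r_inv[OF grp] group.l_inv[OF grp] carrier_UNIV group.inv_inv[OF grp]
      group.inv_mult_group[OF grp] monoid.inv_one[OF group.is_monoid[OF grp]])

lemma mul_inv_cancel [simp]: "x \<cdot> (iv x \<cdot> y) = y" "iv x \<cdot> (x \<cdot> y) = y"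
  by (simp_all add: mul_assoc[symmetric])

lemma chartA [simp]: "c \<in> A \<Longrightarrow> is_chart c"
  using atlas by (auto simp: C2_atlas_def)

lemma chart_c0 [simp]: "is_chart c0"
  using c0 by simp

lemma chart_ex: obtains c where "c \<in> A" "x \<in> fst c"
  using atlas unfolding C2_atlas_def by blast

section \<open>Differentiability of the group operations\<close>

lemma mdiff_quot:
  assumes "c \<in> A" "d \<in> A" "h \<in> A" "x \<in> fst c" "y \<in> fst d" "x \<cdot> iv y \<in> fst h"
  obtains D where "mdiff (pchart c d) h (\<lambda>(x, y). x \<cdot> iv y) (x, y) D"
proof
  show "mdiff (pchart c d) h (\<lambda>(x, y). x \<cdot> iv y) (x, y)
      (dir_deriv (snd h \<circ> (\<lambda>(x, y). x \<cdot> iv y) \<circ> chart_inv (pchart c d)) (snd (pchart c d) (x, y)))"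
    by (rule mfd_map_imp_mdiff[OF mfd_map_C2_imp_C1[OF quot_mfd]])
      (use assms in \<open>simp_all add: pchart_in_prod_atlas is_chart_pchart\<close>)
qed

text \<open>Hides the target chart and the derivative, so that composite expressions are handled by
  introduction rules; \<open>mdfD\<close> recovers a derivative in any prescribed chart.\<close>

definition mdf :: "('m::t2_space, 'f::hausdorff_lcs) chart \<Rightarrow> ('m \<Rightarrow> 'k) \<Rightarrow> 'm \<Rightarrow> bool"
  where "mdf c f x \<longleftrightarrow> (\<exists>d\<in>A. \<exists>D. mdiff c d f x D)"

lemma mdfI: "mdiff c d f x D \<Longrightarrow> d \<in> A \<Longrightarrow> mdf c f x"
  by (auto simp: mdf_def)

lemma mdf_quot_aux:
  assumes f: "mdf c f x" and g: "mdf c g x" and c: "is_chart c"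
    and h: "h \<in> A" "f x \<cdot> iv (g x) \<in> fst h"
  obtains D where "mdiff c h (\<lambda>y. f y \<cdot> iv (g y)) x D"
proof -
  obtain d D e D' where d: "d \<in> A" "mdiff c d f x D" and e: "e \<in> A" "mdiff c e g x D'"
    using f g by (auto simp: mdf_def)
  have "f x \<in> fst d" "g x \<in> fst e" using d e by (auto simp: mdiff_def)
  then obtain D'' where "mdiff (pchart d e) h (\<lambda>(x, y). x \<cdot> iv y) (f x, g x) D''"
    using mdiff_quot[OF d(1) e(1) h(1) _ _ h(2)] by blast
  from mdiff_compose[OF mdiff_Pair[OF d(2) e(2)] this c is_chart_pchart] d(1) e(1)
  have "mdiff c h (\<lambda>y. f y \<cdot> iv (g y)) x (\<lambda>v. D'' (D v, D' v))" by simp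
  then show ?thesis by (rule that)
qed

lemma mdf_const:
  assumes "is_chart c" "x \<in> fst c"
  shows "mdf c (\<lambda>_. y) x"
proof -
  obtain d where "d \<in> A" "y \<in> fst d" by (rule chart_ex)
  with mdiff_const[OF assms, of y d] show ?thesis by (intro mdfI)
qed

lemma mdf_id: "c \<in> A \<Longrightarrow> x \<in> fst c \<Longrightarrow> mdf c (\<lambda>y. y) x"
  by (rule mdfI[OF mdiff_id]) auto

text \<open>Multiplying by \<open>iv one\<close> changes nothing, but the target chart of the
  quotient map is free, so its differentiability supplies the change of chart.\<close>

lemma mdfD:
  assumes f: "mdf c f x" and c: "is_chart c" and h: "h \<in> A" "f x \<in> fst h"
  obtains D where "mdiff c h f x D"
proof -
  have x: "x \<in> fst c" using f by (auto simp: mdf_def mdiff_def)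
  have "f x \<cdot> iv one \<in> fst h" using h by simp
  from mdf_quot_aux[OF f mdf_const[OF c x] c h(1) this] obtain D
    where "mdiff c h (\<lambda>y. f y \<cdot> iv one) x D" .
  with that show ?thesis by simp
qed

lemma mdf_quot:
  assumes "mdf c f x" "mdf c g x" "is_chart c"
  shows "mdf c (\<lambda>y. f y \<cdot> iv (g y)) x"
proof -
  obtain h where h: "h \<in> A" "f x \<cdot> iv (g x) \<in> fst h" by (rule chart_ex)
  obtain D where "mdiff c h (\<lambda>y. f y \<cdot> iv (g y)) x D" by (rule mdf_quot_aux[OF assms h])
  then show ?thesis using h(1) by (rule mdfI)
qed

lemma mdf_inv:
  assumes "mdf c g x" "is_chart c"
  shows "mdf c (\<lambda>y. iv (g y)) x"
proof -
  have "x \<in> fst c" using assms(1) by (auto simp: mdf_def mdiff_def)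
  from mdf_quot[OF mdf_const[OF assms(2) this, of one] assms] show ?thesis by simp
qed

lemma mdf_mul:
  assumes "mdf c f x" "mdf c g x" "is_chart c"
  shows "mdf c (\<lambda>y. f y \<cdot> g y) x"
  using mdf_quot[OF assms(1) mdf_inv[OF assms(2,3)] assms(3)] by simp

lemma mdf_compose:
  assumes f: "mdiff c d f x D" and g: "mdf d g (f x)" and c: "is_chart c" "is_chart d"
  shows "mdf c (\<lambda>y. g (f y)) x"
proof -
  obtain e D' where "e \<in> A" "mdiff d e g (f x) D'" using g by (auto simp: mdf_def)
  with mdiff_compose[OF f _ c, of e g D'] show ?thesis by (intro mdfI)
qed

lemma cdiff_change_chart:
  assumes "cdiff c \<gamma> t w" "c \<in> A" "d \<in> A" "\<gamma> t \<in> fst d"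
  obtains w' where "cdiff d \<gamma> t w'"
proof -
  have "\<gamma> t \<in> fst c" using assms by (simp add: cdiff_def)
  from mdfD[OF mdf_id[OF assms(2) this] chartA[OF assms(2)] assms(3,4)]
  obtain D where "mdiff c d (\<lambda>y. y) (\<gamma> t) D" .
  from cdiff_mdiff[OF assms(1) this chartA[OF assms(2)]] show ?thesis by (rule that)
qed

text \<open>By additivity it suffices to know the derivative on the vectors \<open>(u, 0)\<close>
  and \<open>(u, u)\<close>. The quotient map sends the curve \<open>(\<alpha>, one)\<close> to
  \<alpha> and the curve \<open>(\<alpha>, \<alpha>)\<close> to a constant.\<close>

lemma quot_deriv: "mdiff (pchart c0 c0) c0 (\<lambda>(x, y). x \<cdot> iv y) (one, one) (\<lambda>(u, w). u - w)"
proof -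
  obtain D where D: "mdiff (pchart c0 c0) c0 (\<lambda>(x, y). x \<cdot> iv y) (one, one) D"
    using mdiff_quot[OF c0 c0 c0 one_c0 one_c0] one_c0 by auto
  have P: "is_chart (pchart c0 c0)" by (simp add: is_chart_pchart)
  have 1: "D (u, 0) = u" for u
  proof -
    obtain \<alpha> where \<alpha>: "\<alpha> 0 = one" "cdiff c0 \<alpha> 0 u" using chart_curve[OF chart_c0 one_c0] by blast
    have "cdiff (pchart c0 c0) (\<lambda>s. (\<alpha> s, one)) 0 (u, 0)"
      by (rule cdiff_Pair[OF \<alpha>(2) cdiff_const[OF one_c0]])
    from cdiff_mdiff[OF this _ P, of c0 "\<lambda>(x, y). x \<cdot> iv y" D] D \<alpha>(1)
    have "cdiff c0 \<alpha> 0 (D (u, 0))" by simp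
    then show ?thesis using \<alpha>(2) by (rule cdiff_unique)
  qed
  have 2: "D (u, u) = 0" for u
  proof -
    obtain \<alpha> where \<alpha>: "\<alpha> 0 = one" "cdiff c0 \<alpha> 0 u" using chart_curve[OF chart_c0 one_c0] by blast
    have "cdiff (pchart c0 c0) (\<lambda>s. (\<alpha> s, \<alpha> s)) 0 (u, u)"
      by (rule cdiff_Pair[OF \<alpha>(2) \<alpha>(2)])
    from cdiff_mdiff[OF this _ P, of c0 "\<lambda>(x, y). x \<cdot> iv y" D] D \<alpha>(1)
    have "cdiff c0 (\<lambda>_. one) 0 (D (u, u))" by simp
    then show ?thesis using cdiff_const[OF one_c0] by (rule cdiff_unique)
  qed
  have "D = (\<lambda>(u, w). u - w)"
  proof
    fix p :: "'e \<times> 'e"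
    have "p = (fst p - snd p, 0) + (snd p, snd p)" by (simp add: prod_eq_iff)
    then have "D p = D (fst p - snd p, 0) + D (snd p, snd p)" using mdiff_add[OF D] by metis
    then show "D p = (case p of (u, w) \<Rightarrow> u - w)" by (simp add: 1 2 case_prod_beta)
  qed
  with D show ?thesis by simp
qed

lemma cdiff_quot:
  assumes "cdiff c0 \<alpha> t u" "cdiff c0 \<beta> t w" "\<alpha> t = one" "\<beta> t = one"
  shows "cdiff c0 (\<lambda>s. \<alpha> s \<cdot> iv (\<beta> s)) t (u - w)"
  using cdiff_mdiff[OF cdiff_Pair[OF assms(1,2)], of c0 "\<lambda>(x, y). x \<cdot> iv y" "\<lambda>(u, w). u - w"]
    quot_deriv assms(3,4) by (simp add: is_chart_pchart)

lemma cdiff_mul: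
  assumes "cdiff c0 \<alpha> t u" "cdiff c0 \<beta> t w" "\<alpha> t = one" "\<beta> t = one"
  shows "cdiff c0 (\<lambda>s. \<alpha> s \<cdot> \<beta> s) t (u + w)"
proof -
  have "cdiff c0 (\<lambda>s. one \<cdot> iv (\<beta> s)) t (0 - w)"
    by (rule cdiff_quot[OF cdiff_const[OF one_c0] assms(2)]) (use assms in auto)
  from cdiff_quot[OF assms(1) this] assms show ?thesis by simp
qed

lemma conj_deriv: "mdiff c0 c0 (\<lambda>x. g \<cdot> x \<cdot> iv g) one (Ad K c0 g)"
proof -
  have "mdf c0 (\<lambda>x. g \<cdot> x \<cdot> iv g) one"
    by (intro mdf_quot mdf_mul mdf_const mdf_id) (auto simp: c0 one_c0)
  from mdfD[OF this _ c0] one_c0 obtain D where D: "mdiff c0 c0 (\<lambda>x. g \<cdot> x \<cdot> iv g) one D"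
    by auto
  have "D = Ad K c0 g"
    using mdiff_imp_dir_deriv[OF D] by (simp add: Ad_def fun_eq_iff)
  with D show ?thesis by simp
qed

lemma Ad_zero: "Ad K c0 g 0 = 0"
  and Ad_diff: "Ad K c0 g (v - w) = Ad K c0 g v - Ad K c0 g w"
  by (rule mdiff_zero[OF conj_deriv] mdiff_diff[OF conj_deriv])+

lemma cdiff_conj:
  assumes "cdiff c0 \<alpha> t u" "\<alpha> t = one"
  shows "cdiff c0 (\<lambda>s. g \<cdot> \<alpha> s \<cdot> iv g) t (Ad K c0 g u)"
  by (rule cdiff_mdiff[OF assms(1) _ chart_c0, unfolded assms(2), OF conj_deriv])

text \<open>Left translation by \<open>\<gamma> t\<close> turns the vanishing logarithmic derivative
  into a vanishing derivative in any chart at \<open>\<gamma> t\<close>. So \<gamma> is constant as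
  long as it stays in a chart, and bisection globalizes this.\<close>

lemma cdiff_zero_imp_const:
  assumes 0: "\<And>t. cdiff c0 (\<lambda>s. iv (\<gamma> t) \<cdot> \<gamma> s) t 0"
  shows "\<gamma> s = \<gamma> t"
proof -
  have loc: "cdiff c \<gamma> t 0" if c: "c \<in> A" "\<gamma> t \<in> fst c" for c t
  proof -
    have "mdf c0 (\<lambda>x. \<gamma> t \<cdot> x) one"
      by (intro mdf_mul mdf_const mdf_id) (auto simp: c0 one_c0)
    from mdfD[OF this _ c(1)] c obtain D where D: "mdiff c0 c (\<lambda>x. \<gamma> t \<cdot> x) one D" by auto
    have "cdiff c (\<lambda>s. \<gamma> t \<cdot> (iv (\<gamma> t) \<cdot> \<gamma> s)) t (D 0)"
      by (rule cdiff_mdiff[OF 0]) (use D in auto)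
    then show ?thesis using mdiff_zero[OF D] by simp
  qed
  have "\<gamma> s = \<gamma> t" if "s \<le> t" for s t
    using that
  proof (induction rule: Bolzano)
    case (local x)
    obtain c where c: "c \<in> A" "\<gamma> x \<in> fst c" by (rule chart_ex)
    have "isCont \<gamma> x" using loc[OF c] by (simp add: cdiff_def)
    then have "eventually (\<lambda>y. \<gamma> y \<in> fst c) (nhds x)"
      by (rule isCont_eventually[where P="\<lambda>z. z \<in> fst c"]) (use c in \<open>auto intro!: eventually_nhds_in_open chart_open\<close>)
    then obtain d where d: "d > 0" "\<And>y. \<bar>y - x\<bar> < d \<Longrightarrow> \<gamma> y \<in> fst c"
      by (auto simp: eventually_nhds_metric dist_real_def)
    have "\<gamma> a = \<gamma> b" if ab: "a \<le> x" "x \<le> b" "b - a < d" for a b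
    proof -
      have in_c: "\<gamma> s \<in> fst c" if "s \<in> {a..b}" for s using d(2)[of s] that ab by auto
      have "has_dir_deriv (snd c \<circ> \<gamma>) s 1 0" if "s \<in> {a..b}" for s
        using loc[OF c(1) in_c[OF that]] unfolding cdiff_def by blast
      from zero_derivative_imp_const[OF order_trans[OF ab(1,2)] this]
      have "(snd c \<circ> \<gamma>) b = (snd c \<circ> \<gamma>) a" .
      then show ?thesis
        using chart_inv_apply[OF chartA[OF c(1)]] in_c[of a] in_c[of b] ab
        by (metis atLeastAtMost_iff comp_apply order_refl order_trans)
    qed
    then show ?case using d(1) by blast
  qed simp
  then show ?thesis by (metis linear)
qed

text \<open>One-parameter groups, under assumptions weak enough that a conjugate of such a group is one
  without any appeal to the chain rule for \<open>C2_on\<close>.\<close>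

definition opg :: "'e \<Rightarrow> (real \<Rightarrow> 'k) \<Rightarrow> bool"
  where "opg v \<gamma> \<longleftrightarrow> (\<forall>s t. \<gamma> (s + t) = \<gamma> s \<cdot> \<gamma> t) \<and> cdiff c0 \<gamma> 0 v"

lemma hom_zero:
  assumes "\<And>s t. \<gamma> (s + t) = \<gamma> s \<cdot> \<gamma> t"
  shows "\<gamma> (0::real) = one"
proof -
  have "\<gamma> 0 = \<gamma> 0 \<cdot> \<gamma> 0" using assms[of 0 0] by simp
  then have "iv (\<gamma> 0) \<cdot> \<gamma> 0 = iv (\<gamma> 0) \<cdot> (\<gamma> 0 \<cdot> \<gamma> 0)" by simp
  then show ?thesis by simp
qed

text \<open>The quotient of the two groups has logarithmic derivative 0 everywhere: at time
  \<open>t\<close> it is the conjugate by \<open>\<beta> t\<close> of the derivative at time 0,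
  which is \<open>v - v\<close>.\<close>

lemma opg_unique:
  assumes \<alpha>: "opg v \<alpha>" and \<beta>: "opg v \<beta>"
  shows "\<alpha> t = \<beta> t"
proof -
  have hom: "\<alpha> (s + t) = \<alpha> s \<cdot> \<alpha> t" "\<beta> (s + t) = \<beta> s \<cdot> \<beta> t" for s t
    using \<alpha> \<beta> by (auto simp: opg_def)
  have one: "\<alpha> 0 = one" "\<beta> 0 = one"
    by (auto intro: hom_zero hom)
  define \<gamma> where "\<gamma> t = \<alpha> t \<cdot> iv (\<beta> t)" for t
  have "cdiff c0 (\<lambda>s. iv (\<gamma> t) \<cdot> \<gamma> s) t 0" for t
  proof -
    have "cdiff c0 (\<lambda>s. \<alpha> s \<cdot> iv (\<beta> s)) 0 (v - v)"
      by (rule cdiff_quot) (use \<alpha> \<beta> one in \<open>auto simp: opg_def\<close>)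
    from cdiff_conj[OF this, of "\<beta> t"]
    have "cdiff c0 (\<lambda>s. \<beta> t \<cdot> (\<alpha> s \<cdot> iv (\<beta> s)) \<cdot> iv (\<beta> t)) (t + - t) 0"
      by (simp add: one Ad_zero)
    from cdiff_shift[OF this]
    have "cdiff c0 (\<lambda>s. \<beta> t \<cdot> (\<alpha> (s + - t) \<cdot> iv (\<beta> (s + - t))) \<cdot> iv (\<beta> t)) t 0" .
    moreover have "\<beta> t \<cdot> (\<alpha> (s + - t) \<cdot> iv (\<beta> (s + - t))) \<cdot> iv (\<beta> t) = iv (\<gamma> t) \<cdot> \<gamma> s" for s
    proof -
      have "\<alpha> t \<cdot> \<alpha> (s + - t) = \<alpha> s" "\<beta> t \<cdot> \<beta> (s + - t) = \<beta> s"
        using hom[of t "s + - t"] by simp_all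
      then have "\<alpha> (s + - t) = iv (\<alpha> t) \<cdot> \<alpha> s" "\<beta> (s + - t) = iv (\<beta> t) \<cdot> \<beta> s"
        by (metis mul_inv_cancel(2))+
      then show ?thesis by (simp add: \<gamma>_def mul_assoc)
    qed
    ultimately show ?thesis by simp
  qed
  then have "\<gamma> t = \<gamma> 0" by (rule cdiff_zero_imp_const)
  then have "\<alpha> t \<cdot> iv (\<beta> t) = one" by (simp add: \<gamma>_def one)
  then have "(\<alpha> t \<cdot> iv (\<beta> t)) \<cdot> \<beta> t = \<beta> t" by simp
  then show ?thesis by (simp add: mul_assoc)
qed

end

locale lie_exp = lie_grp K A c0
  for K :: "'k::t2_space monoid" and A :: "('k, 'e::hausdorff_lcs) chart set" and c0 +
  fixes ex :: "'e \<Rightarrow> 'k"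
  assumes exponential: "is_exponential K A c0 ex"
    and ex_C2: "mfd_map C2_on vector_atlas UNIV A ex"
begin

text \<open>\<open>is_exponential\<close> offers for each vector a group known only through its
  value at time 1. Rescaling time turns the group of \<open>v\<close> into one with velocity
  \<open>t v\<close>, and uniqueness identifies its value at time 1 with
  \<open>ex (t v)\<close>.\<close>

lemma ex_opg: "opg v (\<lambda>t. ex (t *\<^sub>R v))"
proof -
  have *: "\<exists>\<gamma>. opg v \<gamma> \<and> ex v = \<gamma> 1" for v
  proof -
    obtain \<gamma> where \<gamma>: "one_parameter_group K A c0 v \<gamma>" "ex v = \<gamma> 1"
      using exponential by (auto simp: is_exponential_def)
    then have "\<gamma> 0 = one" by (intro hom_zero) (auto simp: one_parameter_group_def)
    moreover have "isCont \<gamma> 0"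
      using \<gamma>(1) by (auto simp: one_parameter_group_def mfd_map_def continuous_on_eq_continuous_at)
    ultimately have "opg v \<gamma>" using \<gamma>(1) one_c0 by (auto simp: one_parameter_group_def opg_def cdiff_def)
    with \<gamma> show ?thesis by blast
  qed
  obtain \<gamma> where \<gamma>: "opg v \<gamma>" using * by blast
  have "ex (t *\<^sub>R v) = \<gamma> t" for t
  proof -
    have "cdiff c0 \<gamma> (t * 0) v" using \<gamma> by (simp add: opg_def)
    from cdiff_scale[OF this] have "opg (t *\<^sub>R v) (\<lambda>s. \<gamma> (t * s))"
      using \<gamma> by (simp add: opg_def distrib_left)
    moreover obtain \<beta> where "opg (t *\<^sub>R v) \<beta>" "ex (t *\<^sub>R v) = \<beta> 1" using * by blast
    ultimately show ?thesis using opg_unique[of "t *\<^sub>R v" \<beta> "\<lambda>s. \<gamma> (t * s)" 1] by simp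
  qed
  with \<gamma> show ?thesis by (simp add: opg_def)
qed

lemma ex_add: "ex ((s + t) *\<^sub>R v) = ex (s *\<^sub>R v) \<cdot> ex (t *\<^sub>R v)"
  using ex_opg[of v] by (simp add: opg_def)

lemma ex_zero [simp]: "ex 0 = one"
  using hom_zero[of "\<lambda>t. ex (t *\<^sub>R 0)"] ex_add[of _ _ 0] by simp

lemma ex_cdiff_0: "cdiff c0 (\<lambda>t. ex (t *\<^sub>R v)) 0 v"
  using ex_opg[of v] by (simp add: opg_def)

text \<open>Both sides are values at time 1 of one-parameter groups with the same velocity.\<close>

lemma ex_conj: "g \<cdot> ex v \<cdot> iv g = ex (Ad K c0 g v)"
proof -
  have "opg (Ad K c0 g v) (\<lambda>t. g \<cdot> ex (t *\<^sub>R v) \<cdot> iv g)"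
    using cdiff_conj[OF ex_cdiff_0[of v], of g] by (simp add: opg_def ex_add mul_assoc)
  from opg_unique[OF this ex_opg, of 1] show ?thesis by simp
qed

lemma mdf_ex: "mdf vchart ex v"
proof -
  obtain d where d: "d \<in> A" "ex v \<in> fst d" by (rule chart_ex)
  have "mdiff vchart d ex v (dir_deriv (snd d \<circ> ex \<circ> chart_inv vchart) (snd vchart v))"
    by (rule mfd_map_imp_mdiff[OF mfd_map_C2_imp_C1[OF ex_C2]])
      (use d in \<open>simp_all add: vchart_in_vector_atlas\<close>)
  then show ?thesis using d by (auto simp: mdf_def)
qed

lemma isCont_ex: "isCont ex v"
  using mdf_ex[of v] by (auto simp: mdf_def mdiff_def)

end

section \<open>One-sided derivatives of a Finsler norm\<close>

text \<open>The quotients do not decrease as \<open>h\<close> grows, so the infimum is also the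
  limit as \<open>h\<close> falls to 0. In this form it is below every single quotient, in
  particular the one with \<open>h = 1\<close>.\<close>

definition norm_deriv :: "('e::real_vector \<Rightarrow> real) \<Rightarrow> 'e \<Rightarrow> 'e \<Rightarrow> real"
  where "norm_deriv \<mu> x v = (INF h\<in>{0<..}. (\<mu> (x + h *\<^sub>R v) - \<mu> x) / h)"

locale finsler =
  fixes \<mu> :: "'e::hausdorff_lcs \<Rightarrow> real"
  assumes finsler_norm: "finsler_norm \<mu>"
begin

lemma mu_cont: "continuous_on UNIV \<mu>"
  and mu_nonneg [simp]: "0 \<le> \<mu> v"
  and mu_triangle: "\<mu> (v + w) \<le> \<mu> v + \<mu> w"
  and mu_scale: "r \<ge> 0 \<Longrightarrow> \<mu> (r *\<^sub>R v) = r * \<mu> v"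
  and mu_eq_0D: "\<mu> v = 0 \<Longrightarrow> v = 0"
  using finsler_norm by (simp_all add: finsler_norm_def finsler_seminorm_def)

lemma mu_zero [simp]: "\<mu> 0 = 0"
  using mu_scale[of 0 0] by simp

lemma tendsto_mu: "(f \<longlongrightarrow> l) F \<Longrightarrow> ((\<lambda>x. \<mu> (f x)) \<longlongrightarrow> \<mu> l) F"
  using mu_cont by (auto simp: continuous_on_eq_continuous_at isCont_def intro: tendsto_compose[of \<mu>])

lemma mu_diff_le: "\<mu> v - \<mu> w \<le> \<mu> (v - w)"
  using mu_triangle[of "v - w" w] by simp

lemma open_mu_less: "open {v. \<mu> v < r}"
  using open_Collect_less[OF mu_cont continuous_on_const] by simp

text \<open>Convexity of \<mu>: the point \<open>x + h v\<close> divides the segment from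
  \<open>x\<close> to \<open>x + k v\<close> in the ratio \<open>h / k\<close>.\<close>

lemma mu_quotient_mono:
  assumes "0 < h" "h \<le> k"
  shows "(\<mu> (x + h *\<^sub>R v) - \<mu> x) / h \<le> (\<mu> (x + k *\<^sub>R v) - \<mu> x) / k"
proof -
  have "x + h *\<^sub>R v = (1 - h / k) *\<^sub>R x + (h / k) *\<^sub>R (x + k *\<^sub>R v)"
    using assms by (simp add: algebra_simps)
  also have "\<mu> \<dots> \<le> (1 - h / k) * \<mu> x + (h / k) * \<mu> (x + k *\<^sub>R v)"
    using mu_triangle[of "(1 - h / k) *\<^sub>R x" "(h / k) *\<^sub>R (x + k *\<^sub>R v)"] assms by (simp add: mu_scale)
  finally have "\<mu> (x + h *\<^sub>R v) - \<mu> x \<le> (h / k) * (\<mu> (x + k *\<^sub>R v) - \<mu> x)"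
    by (simp add: algebra_simps)
  then show ?thesis using assms by (simp add: field_simps)
qed

lemma norm_deriv_le: "0 < h \<Longrightarrow> norm_deriv \<mu> x v \<le> (\<mu> (x + h *\<^sub>R v) - \<mu> x) / h"
proof -
  assume h: "0 < h"
  \<comment> \<open>A lower bound for all quotients, so that the infimum is meaningful. It involves
    \<open>- v\<close> because \<mu> need not be symmetric.\<close>
  have "- \<mu> (- v) \<le> (\<mu> (x + k *\<^sub>R v) - \<mu> x) / k" if k: "0 < k" for k
  proof -
    have "\<mu> x \<le> \<mu> (x + k *\<^sub>R v) + k * \<mu> (- v)"
      using mu_triangle[of "x + k *\<^sub>R v" "k *\<^sub>R (- v)"] mu_scale[of k "- v"] k by simp
    then show ?thesis using k by (simp add: field_simps)
  qed
  then show ?thesis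
    unfolding norm_deriv_def using h by (intro cINF_lower bdd_belowI2) auto
qed

text \<open>The direction may vary together with the increment: replacing \<open>v\<close> by
  \<open>w\<close> changes the quotient by at most \<open>\<mu> (w - v) + \<mu> (v - w)\<close>,
  which tends to 0 by continuity. Without symmetry both terms occur. This yields the derivative of
  \<mu> along a curve.\<close>

lemma norm_deriv_tendsto:
  assumes w: "(w \<longlongrightarrow> v) F" and h: "filterlim h (at_right 0) F"
  shows "((\<lambda>t. (\<mu> (x + h t *\<^sub>R w t) - \<mu> x) / h t) \<longlongrightarrow> norm_deriv \<mu> x v) F"
proof -
  have h0: "eventually (\<lambda>t. 0 < h t) F"
    using h by (auto simp: filterlim_at elim!: eventually_mono)
  have 1: "((\<lambda>h. (\<mu> (x + h *\<^sub>R v) - \<mu> x) / h) \<longlongrightarrow> norm_deriv \<mu> x v) (at_right 0)"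
  proof (rule order_tendstoI)
    fix a assume a: "a < norm_deriv \<mu> x v"
    have "eventually (\<lambda>h::real. 0 < h) (at_right 0)"
      by (simp add: eventually_at_right_less)
    then show "eventually (\<lambda>h. a < (\<mu> (x + h *\<^sub>R v) - \<mu> x) / h) (at_right 0)"
      by eventually_elim (rule less_le_trans[OF a norm_deriv_le])
  next
    fix a assume "norm_deriv \<mu> x v < a"
    then obtain k where k: "k > 0" "(\<mu> (x + k *\<^sub>R v) - \<mu> x) / k < a"
      using cInf_lessD[of "(\<lambda>h. (\<mu> (x + h *\<^sub>R v) - \<mu> x) / h) ` {0<..}" a]
      by (auto simp: norm_deriv_def)
    have "eventually (\<lambda>h. h \<in> {0<..<k}) (at_right 0)"
      by (rule eventually_at_right_real[OF k(1)])
    then show "eventually (\<lambda>h. (\<mu> (x + h *\<^sub>R v) - \<mu> x) / h < a) (at_right 0)"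
    proof eventually_elim
      case (elim h)
      then have "(\<mu> (x + h *\<^sub>R v) - \<mu> x) / h \<le> (\<mu> (x + k *\<^sub>R v) - \<mu> x) / k"
        by (intro mu_quotient_mono) auto
      then show ?case using k(2) by (rule le_less_trans)
    qed
  qed
  from filterlim_compose[OF 1 h]
  have 1: "((\<lambda>t. (\<mu> (x + h t *\<^sub>R v) - \<mu> x) / h t) \<longlongrightarrow> norm_deriv \<mu> x v) F" .
  have "((\<lambda>t. \<mu> (w t - v) + \<mu> (v - w t)) \<longlongrightarrow> \<mu> (v - v) + \<mu> (v - v)) F"
    by (intro tendsto_add tendsto_mu tendsto_diff w tendsto_const)
  then have 0: "((\<lambda>t. \<mu> (w t - v) + \<mu> (v - w t)) \<longlongrightarrow> 0) F" by simp
  have 2: "((\<lambda>t. (\<mu> (x + h t *\<^sub>R w t) - \<mu> x) / h t - (\<mu> (x + h t *\<^sub>R v) - \<mu> x) / h t) \<longlongrightarrow> 0) F"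
  proof (rule Lim_null_comparison[OF _ 0])
    show "eventually (\<lambda>t. norm ((\<mu> (x + h t *\<^sub>R w t) - \<mu> x) / h t - (\<mu> (x + h t *\<^sub>R v) - \<mu> x) / h t)
        \<le> \<mu> (w t - v) + \<mu> (v - w t)) F"
      using h0
    proof eventually_elim
      case (elim t)
      have "\<mu> (x + h t *\<^sub>R w t) - \<mu> (x + h t *\<^sub>R v) \<le> h t * \<mu> (w t - v)"
        using mu_diff_le[of "x + h t *\<^sub>R w t" "x + h t *\<^sub>R v"] elim
        by (simp add: scaleR_right_diff_distrib[symmetric] mu_scale)
      moreover have "\<mu> (x + h t *\<^sub>R v) - \<mu> (x + h t *\<^sub>R w t) \<le> h t * \<mu> (v - w t)"
        using mu_diff_le[of "x + h t *\<^sub>R v" "x + h t *\<^sub>R w t"] elim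
        by (simp add: scaleR_right_diff_distrib[symmetric] mu_scale)
      moreover have "0 \<le> h t * \<mu> (w t - v)" "0 \<le> h t * \<mu> (v - w t)"
        using elim by auto
      ultimately have "\<bar>\<mu> (x + h t *\<^sub>R w t) - \<mu> (x + h t *\<^sub>R v)\<bar> \<le> h t * (\<mu> (w t - v) + \<mu> (v - w t))"
        by (auto simp: distrib_left abs_le_iff)
      then show ?case
        using elim by (simp add: diff_divide_distrib[symmetric] abs_divide divide_le_eq mult.commute)
    qed
  qed
  from tendsto_add[OF 2 1] show ?thesis by simp
qed

lemma norm_deriv_le_mu: "norm_deriv \<mu> x v \<le> \<mu> v"
  using norm_deriv_le[of 1 x v] mu_triangle[of x v] by simp

lemma filterlim_times_at_right_0:
  assumes "(c::real) > 0"
  shows "filterlim (\<lambda>h. h * c) (at_right 0) (at_right 0)"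
proof -
  have "((\<lambda>h. h * c) \<longlongrightarrow> 0 * c) (at_right 0)" by (intro tendsto_intros)
  then show ?thesis using assms by (auto simp: filterlim_at eventually_at_filter)
qed

text \<open>Homogeneity of degree 0 in the base point, by rescaling the increment by
  \<open>c\<close>. It lets the base point stay put when \<open>x\<close> is halved.\<close>

lemma norm_deriv_scale_base:
  assumes "c > 0"
  shows "norm_deriv \<mu> (c *\<^sub>R x) v = norm_deriv \<mu> x v"
proof (rule tendsto_unique)
  have "filterlim (\<lambda>h. h * c) (at_right 0) (at_right 0)"
    by (rule filterlim_times_at_right_0[OF assms])
  from norm_deriv_tendsto[OF tendsto_const this, where v=v and x="c *\<^sub>R x"]
  show "((\<lambda>h. (\<mu> (c *\<^sub>R x + (h * c) *\<^sub>R v) - \<mu> (c *\<^sub>R x)) / (h * c)) \<longlongrightarrow> norm_deriv \<mu> (c *\<^sub>R x) v) (at_right 0)" .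
  have "(\<mu> (c *\<^sub>R x + (h * c) *\<^sub>R v) - \<mu> (c *\<^sub>R x)) / (h * c) = (\<mu> (x + h *\<^sub>R v) - \<mu> x) / h" for h
  proof -
    have "c *\<^sub>R x + (h * c) *\<^sub>R v = c *\<^sub>R (x + h *\<^sub>R v)" by (simp add: scaleR_add_right mult.commute)
    then have *: "\<mu> (c *\<^sub>R x + (h * c) *\<^sub>R v) - \<mu> (c *\<^sub>R x) = c * (\<mu> (x + h *\<^sub>R v) - \<mu> x)"
      using assms by (simp only: mu_scale less_imp_le right_diff_distrib)
    have "c * a / (h * c) = a / h" for a
      using assms by (cases "h = 0") (simp_all add: field_simps)
    then show ?thesis unfolding * .
  qed
  moreover have "((\<lambda>h. (\<mu> (x + h *\<^sub>R v) - \<mu> x) / h) \<longlongrightarrow> norm_deriv \<mu> x v) (at_right 0)"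
    by (rule norm_deriv_tendsto) (auto intro: tendsto_const filterlim_ident)
  ultimately show "((\<lambda>h. (\<mu> (c *\<^sub>R x + (h * c) *\<^sub>R v) - \<mu> (c *\<^sub>R x)) / (h * c)) \<longlongrightarrow> norm_deriv \<mu> x v) (at_right 0)"
    by (simp only:)
qed simp

text \<open>The point \<open>x + h (v + w)\<close> is the midpoint of \<open>x + 2 h v\<close> and
  \<open>x + 2 h w\<close>, hence the doubled increments on the right.\<close>

lemma norm_deriv_add: "norm_deriv \<mu> x (v + w) \<le> norm_deriv \<mu> x v + norm_deriv \<mu> x w"
proof (rule tendsto_le)
  show "((\<lambda>h. (\<mu> (x + h *\<^sub>R (v + w)) - \<mu> x) / h) \<longlongrightarrow> norm_deriv \<mu> x (v + w)) (at_right 0)"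
    by (rule norm_deriv_tendsto) (auto intro: tendsto_const filterlim_ident)
  have "filterlim (\<lambda>h::real. h * 2) (at_right 0) (at_right 0)"
    by (rule filterlim_times_at_right_0) simp
  then show "((\<lambda>h. (\<mu> (x + (h * 2) *\<^sub>R v) - \<mu> x) / (h * 2) + (\<mu> (x + (h * 2) *\<^sub>R w) - \<mu> x) / (h * 2)) \<longlongrightarrow>
      norm_deriv \<mu> x v + norm_deriv \<mu> x w) (at_right 0)"
    by (intro tendsto_add norm_deriv_tendsto tendsto_const)
  have "eventually (\<lambda>h::real. 0 < h) (at_right 0)"
    by (simp add: eventually_at_right_less)
  then show "eventually (\<lambda>h. (\<mu> (x + h *\<^sub>R (v + w)) - \<mu> x) / h \<le>
      (\<mu> (x + (h * 2) *\<^sub>R v) - \<mu> x) / (h * 2) + (\<mu> (x + (h * 2) *\<^sub>R w) - \<mu> x) / (h * 2)) (at_right 0)"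
  proof eventually_elim
    case (elim h)
    have "x + h *\<^sub>R (v + w) = (1/2) *\<^sub>R (x + (h * 2) *\<^sub>R v) + (1/2) *\<^sub>R (x + (h * 2) *\<^sub>R w)"
      by (simp add: scaleR_add_right flip: scaleR_add_left)
    then have "\<mu> (x + h *\<^sub>R (v + w)) \<le> (1/2) * \<mu> (x + (h * 2) *\<^sub>R v) + (1/2) * \<mu> (x + (h * 2) *\<^sub>R w)"
      using mu_triangle[of "(1/2) *\<^sub>R (x + (h * 2) *\<^sub>R v)" "(1/2) *\<^sub>R (x + (h * 2) *\<^sub>R w)"]
      by (simp add: mu_scale)
    then have "2 * (\<mu> (x + h *\<^sub>R (v + w)) - \<mu> x) / (h * 2) \<le>
        ((\<mu> (x + (h * 2) *\<^sub>R v) - \<mu> x) + (\<mu> (x + (h * 2) *\<^sub>R w) - \<mu> x)) / (h * 2)"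
      using elim by (intro divide_right_mono) auto
    moreover have "a / h = 2 * a / (h * 2)" for a
      using elim by (simp add: field_simps)
    from this[of "\<mu> (x + h *\<^sub>R (v + w)) - \<mu> x"]
    have "(\<mu> (x + h *\<^sub>R (v + w)) - \<mu> x) / h = 2 * (\<mu> (x + h *\<^sub>R (v + w)) - \<mu> x) / (h * 2)" .
    ultimately show ?case by (simp only: add_divide_distrib)
  qed
qed simp

text \<open>From the left the curve is traversed backwards, with velocity \<open>- v\<close>. Both
  sides matter because an interval of a tagged division extends to both sides of its tag.\<close>

lemma norm_deriv_curve:
  assumes C: "has_dir_deriv C t 1 v"
  shows "((\<lambda>h. (\<mu> (C (t + h)) - \<mu> (C t)) / h) \<longlongrightarrow> norm_deriv \<mu> (C t) v) (at_right 0)"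
    and "((\<lambda>h. (\<mu> (C t) - \<mu> (C (t - h))) / h) \<longlongrightarrow> - norm_deriv \<mu> (C t) (- v)) (at_right 0)"
proof -
  have D: "((\<lambda>h. (C (t + h) - C t) /\<^sub>R h) \<longlongrightarrow> v) (at 0)"
    using C by (simp add: has_dir_deriv_def)
  have ev: "eventually (\<lambda>h::real. 0 < h) (at_right 0)"
    by (simp add: eventually_at_right_less)
  have "filterlim (\<lambda>h::real. h) (at 0) (at_right 0)"
    by (simp add: filterlim_at eventually_at_filter)
  from norm_deriv_tendsto[OF filterlim_compose[OF D this] filterlim_ident, of "C t"]
  show "((\<lambda>h. (\<mu> (C (t + h)) - \<mu> (C t)) / h) \<longlongrightarrow> norm_deriv \<mu> (C t) v) (at_right 0)"
    by (rule Lim_transform_eventually) (use ev in eventually_elim, simp)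
  have "((\<lambda>h::real. - h) \<longlongrightarrow> - 0) (at_right 0)"
    by (intro tendsto_intros)
  then have "filterlim (\<lambda>h::real. - h) (at 0) (at_right 0)"
    by (auto simp: filterlim_at eventually_at_filter)
  from tendsto_minus[OF filterlim_compose[OF D this]]
  have "((\<lambda>h. - ((C (t + - h) - C t) /\<^sub>R - h)) \<longlongrightarrow> - v) (at_right 0)" .
  from tendsto_minus[OF norm_deriv_tendsto[OF this filterlim_ident, of "C t"]]
  show "((\<lambda>h. (\<mu> (C t) - \<mu> (C (t - h))) / h) \<longlongrightarrow> - norm_deriv \<mu> (C t) (- v)) (at_right 0)"
    by (rule Lim_transform_eventually) (use ev in eventually_elim, simp add: diff_divide_distrib)
qed

end

section \<open>The logarithm\<close>

locale lie_finsler = lie_exp K A c0 ex + finsler \<mu>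
  for K :: "'k::t2_space monoid" and A :: "('k, 'e::hausdorff_lcs) chart set" and c0 ex \<mu> +
  fixes R :: real
  assumes Ad_inv: "Ad_invariant K c0 \<mu>" and R: "R > 0"
    and diffeo: "C1_diffeo_onto_open vector_atlas {v. \<mu> v < R} A ex"
begin

definition V :: "'k set" where "V = ex ` {v. \<mu> v < R}"
definition lg :: "'k \<Rightarrow> 'e" where "lg = inv_into {v. \<mu> v < R} ex"

lemma mu_Ad [simp]: "\<mu> (Ad K c0 u v) = \<mu> v"
  using Ad_inv by (simp add: Ad_invariant_def)

lemma open_V: "open V" and inj_ex: "inj_on ex {v. \<mu> v < R}"
  and lg_C1: "mfd_map C1_on A V vector_atlas lg"
  using diffeo by (simp_all add: C1_diffeo_onto_open_def V_def lg_def)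

lemma ex_in_V: "\<mu> v < R \<Longrightarrow> ex v \<in> V"
  by (auto simp: V_def)

lemma lg_ex [simp]: "\<mu> v < R \<Longrightarrow> lg (ex v) = v"
  unfolding lg_def by (rule inv_into_f_f[OF inj_ex]) simp

lemma lg_V: "g \<in> V \<Longrightarrow> ex (lg g) = g" "g \<in> V \<Longrightarrow> \<mu> (lg g) < R"
  by (auto simp: V_def)

lemma one_in_V: "one \<in> V"
  using ex_in_V[of 0] R by simp

lemma mdiff_lg_compose:
  assumes f: "mdf c f x" and V: "f x \<in> V" and c: "is_chart c"
  obtains D where "mdiff c vchart (\<lambda>y. lg (f y)) x D"
proof -
  obtain d D where d: "d \<in> A" "mdiff c d f x D" using f by (auto simp: mdf_def)
  have "mdiff d vchart lg (f x) (dir_deriv (snd vchart \<circ> lg \<circ> chart_inv d) (snd d (f x)))"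
    by (rule mfd_map_imp_mdiff[OF lg_C1 open_V V])
      (use d in \<open>auto simp: vchart_in_vector_atlas mdiff_def\<close>)
  from mdiff_compose[OF d(2) this c chartA[OF d(1)]] show ?thesis by (rule that)
qed

text \<open>Tested on the curve \<open>ex (t v)\<close>, which has velocity \<open>v\<close> and on
  which \<open>lg\<close> is the line \<open>t v\<close> near 0.\<close>

lemma lg_deriv: "mdiff c0 vchart lg one (\<lambda>v. v)"
proof -
  obtain D where D: "mdiff c0 vchart lg one D"
    by (rule mdiff_lg_compose[OF mdf_id[OF c0 one_c0] one_in_V chart_c0])
  have "D v = v" for v
  proof -
    have l: "cdiff vchart (\<lambda>t. 0 + t *\<^sub>R v) 0 v"
      by (simp only: cdiff_vchart has_dir_deriv_line)
    have "eventually (\<lambda>t. 0 + t *\<^sub>R v \<in> {v. \<mu> v < R}) (nhds (0::real))"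
      by (rule isCont_eventually[OF has_dir_deriv_imp_isCont[OF has_dir_deriv_line], where P="\<lambda>z. z \<in> {v. \<mu> v < R}"])
        (rule eventually_nhds_in_open[OF open_mu_less], use R in simp)
    then have ev: "eventually (\<lambda>t. lg (ex (t *\<^sub>R v)) = 0 + t *\<^sub>R v) (nhds (0::real))"
      by eventually_elim simp
    have "cdiff vchart (\<lambda>t. lg (ex (t *\<^sub>R v))) 0 (D v)"
      using cdiff_mdiff[OF ex_cdiff_0[of v] _ chart_c0, of vchart lg D] D by simp
    from cdiff_cong[OF this ev] have "cdiff vchart (\<lambda>t. 0 + t *\<^sub>R v) 0 (D v)" .
    then show ?thesis using l by (rule cdiff_unique)
  qed
  then have "D = (\<lambda>v. v)" by auto
  with D show ?thesis by simp
qed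

text \<open>The operator \<open>D\<^sub>x\<close> of the overview: the derivative at the identity of
  left translation by \<open>ex x\<close>, read in logarithmic coordinates on both sides. It is
  determined when \<open>\<mu> x < R\<close>.\<close>

definition Dop :: "'e \<Rightarrow> 'e \<Rightarrow> 'e"
  where "Dop x = (SOME D. mdiff vchart vchart (\<lambda>v. lg (ex x \<cdot> ex v)) 0 D)"

lemma Dop: "\<mu> x < R \<Longrightarrow> mdiff vchart vchart (\<lambda>v. lg (ex x \<cdot> ex v)) 0 (Dop x)"
proof -
  assume x: "\<mu> x < R"
  have "mdf vchart (\<lambda>v. ex x \<cdot> ex v) 0"
    by (intro mdf_mul mdf_const mdf_ex) auto
  then obtain D where "mdiff vchart vchart (\<lambda>v. lg (ex x \<cdot> ex v)) 0 D"
    by (rule mdiff_lg_compose) (use x ex_in_V in auto)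
  then have "\<exists>D. mdiff vchart vchart (\<lambda>v. lg (ex x \<cdot> ex v)) 0 D" by blast
  then show ?thesis unfolding Dop_def by (rule someI_ex)
qed

lemma Dop_add: "\<mu> x < R \<Longrightarrow> Dop x (v + w) = Dop x v + Dop x w"
  by (rule mdiff_add[OF Dop])

text \<open>Only the velocity of the second factor matters: near \<open>t\<close> the curve
  \<open>k\<close> is \<open>ex\<close> of \<open>lg k\<close>, and \<open>lg k\<close> also has
  velocity \<open>u\<close>.\<close>

lemma cdiff_lg_mul:
  assumes x: "\<mu> x < R" and k: "cdiff c0 k t u" "k t = one"
  shows "cdiff vchart (\<lambda>s. lg (ex x \<cdot> k s)) t (Dop x u)"
proof -
  have 1: "cdiff vchart (\<lambda>s. lg (k s)) t u"
    by (rule cdiff_mdiff[OF k(1) _ chart_c0, where D'="\<lambda>v. v", unfolded k(2), OF lg_deriv])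
  have "lg (k t) = 0" using k lg_ex[of 0] R by simp
  then have 2: "mdiff vchart vchart (\<lambda>v. lg (ex x \<cdot> ex v)) (lg (k t)) (Dop x)" using Dop[OF x] by simp
  note * = cdiff_mdiff[OF 1 2 is_chart_vchart]
  have "isCont k t" using k by (simp add: cdiff_def)
  then have "eventually (\<lambda>s. k s \<in> V) (nhds t)"
    by (rule isCont_eventually[where P="\<lambda>z. z \<in> V"])
      (rule eventually_nhds_in_open[OF open_V], simp add: k(2) one_in_V)
  then have "eventually (\<lambda>s. lg (ex x \<cdot> ex (lg (k s))) = lg (ex x \<cdot> k s)) (nhds t)"
    by eventually_elim (simp only: lg_V(1))
  from cdiff_cong[OF * this] show ?thesis .
qed

text \<open>The norm is constant on the curve \<open>Ad (ex (t v)) x\<close>, whose exponential is the product of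
  \<open>ex x\<close> and the commutator of \<open>ex (- x)\<close> and \<open>ex (t v)\<close>.\<close>

lemma norm_deriv_Dop_Ad_diff:
  assumes x: "\<mu> x < R"
  shows "norm_deriv \<mu> x (Dop x (Ad K c0 (iv (ex x)) v - v)) = 0"
proof -
  let ?k = "\<lambda>t. iv (ex x) \<cdot> ex (t *\<^sub>R v) \<cdot> iv (iv (ex x)) \<cdot> iv (ex (t *\<^sub>R v))"
  let ?C = "\<lambda>t. Ad K c0 (ex (t *\<^sub>R v)) x"
  have "cdiff c0 ?k 0 (Ad K c0 (iv (ex x)) v - v)"
    by (rule cdiff_quot[OF cdiff_conj[OF ex_cdiff_0] ex_cdiff_0]) auto
  then have "cdiff vchart (\<lambda>t. lg (ex x \<cdot> ?k t)) 0 (Dop x (Ad K c0 (iv (ex x)) v - v))"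
    by (rule cdiff_lg_mul[OF x]) simp
  moreover have "lg (ex x \<cdot> ?k t) = ?C t" for t
  proof -
    have "ex x \<cdot> ?k t = ex (t *\<^sub>R v) \<cdot> ex x \<cdot> iv (ex (t *\<^sub>R v))" by (simp add: mul_assoc)
    then show ?thesis unfolding ex_conj using x by simp
  qed
  ultimately have "has_dir_deriv ?C 0 1 (Dop x (Ad K c0 (iv (ex x)) v - v))"
    by (simp add: cdiff_vchart)
  from norm_deriv_curve(1)[OF this]
  have "((\<lambda>h::real. 0) \<longlongrightarrow> norm_deriv \<mu> (?C 0) (Dop x (Ad K c0 (iv (ex x)) v - v))) (at_right 0)"
    by simp
  from tendsto_unique[OF trivial_limit_at_right_real this tendsto_const]
  have "norm_deriv \<mu> (?C 0) (Dop x (Ad K c0 (iv (ex x)) v - v)) = 0" .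
  \<comment> \<open>Conjugation by \<open>ex 0\<close> is trivial. As \<mu> is invariant under
    \<open>Ad\<close>, both vectors lie in the ball where \<open>ex\<close> is injective, so they
    agree.\<close>
  moreover have "?C 0 = x"
  proof -
    have "ex (?C 0) = ex x" using ex_conj[of "ex (0 *\<^sub>R v)" x] by simp
    then have "lg (ex (?C 0)) = lg (ex x)" by simp
    then show ?thesis using x by (simp del: scaleR_zero_left)
  qed
  ultimately show ?thesis by (simp only:)
qed

text \<open>A subadditive function that vanishes on a vector and on its negative is unchanged by
  adding that vector. Replacing \<open>v\<close> by \<open>- v\<close> covers the negative.\<close>

lemma norm_deriv_Dop_add_Ad_diff:
  assumes x: "\<mu> x < R"
  shows "norm_deriv \<mu> x (Dop x (u + (Ad K c0 (iv (ex x)) v - v))) = norm_deriv \<mu> x (Dop x u)"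
proof (rule antisym)
  have *: "norm_deriv \<mu> x (Dop x (u + (Ad K c0 (iv (ex x)) v - v))) \<le> norm_deriv \<mu> x (Dop x u)" for u v
    using norm_deriv_add[of x "Dop x u" "Dop x (Ad K c0 (iv (ex x)) v - v)"]
    by (simp add: Dop_add[OF x] norm_deriv_Dop_Ad_diff[OF x])
  show "norm_deriv \<mu> x (Dop x (u + (Ad K c0 (iv (ex x)) v - v))) \<le> norm_deriv \<mu> x (Dop x u)" by (rule *)
  have "Ad K c0 (iv (ex x)) (- v) = - Ad K c0 (iv (ex x)) v"
    using Ad_diff[of "iv (ex x)" 0 v] by (simp add: Ad_zero)
  then have "u = (u + (Ad K c0 (iv (ex x)) v - v)) + (Ad K c0 (iv (ex x)) (- v) - (- v))" by simp
  then show "norm_deriv \<mu> x (Dop x u) \<le> norm_deriv \<mu> x (Dop x (u + (Ad K c0 (iv (ex x)) v - v)))"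
    using * by metis
qed

text \<open>Locally, the product of \<open>ex x\<close> and \<open>ex (t u)\<close> is the square of \<open>ex (x / 2)\<close> times a curve \<open>k\<close>
  through the identity. If \<open>w\<close> is the derivative of \<open>k\<close>, then \<open>u\<close> is \<open>2 w\<close> up to a term
  \<open>Ad (ex (- x / 2)) w - w\<close>.\<close>

lemma norm_deriv_Dop_half:
  assumes x: "\<mu> x < R"
  shows "norm_deriv \<mu> x (Dop ((1/2) *\<^sub>R x) u) = norm_deriv \<mu> x (Dop x u)"
proof -
  define y where "y = (1/2::real) *\<^sub>R x"
  define g where "g = ex y"
  have "\<mu> y = \<mu> x / 2" by (simp add: y_def mu_scale)
  then have y: "\<mu> y < R" using x mu_nonneg[of x] by linarith
  have gg: "ex x = g \<cdot> g" using ex_add[of "1/2" "1/2" x] by (simp add: g_def y_def)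
  define z where "z t = lg (ex x \<cdot> ex (t *\<^sub>R u))" for t
  have z: "cdiff vchart z 0 (Dop x u)"
    unfolding z_def by (rule cdiff_lg_mul[OF x ex_cdiff_0]) simp
  have z0: "z 0 = x" using x by (simp add: z_def)
  have zc: "isCont z 0" using z by (simp add: cdiff_def)
  define k where "k t = iv g \<cdot> ex ((1/2) *\<^sub>R z t)" for t
  have half: "mdiff vchart vchart (\<lambda>v::'e. (1/2::real) *\<^sub>R v) x (\<lambda>v. (1/2) *\<^sub>R v)"
    by (simp add: mdiff_vchart sdiff_scaleR_left)
      (auto simp: isCont_def intro!: tendsto_scaleR_lcs tendsto_const tendsto_ident_at)
  have k0: "k 0 = one" by (simp add: k_def z0 g_def y_def)
  obtain w where w: "cdiff c0 k 0 w"
  proof -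
    have "mdf vchart (\<lambda>v. iv g \<cdot> ex ((1/2) *\<^sub>R v)) x"
      by (intro mdf_mul mdf_const mdf_compose[OF half] mdf_ex) auto
    then obtain D where D: "mdiff vchart c0 (\<lambda>v. iv g \<cdot> ex ((1/2) *\<^sub>R v)) x D"
      by (rule mdfD[OF _ is_chart_vchart c0]) (use one_c0 in \<open>simp add: g_def y_def\<close>)
    have "cdiff c0 (\<lambda>t. iv g \<cdot> ex ((1/2) *\<^sub>R z t)) 0 (D (Dop x u))"
      using cdiff_mdiff[OF z _ is_chart_vchart, of c0 "\<lambda>v. iv g \<cdot> ex ((1/2) *\<^sub>R v)" D] D z0 by simp
    then show ?thesis using that by (simp add: k_def[abs_def])
  qed
  \<comment> \<open>By construction \<open>ex y\<close> times \<open>k t\<close> is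
    \<open>ex\<close> of half of \<open>z t\<close>, so the logarithm is \<open>z t / 2\<close> near
    0 and its velocity is half that of \<open>z\<close>.\<close>
  have Dw: "Dop y w = (1/2) *\<^sub>R Dop x u"
  proof -
    have 1: "cdiff vchart (\<lambda>t. lg (ex y \<cdot> k t)) 0 (Dop y w)"
      by (rule cdiff_lg_mul[OF y w k0])
    have 2: "cdiff vchart (\<lambda>t. (1/2) *\<^sub>R z t) 0 ((1/2) *\<^sub>R Dop x u)"
      using cdiff_mdiff[OF z _ is_chart_vchart, of vchart "\<lambda>v. (1/2) *\<^sub>R v" "\<lambda>v. (1/2) *\<^sub>R v"] half z0 by simp
    have "isCont (\<lambda>t. (1/2) *\<^sub>R z t) 0" using 2 by (simp add: cdiff_def)
    then have "eventually (\<lambda>t. (1/2) *\<^sub>R z t \<in> {v. \<mu> v < R}) (nhds 0)"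
      by (rule isCont_eventually[where P="\<lambda>v. v \<in> {v. \<mu> v < R}"])
        (rule eventually_nhds_in_open[OF open_mu_less], use y z0 y_def in simp)
    then have "eventually (\<lambda>t. lg (ex y \<cdot> k t) = (1/2) *\<^sub>R z t) (nhds 0)"
      by eventually_elim (simp add: k_def g_def)
    from cdiff_cong[OF 1 this] 2 show ?thesis by (rule cdiff_unique)
  qed
  have "cdiff c0 (\<lambda>t. (iv g \<cdot> k t \<cdot> iv (iv g)) \<cdot> k t) 0 (Ad K c0 (iv g) w + w)"
    by (rule cdiff_mul[OF cdiff_conj[OF w k0] w]) (simp_all add: k0)
  moreover have "eventually (\<lambda>t. (iv g \<cdot> k t \<cdot> iv (iv g)) \<cdot> k t = ex (t *\<^sub>R u)) (nhds 0)"
  proof -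
    have "mdf vchart (\<lambda>v. ex x \<cdot> ex v) 0"
      by (intro mdf_mul mdf_const mdf_ex) auto
    then have "isCont (\<lambda>v. ex x \<cdot> ex v) 0" by (auto simp: mdf_def mdiff_def)
    moreover have "isCont (\<lambda>t. 0 + t *\<^sub>R u) (0::real)"
      by (rule has_dir_deriv_imp_isCont[OF has_dir_deriv_line])
    ultimately have "isCont (\<lambda>t. ex x \<cdot> ex (0 + t *\<^sub>R u)) 0"
      using isCont_o2[of 0 "\<lambda>t. 0 + t *\<^sub>R u" "\<lambda>v. ex x \<cdot> ex v"] by simp
    then have "eventually (\<lambda>t. ex x \<cdot> ex (0 + t *\<^sub>R u) \<in> V) (nhds 0)"
      by (rule isCont_eventually[where P="\<lambda>v. v \<in> V"])
        (rule eventually_nhds_in_open[OF open_V], use ex_in_V[OF x] in simp)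
    then show ?thesis
    proof eventually_elim
      case (elim t)
      then have "ex (z t) = ex x \<cdot> ex (t *\<^sub>R u)" by (simp add: z_def lg_V)
      moreover have "ex (z t) = ex ((1/2) *\<^sub>R z t) \<cdot> ex ((1/2) *\<^sub>R z t)"
        using ex_add[of "1/2" "1/2" "z t"] by simp
      moreover have "ex ((1/2) *\<^sub>R z t) = g \<cdot> k t" by (simp add: k_def)
      ultimately have *: "g \<cdot> k t \<cdot> (g \<cdot> k t) = g \<cdot> g \<cdot> ex (t *\<^sub>R u)" by (simp add: gg)
      \<comment> \<open>Cancelling \<open>g\<close> twice leaves the conjugate of \<open>k t\<close>
        by \<open>iv g\<close>, times \<open>k t\<close>. The velocity of this product at 0 was
        computed just before.\<close>
      have "iv g \<cdot> (iv g \<cdot> (g \<cdot> k t \<cdot> (g \<cdot> k t))) = ex (t *\<^sub>R u)"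
        unfolding * by (simp add: mul_assoc)
      then show ?case by (simp add: mul_assoc)
    qed
  qed
  ultimately have "cdiff c0 (\<lambda>t. ex (t *\<^sub>R u)) 0 (Ad K c0 (iv g) w + w)" by (rule cdiff_cong)
  then have "u = Ad K c0 (iv g) w + w" by (rule cdiff_unique[OF ex_cdiff_0])
  then have u: "u = (w + w) + (Ad K c0 (iv (ex y)) w - w)" by (simp add: g_def)
  \<comment> \<open>The term \<open>Ad (iv g) w - w\<close> is invisible here, so \<open>u\<close>
    may be replaced by \<open>2 w\<close>, whose image under \<open>Dop y\<close> is
    \<open>Dop x u\<close>.\<close>
  have "norm_deriv \<mu> y (Dop y u) = norm_deriv \<mu> y (Dop y (w + w))"
    unfolding u by (rule norm_deriv_Dop_add_Ad_diff[OF y])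
  also have "Dop y (w + w) = Dop x u"
    by (simp add: Dop_add[OF y] Dw flip: scaleR_add_left)
  finally show ?thesis
    using norm_deriv_scale_base[of "1/2" x] by (simp add: y_def)
qed

text \<open>Continuity of the derivative at the one point 0. Strict differentiability at
  \<open>(0, 0)\<close> of the product in logarithmic coordinates controls the difference quotients
  at all base points \<open>(y, 0)\<close> for \<open>y\<close> near 0 and small \<open>h\<close>
  simultaneously. Letting \<open>h\<close> tend to 0 with \<open>y\<close> fixed weakens the strict
  bound to a weak one.\<close>

lemma Dop_near_zero:
  assumes "\<epsilon> > 0"
  shows "eventually (\<lambda>y. \<mu> (Dop y u - u) \<le> \<epsilon>) (nhds 0)"
proof -
  let ?F = "\<lambda>p. lg (ex (fst p) \<cdot> ex (snd p))"
  let ?c = "pchart (vchart :: ('e, 'e) chart) (vchart :: ('e, 'e) chart)"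
  have P: "is_chart ?c" by (simp add: is_chart_pchart)
  have ci: "chart_inv ?c p = p" for p
    using chart_inv_pchart[OF is_chart_vchart is_chart_vchart, of "fst p" "snd p"] by simp
  have 1: "mdiff ?c vchart fst (0, 0) fst" and 2: "mdiff ?c vchart snd (0, 0) snd"
  proof -
    have s: "sdiff (\<lambda>p. p) (0, 0) (\<lambda>p. p :: 'e \<times> 'e)" using sdiff_id[of "(0,0) :: 'e \<times> 'e"] by (simp add: id_def)
    have "sdiff fst (0, 0) (fst :: 'e \<times> 'e \<Rightarrow> 'e)" "sdiff snd (0, 0) (snd :: 'e \<times> 'e \<Rightarrow> 'e)"
      by (rule sdiff_fst[OF s] sdiff_snd[OF s])+
    moreover have "snd (vchart :: ('e, 'e) chart) \<circ> f \<circ> chart_inv ?c = f" for f by (auto simp: ci)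
    moreover have "isCont (fst :: 'e \<times> 'e \<Rightarrow> 'e) (0, 0)" "isCont (snd :: 'e \<times> 'e \<Rightarrow> 'e) (0, 0)"
      by (rule continuous_fst[OF continuous_ident] continuous_snd[OF continuous_ident])+
    ultimately show "mdiff ?c vchart fst (0, 0) fst" "mdiff ?c vchart snd (0, 0) snd"
      by (simp_all add: mdiff_def)
  qed
  have "mdf ?c (\<lambda>p. ex (fst p) \<cdot> ex (snd p)) (0, 0)"
    by (intro mdf_mul mdf_compose[OF 1] mdf_compose[OF 2] mdf_ex P is_chart_vchart)
  then obtain D where D: "mdiff ?c vchart ?F (0, 0) D"
    by (rule mdiff_lg_compose) (use P one_in_V in auto)
  have D0: "D (0, u) = u"
  proof -
    have l: "cdiff vchart (\<lambda>t. 0 + t *\<^sub>R u) 0 u"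
      by (simp only: cdiff_vchart has_dir_deriv_line)
    have "cdiff ?c (\<lambda>t. (0, 0 + t *\<^sub>R u)) 0 (0, u)"
      by (rule cdiff_Pair[OF cdiff_const l]) simp
    from cdiff_mdiff[OF this _ P, of vchart ?F D] D
    have "cdiff vchart (\<lambda>t. lg (ex (0 + t *\<^sub>R u))) 0 (D (0, u))" by simp
    moreover have "cdiff vchart (\<lambda>t. lg (ex (0 + t *\<^sub>R u))) 0 u"
      using cdiff_mdiff[OF ex_cdiff_0[of u] _ chart_c0, of vchart lg "\<lambda>v. v"] lg_deriv by simp
    ultimately show ?thesis by (rule cdiff_unique)
  qed
  have sF: "sdiff ?F (0, 0) D"
  proof -
    have "snd vchart \<circ> ?F \<circ> chart_inv ?c = ?F" by (auto simp: ci)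
    then show ?thesis using D by (simp add: mdiff_def)
  qed
  let ?G = "nhds (0::'e) \<times>\<^sub>F at (0::real)"
  have "((\<lambda>p. (?F ((fst p, 0) + snd p *\<^sub>R (0, u)) - ?F (fst p, 0)) /\<^sub>R snd p) \<longlongrightarrow> D (0, u)) ?G"
    by (rule sdiffD[OF sF]) (auto intro!: tendsto_Pair tendsto_const filterlim_fst filterlim_snd)
  then have "((\<lambda>p. \<mu> ((?F ((fst p, 0) + snd p *\<^sub>R (0, u)) - ?F (fst p, 0)) /\<^sub>R snd p - u)) \<longlongrightarrow> \<mu> (D (0, u) - u)) ?G"
    by (intro tendsto_mu tendsto_diff tendsto_const)
  then have "eventually (\<lambda>p. \<mu> ((?F ((fst p, 0) + snd p *\<^sub>R (0, u)) - ?F (fst p, 0)) /\<^sub>R snd p - u) < \<epsilon>) ?G"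
    using assms by (intro order_tendstoD(2)[where y="\<mu> (D (0, u) - u)"]) (simp_all add: D0)
  then obtain P Q where PQ: "eventually P (nhds (0::'e))" "eventually Q (at (0::real))"
      "\<And>y h. P y \<Longrightarrow> Q h \<Longrightarrow> \<mu> ((?F ((y, 0) + h *\<^sub>R (0, u)) - ?F (y, 0)) /\<^sub>R h - u) < \<epsilon>"
    by (auto simp: eventually_prod_filter)
  have "eventually (\<lambda>y. y \<in> {v. \<mu> v < R}) (nhds 0)"
    by (rule eventually_nhds_in_open[OF open_mu_less]) (use R in simp)
  with PQ(1) show ?thesis
  proof eventually_elim
    case (elim y)
    then have y: "\<mu> y < R" by simp
    have "sdiff (\<lambda>v. lg (ex y \<cdot> ex v)) 0 (Dop y)"
      using Dop[OF y] by (simp add: mdiff_vchart)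
    from sdiff_imp_has_dir_deriv[OF this, of u]
    have "((\<lambda>h. (?F ((y, 0) + h *\<^sub>R (0, u)) - ?F (y, 0)) /\<^sub>R h) \<longlongrightarrow> Dop y u) (at 0)"
      by (simp add: has_dir_deriv_def)
    then have lim: "((\<lambda>h. \<mu> ((?F ((y, 0) + h *\<^sub>R (0, u)) - ?F (y, 0)) /\<^sub>R h - u)) \<longlongrightarrow> \<mu> (Dop y u - u)) (at 0)"
      by (intro tendsto_mu tendsto_diff tendsto_const)
    show ?case
      by (rule tendsto_upperbound[OF lim]) (use PQ(2) PQ(3)[OF elim(1)] in \<open>auto elim!: eventually_mono intro: less_imp_le\<close>)
  qed
qed

lemma norm_deriv_Dop_le:
  assumes x: "\<mu> x < R"
  shows "norm_deriv \<mu> x (Dop x u) \<le> norm_deriv \<mu> x u"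
proof (rule field_le_epsilon)
  fix \<epsilon> :: real assume \<epsilon>: "\<epsilon> > 0"
  \<comment> \<open>Only the argument of \<open>Dop\<close> shrinks; the base point of
    \<open>norm_deriv\<close> may remain \<open>x\<close> by
    \<open>norm_deriv_scale_base\<close>.\<close>
  have "norm_deriv \<mu> x (Dop ((1/2)^n *\<^sub>R x) u) = norm_deriv \<mu> x (Dop x u)" for n
  proof (induction n)
    case (Suc n)
    let ?y = "(1/2)^n *\<^sub>R x"
    have "\<mu> ?y \<le> 1 * \<mu> x"
      unfolding mu_scale[of "(1/2)^n", simplified] by (intro mult_right_mono) (auto intro: power_le_one)
    then have "\<mu> ?y < R" using x by simp
    from norm_deriv_Dop_half[OF this, of u] Suc show ?case
      by (simp add: norm_deriv_scale_base mult.commute)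
  qed simp
  moreover have "((\<lambda>n. (1/2)^n *\<^sub>R x) \<longlongrightarrow> 0 *\<^sub>R x) sequentially"
    by (intro tendsto_scaleR_lcs LIMSEQ_power_zero tendsto_const) simp
  then have "eventually (\<lambda>n. \<mu> (Dop ((1/2)^n *\<^sub>R x) u - u) \<le> \<epsilon>) sequentially"
    using eventually_compose_filterlim[OF Dop_near_zero[OF \<epsilon>]] by simp
  then obtain n where n: "\<mu> (Dop ((1/2)^n *\<^sub>R x) u - u) \<le> \<epsilon>"
    by (auto simp: eventually_sequentially)
  ultimately have "norm_deriv \<mu> x (Dop x u) = norm_deriv \<mu> x (u + (Dop ((1/2)^n *\<^sub>R x) u - u))"
    by simp
  also have "\<dots> \<le> norm_deriv \<mu> x u + norm_deriv \<mu> x (Dop ((1/2)^n *\<^sub>R x) u - u)"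
    by (rule norm_deriv_add)
  also have "\<dots> \<le> norm_deriv \<mu> x u + \<epsilon>"
    using norm_deriv_le_mu[of x "Dop ((1/2)^n *\<^sub>R x) u - u"] n by simp
  finally show "norm_deriv \<mu> x (Dop x u) \<le> norm_deriv \<mu> x u + \<epsilon>" .
qed

end

section \<open>Absolutely continuous functions\<close>

lemma continuous_seminormD:
  assumes "continuous_seminorm p"
  shows seminorm_triangle: "p (x + y) \<le> p x + p y"
    and seminorm_scale: "p (c *\<^sub>R x) = \<bar>c\<bar> * p x"
    and seminorm_continuous: "continuous_on UNIV p"
    and seminorm_zero: "p 0 = 0"
    and seminorm_nonneg: "0 \<le> p x"
    and seminorm_minus: "p (x - y) = p (y - x)"
proof -
  have t: "p (x + y) \<le> p x + p y" and s: "p (c *\<^sub>R x) = \<bar>c\<bar> * p x" for x y c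
    using assms unfolding continuous_seminorm_def by blast+
  show "p (x + y) \<le> p x + p y" "p (c *\<^sub>R x) = \<bar>c\<bar> * p x" by (fact t s)+
  show "continuous_on UNIV p" using assms unfolding continuous_seminorm_def by blast
  show 0: "p 0 = 0" using s[of 0 0] by simp
  have m: "p (- x) = p x" for x using s[of "-1" x] by simp
  show "0 \<le> p x" using t[of x "- x"] m[of x] 0 by simp
  show "p (x - y) = p (y - x)" using m[of "x - y"] by simp
qed

text \<open>The Minkowski functional of a symmetric convex neighbourhood of zero.\<close>

lemma ex_continuous_seminorm:
  fixes U :: "'e::hausdorff_lcs set"
  assumes "open U" "0 \<in> U"
  obtains p where "continuous_seminorm p" "\<And>x. p x < 1 \<Longrightarrow> x \<in> U"
proof -
  obtain V where V: "open V" "0 \<in> V" "convex V" "\<And>y. y - 0 \<in> V \<Longrightarrow> y \<in> U"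
    using open_convex_nbhd_diff[OF assms] by blast
  \<comment> \<open>Intersecting with the reflected set makes the functional even, hence a seminorm
    and not merely a gauge.\<close>
  define W where "W = V \<inter> uminus -` V"
  have "open (uminus -` V)"
    by (rule open_vimage[OF V(1)]) (auto simp: continuous_on_def intro!: tendsto_intros)
  then have oW: "open W" using V(1) by (simp add: W_def open_Int)
  have W0: "0 \<in> W" using V by (simp add: W_def)
  have Wm: "x \<in> W \<Longrightarrow> - x \<in> W" for x by (simp add: W_def)
  have cW: "s *\<^sub>R x + t *\<^sub>R y \<in> W" if "x \<in> W" "y \<in> W" "0 \<le> s" "0 \<le> t" "s + t = 1" for s t x y
  proof -
    have "s *\<^sub>R x + t *\<^sub>R y \<in> V" "s *\<^sub>R (- x) + t *\<^sub>R (- y) \<in> V"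
      using that V(3) by (auto simp: W_def intro!: convexD simp del: scaleR_minus_right)
    then show ?thesis by (simp add: W_def)
  qed
  define T where "T x = {t. 0 < t \<and> x /\<^sub>R t \<in> W}" for x
  define p where "p x = Inf (T x)" for x
  have Tbdd: "bdd_below (T x)" for x by (auto simp: T_def intro!: bdd_belowI[of _ 0])
  have Tne: "T x \<noteq> {}" for x
  proof -
    have "((\<lambda>h. h *\<^sub>R x) \<longlongrightarrow> 0 *\<^sub>R x) (at_right (0::real))"
      by (intro tendsto_scaleR_lcs tendsto_const tendsto_ident_at)
    then have "eventually (\<lambda>h. h *\<^sub>R x \<in> W) (at_right (0::real))"
      using oW W0 by (intro topological_tendstoD[of _ 0]) auto
    moreover have "eventually (\<lambda>h. 0 < h) (at_right (0::real))" by (rule eventually_at_right_less)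
    ultimately have "eventually (\<lambda>h. inverse h \<in> T x) (at_right (0::real))"
      by eventually_elim (simp add: T_def)
    then show ?thesis using eventually_happens'[OF trivial_limit_at_right_real] by blast
  qed
  have p_le: "p x \<le> t" if "0 < t" "x /\<^sub>R t \<in> W" for x t
    unfolding p_def by (rule cInf_lower[OF _ Tbdd]) (use that in \<open>simp add: T_def\<close>)
  have inW: "x /\<^sub>R t \<in> W" "0 < t" if "p x < t" for x t
  proof -
    obtain s where s: "0 < s" "x /\<^sub>R s \<in> W" "s < t"
      using cInf_lessD[OF Tne \<open>p x < t\<close>[unfolded p_def]] by (auto simp: T_def)
    have "(s / t) *\<^sub>R (x /\<^sub>R s) + (1 - s / t) *\<^sub>R 0 \<in> W"
      using s by (intro cW W0) auto
    then show "x /\<^sub>R t \<in> W" using s by (simp add: field_simps)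
    show "0 < t" using s by simp
  qed
  have nonneg: "0 \<le> p x" for x
    unfolding p_def by (rule cInf_greatest[OF Tne]) (simp add: T_def)
  have scale_quot: "(s / r) *\<^sub>R (z /\<^sub>R s) = z /\<^sub>R r" if "s > 0" for s r :: real and z :: 'e
  proof -
    have "(s / r) * inverse s = inverse r" using that by (simp add: divide_inverse)
    then show ?thesis by (simp only: scaleR_scaleR)
  qed
  have comb: "(x + y) /\<^sub>R (s + t) \<in> W"
    if "x /\<^sub>R s \<in> W" "0 < s" "y /\<^sub>R t \<in> W" "0 < t" for x y s t
  proof -
    have "(s / (s + t)) *\<^sub>R (x /\<^sub>R s) + (t / (s + t)) *\<^sub>R (y /\<^sub>R t) \<in> W"
      by (rule cW[OF that(1,3)]) (use that in \<open>auto simp: add_divide_distrib[symmetric]\<close>)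
    then show ?thesis
      unfolding scale_quot[OF that(2)] scale_quot[OF that(4)] by (simp only: scaleR_add_right)
  qed
  have tri: "p (x + y) \<le> p x + p y" for x y
  proof (rule field_le_epsilon)
    fix e :: real assume e: "e > 0"
    have "p x < p x + e / 2" "p y < p y + e / 2" using e by auto
    from comb[OF inW[OF this(1)] inW[OF this(2)]] inW(2)[OF this(1)] inW(2)[OF this(2)]
    have "p (x + y) \<le> (p x + e / 2) + (p y + e / 2)" by (intro p_le) linarith
    then show "p (x + y) \<le> p x + p y + e" by simp
  qed
  have minus: "p (- x) = p x" for x
  proof -
    have "T (- x) = T x" for x
    proof -
      have "- x /\<^sub>R t \<in> W \<longleftrightarrow> x /\<^sub>R t \<in> W" for t
        using Wm[of "x /\<^sub>R t"] Wm[of "- x /\<^sub>R t"] by auto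
      then show ?thesis by (simp add: T_def)
    qed
    then show ?thesis by (simp add: p_def)
  qed
  have scale_le: "p (c *\<^sub>R x) \<le> c * p x" if c: "c > 0" for c x
  proof -
    have "p (c *\<^sub>R x) / c \<le> p x"
    proof (rule field_le_epsilon)
      fix e :: real assume e: "e > 0"
      have "x /\<^sub>R (p x + e) \<in> W" "0 < p x + e" using inW[of x "p x + e"] e by auto
      moreover have "(c *\<^sub>R x) /\<^sub>R (c * r) = x /\<^sub>R r" for r
        using c by simp
      ultimately have "p (c *\<^sub>R x) \<le> c * (p x + e)"
        by (intro p_le mult_pos_pos[OF c]) (simp_all only:)
      then show "p (c *\<^sub>R x) / c \<le> p x + e" using c by (simp add: divide_le_eq mult.commute)
    qed
    then show ?thesis using c by (simp add: divide_le_eq mult.commute)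
  qed
  have scale_pos: "p (c *\<^sub>R x) = c * p x" if c: "c > 0" for c x
  proof (rule antisym)
    have "p (inverse c *\<^sub>R (c *\<^sub>R x)) \<le> inverse c * p (c *\<^sub>R x)"
      using c by (intro scale_le) simp
    then show "c * p x \<le> p (c *\<^sub>R x)" using c by (simp add: field_simps)
  qed (rule scale_le[OF c])
  have zero: "p 0 = 0"
    using scale_pos[of 2 0] by simp
  have scale: "p (c *\<^sub>R x) = \<bar>c\<bar> * p x" for c x
  proof -
    consider "c > 0" | "c = 0" | "c < 0" by linarith
    then show ?thesis
    proof cases
      case 3
      then have "p (c *\<^sub>R x) = p ((- c) *\<^sub>R x)" using minus[of "c *\<^sub>R x"] by simp
      then show ?thesis using 3 scale_pos[of "- c" x] by simp
    qed (auto simp: zero scale_pos)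
  qed
  have cont: "continuous_on UNIV p"
    unfolding continuous_on_def
  proof
    fix x
    have lim0: "((\<lambda>y. p (y - x)) \<longlongrightarrow> 0) (at x)"
    proof (rule tendstoI)
      fix e :: real assume e: "e > 0"
      have "((\<lambda>y. (2 / e) *\<^sub>R (y - x)) \<longlongrightarrow> (2 / e) *\<^sub>R (x - x)) (at x)"
        by (intro tendsto_scaleR_lcs tendsto_diff tendsto_const tendsto_ident_at)
      then have "eventually (\<lambda>y. (2 / e) *\<^sub>R (y - x) \<in> W) (at x)"
        using oW W0 by (intro topological_tendstoD[of _ 0]) auto
      then show "eventually (\<lambda>y. dist (p (y - x)) 0 < e) (at x)"
      proof eventually_elim
        case (elim y)
        then have "p (y - x) \<le> e / 2" using e by (intro p_le) auto
        then show ?case using e nonneg[of "y - x"] by (simp add: dist_real_def)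
      qed
    qed
    have "((\<lambda>y. p y - p x) \<longlongrightarrow> 0) (at x)"
    proof (rule Lim_null_comparison[OF always_eventually lim0], rule)
      fix y
      have "p y \<le> p (y - x) + p x" "p x \<le> p (x - y) + p y" "p (x - y) = p (y - x)"
        using tri[of "y - x" x] tri[of "x - y" y] minus[of "x - y"] by simp_all
      then show "norm (p y - p x) \<le> p (y - x)" by simp
    qed
    then show "(p \<longlongrightarrow> p x) (at x within UNIV)" by (simp add: LIM_zero_iff)
  qed
  show ?thesis
  proof
    show "continuous_seminorm p"
      unfolding continuous_seminorm_def using cont tri scale by blast
    show "x \<in> U" if "p x < 1" for x
      using inW(1)[OF that] V(4)[of x] by (simp add: W_def)
  qed
qed

section \<open>Absolute continuity over finite families of intervals\<close>

definition interval_family :: "real set \<Rightarrow> (real \<times> real) set \<Rightarrow> bool"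
  where "interval_family J I \<longleftrightarrow> finite I \<and> (\<forall>(x, y)\<in>I. x \<le> y \<and> {x..y} \<subseteq> J) \<and>
    pairwise (\<lambda>i j. {fst i<..<snd i} \<inter> {fst j<..<snd j} = {}) I"

lemma abs_continuous_on_iff:
  "abs_continuous_on J f \<longleftrightarrow> (\<forall>p. continuous_seminorm p \<longrightarrow> (\<forall>\<epsilon>>0. \<exists>\<delta>>0.
    \<forall>I. interval_family J I \<and> (\<Sum>(x, y)\<in>I. y - x) < \<delta> \<longrightarrow> (\<Sum>(x, y)\<in>I. p (f y - f x)) < \<epsilon>))"
  unfolding abs_continuous_on_def interval_family_def by (simp only: conj_assoc)

lemma abs_continuous_onD:
  assumes "abs_continuous_on J f" "continuous_seminorm p" "\<epsilon> > 0"
  obtains \<delta> where "\<delta> > 0" "\<And>I. interval_family J I \<Longrightarrow>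
      (\<Sum>(x, y)\<in>I. y - x) < \<delta> \<Longrightarrow> (\<Sum>(x, y)\<in>I. p (f y - f x)) < \<epsilon>"
  using assms unfolding abs_continuous_on_iff by blast

lemma abs_continuous_on_subset:
  assumes "abs_continuous_on J f" "J' \<subseteq> J"
  shows "abs_continuous_on J' f"
proof -
  have "interval_family J I" if "interval_family J' I" for I
    using that assms(2) unfolding interval_family_def by fastforce
  with assms(1) show ?thesis unfolding abs_continuous_on_iff by blast
qed

text \<open>The gauge confines the intervals tagged in the null set \<open>N\<close> to an open set of small measure;
  there absolute continuity bounds the increments of \<open>f\<close>.\<close>

lemma ftc_ac_inequality:
  fixes f g :: "real \<Rightarrow> real" and c :: "real \<Rightarrow> 'e::{real_vector,topological_space}"
  assumes ab: "a \<le> b"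
    and c: "abs_continuous_on {a..b} c" and q: "continuous_seminorm q"
    and fc: "\<And>u v. a \<le> u \<Longrightarrow> u \<le> v \<Longrightarrow> v \<le> b \<Longrightarrow> f v - f u \<le> q (c v - c u)"
    and N: "negligible N"
    and g: "set_integrable lebesgue {a..b} g"
    and loc: "\<And>t \<epsilon>. t \<in> {a..b} \<Longrightarrow> t \<notin> N \<Longrightarrow> \<epsilon> > 0 \<Longrightarrow>
      \<exists>d>0. \<forall>u v. a \<le> u \<and> u \<le> t \<and> t \<le> v \<and> v \<le> b \<and> v - u < d \<longrightarrow> f v - f u \<le> (g t + \<epsilon>) * (v - u)"
  shows "f b - f a \<le> set_lebesgue_integral lebesgue {a..b} g"
proof -
  define I where "I = set_lebesgue_integral lebesgue {a..b} g"
  \<comment> \<open>Changing the integrand on a null set keeps the integral, and intervals tagged in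
    \<open>N\<close> then drop out of the Riemann sum.\<close>
  define G where "G t = (if t \<in> N then 0 else g t)" for t
  have gI: "(g has_integral I) {a..b}"
    unfolding I_def by (rule has_integral_set_lebesgue[OF g])
  have "\<And>t. t \<in> {a..b} - N \<Longrightarrow> G t = g t" unfolding G_def by simp
  from has_integral_spike[OF N this gI] have G: "(G has_integral I) {a..b}" .
  \<comment> \<open>The three errors are \<epsilon> times the length \<open>b - a\<close> from tags
    outside \<open>N\<close>, one \<epsilon> from tags in \<open>N\<close>, and one \<epsilon> from
    the Riemann sum.\<close>
  have main: "f b - f a \<le> I + \<epsilon> * (b - a + 2)" if \<epsilon>: "\<epsilon> > 0" for \<epsilon>
  proof -
    from G[unfolded has_integral_real, rule_format, OF \<epsilon>] obtain \<gamma>1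
      where \<gamma>1: "gauge \<gamma>1 \<and> (\<forall>D. D tagged_division_of {a..b} \<and> \<gamma>1 fine D \<longrightarrow>
        norm ((\<Sum>(x, k)\<in>D. measure lborel k *\<^sub>R G x) - I) < \<epsilon>)" by (elim exE)
    note \<gamma>1 = \<gamma>1[THEN conjunct1] \<gamma>1[THEN conjunct2, rule_format, OF conjI]
    obtain \<delta> where \<delta>: "\<delta> > 0" "\<And>J. interval_family {a..b} J \<Longrightarrow>
        (\<Sum>(x, y)\<in>J. y - x) < \<delta> \<Longrightarrow> (\<Sum>(x, y)\<in>J. q (c y - c x)) < \<epsilon>"
      using abs_continuous_onD[OF c q \<epsilon>] by blast
    have "N \<in> null_sets lebesgue" using N by (simp add: negligible_iff_null_sets)
    then have Ns: "N \<in> sets lebesgue" "emeasure lebesgue N = 0" by auto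
    obtain U where U: "open U" "N \<subseteq> U" "U - N \<in> lmeasurable" "emeasure lebesgue (U - N) < ennreal \<delta>"
      using sets_lebesgue_outer_open[OF Ns(1) \<delta>(1)] by blast
    have "U = (U - N) \<union> N" using U by auto
    then have Ul: "U \<in> lmeasurable" and mU: "measure lebesgue U < \<delta>"
    proof -
      have "N \<in> lmeasurable" using N by (rule negligible_imp_measurable)
      with U(3) show "U \<in> lmeasurable" using \<open>U = (U - N) \<union> N\<close> fmeasurable.Un by metis
      have "measure lebesgue U \<le> measure lebesgue (U - N) + measure lebesgue N"
        using \<open>U = (U - N) \<union> N\<close> measure_Un_le[of "U - N" lebesgue N] U(3) Ns(1) by (metis fmeasurableD)
      also have "measure lebesgue N = 0" using N by (simp add: negligible_imp_measure0)
      also have "measure lebesgue (U - N) < \<delta>"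
        using U(3,4) \<delta>(1) by (simp add: emeasure_eq_measure2 ennreal_less_iff)
      finally show "measure lebesgue U < \<delta>" by simp
    qed
    have "\<exists>d. t \<in> {a..b} \<longrightarrow> t \<notin> N \<longrightarrow> d > 0 \<and> (\<forall>u v. a \<le> u \<and> u \<le> t \<and> t \<le> v \<and> v \<le> b \<and> v - u < d \<longrightarrow>
        f v - f u \<le> (g t + \<epsilon>) * (v - u))" for t
      using loc[OF _ _ \<epsilon>] by blast
    then obtain d where d: "\<And>t. t \<in> {a..b} \<Longrightarrow> t \<notin> N \<Longrightarrow> d t > 0"
      "\<And>t u v. t \<in> {a..b} \<Longrightarrow> t \<notin> N \<Longrightarrow> a \<le> u \<Longrightarrow> u \<le> t \<Longrightarrow> t \<le> v \<Longrightarrow> v \<le> b \<Longrightarrow> v - u < d t \<Longrightarrow>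
        f v - f u \<le> (g t + \<epsilon>) * (v - u)"
      by metis
    \<comment> \<open>Half the radius suffices because the interval contains its tag: its two ends
      then differ by less than \<open>d t\<close>. Beyond \<open>{a..b}\<close> there are no tags,
      so any ball will do.\<close>
    define \<gamma>2 where "\<gamma>2 t = (if t \<in> N then U else if t \<in> {a..b} then ball t (d t / 2) else ball t 1)" for t
    have "gauge \<gamma>2"
      using U d(1) by (auto simp: gauge_def \<gamma>2_def subset_iff)
    with \<gamma>1 have "gauge (\<lambda>t. \<gamma>1 t \<inter> \<gamma>2 t)" by (intro gauge_Int)
    then obtain D where D: "D tagged_division_of {a..b}" "(\<lambda>t. \<gamma>1 t \<inter> \<gamma>2 t) fine D"
      using fine_division_exists_real by blast
    have f12: "\<gamma>1 fine D" "\<gamma>2 fine D" using D(2) by (auto simp: fine_Int)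
    have finD: "finite D" using D(1) by auto
    have Dk: "\<exists>u v. k = {u..v} \<and> u \<le> x \<and> x \<le> v \<and> a \<le> u \<and> v \<le> b" if "(x, k) \<in> D" for x k
    proof -
      obtain u v where k: "k = cbox u v" using tagged_division_ofD(4)[OF D(1) \<open>(x, k) \<in> D\<close>] by blast
      have "x \<in> k" "k \<subseteq> {a..b}" using tagged_division_ofD(2,3)[OF D(1) \<open>(x, k) \<in> D\<close>] by auto
      then show ?thesis using k by (intro exI[of _ u] exI[of _ v]) auto
    qed
    \<comment> \<open>Degenerate intervals contribute nothing to any of the sums. The remaining ones
      have nonempty interior, so distinct tagged intervals have distinct underlying
      intervals.\<close>
    define D' where "D' = {p \<in> D. Inf (snd p) < Sup (snd p)}"
    define DN where "DN = {p \<in> D'. fst p \<in> N}"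
    have fin: "finite D'" "finite DN" using finD by (auto simp: D'_def DN_def)
    have D'D: "D' \<subseteq> D" "DN \<subseteq> D'" by (auto simp: D'_def DN_def)
    have inj: "inj_on snd D'"
    proof (rule inj_onI)
      fix p p' assume pp: "p \<in> D'" "p' \<in> D'" "snd p = snd p'"
      show "p = p'"
      proof (rule ccontr)
        assume ne: "p \<noteq> p'"
        have inD: "(fst p, snd p) \<in> D" "(fst p', snd p') \<in> D" using pp(1,2) D'D by auto
        moreover have "(fst p, snd p) \<noteq> (fst p', snd p')" using ne by simp
        ultimately have int: "interior (snd p) \<inter> interior (snd p') = {}"
          by (rule tagged_division_ofD(5)[OF D(1)])
        obtain u v where uv: "snd p = {u..v}" "u \<le> v"
          using Dk[OF inD(1)] by fastforce
        moreover have "Inf (snd p) < Sup (snd p)" using pp(1) by (simp add: D'_def)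
        ultimately have "u < v" by simp
        then show False using int unfolding pp(3)[symmetric] uv(1) by simp
      qed
    qed
    have deg: "Sup k = Inf k" if "(x, k) \<in> D" "(x, k) \<notin> D'" for x k
      using Dk[OF that(1)] that by (auto simp: D'_def)
    have sum1: "f b - f a = (\<Sum>p\<in>D'. f (Sup (snd p)) - f (Inf (snd p)))"
    proof -
      have "f b - f a = (\<Sum>p\<in>D. f (Sup (snd p)) - f (Inf (snd p)))"
        using additive_tagged_division_1[OF ab D(1), of f] by (simp add: case_prod_beta')
      also have "\<dots> = (\<Sum>p\<in>D'. f (Sup (snd p)) - f (Inf (snd p)))"
        by (rule sum.mono_neutral_right[OF finD D'D(1)]) (auto dest: deg)
      finally show ?thesis .
    qed
    have sum2: "(\<Sum>(x, k)\<in>D. measure lborel k *\<^sub>R G x) = (\<Sum>p\<in>D' - DN. measure lborel (snd p) * g (fst p))"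
    proof -
      have "(\<Sum>(x, k)\<in>D. measure lborel k *\<^sub>R G x) = (\<Sum>p\<in>D. measure lborel (snd p) * G (fst p))"
        by (simp add: case_prod_beta')
      also have "\<dots> = (\<Sum>p\<in>D' - DN. measure lborel (snd p) * G (fst p))"
      proof (rule sum.mono_neutral_right[OF finD])
        show "\<forall>p\<in>D - (D' - DN). measure lborel (snd p) * G (fst p) = 0"
        proof
          fix p assume p: "p \<in> D - (D' - DN)"
          show "measure lborel (snd p) * G (fst p) = 0"
          proof (cases "p \<in> DN")
            case True then show ?thesis by (simp add: DN_def G_def)
          next
            case False
            then have "p \<in> D" "p \<notin> D'" using p by auto
            then show ?thesis using Dk[of "fst p" "snd p"] deg[of "fst p" "snd p"] by auto
          qed
        qed
      qed (use D'D in auto)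
      also have "\<dots> = (\<Sum>p\<in>D' - DN. measure lborel (snd p) * g (fst p))"
        by (rule sum.cong) (auto simp: DN_def G_def)
      finally show ?thesis .
    qed
    have good: "(\<Sum>p\<in>D' - DN. f (Sup (snd p)) - f (Inf (snd p))) \<le>
        (\<Sum>p\<in>D' - DN. measure lborel (snd p) * g (fst p)) + \<epsilon> * (b - a)"
    proof -
      have "(\<Sum>p\<in>D' - DN. f (Sup (snd p)) - f (Inf (snd p))) \<le>
          (\<Sum>p\<in>D' - DN. measure lborel (snd p) * g (fst p) + \<epsilon> * measure lborel (snd p))"
      proof (rule sum_mono)
        fix p assume p: "p \<in> D' - DN"
        obtain t k where pk: "p = (t, k)" by (cases p)
        have tk: "(t, k) \<in> D" "t \<notin> N" using p pk D'D by (auto simp: DN_def)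
        obtain u v where k: "k = {u..v}" "u \<le> t" "t \<le> v" "a \<le> u" "v \<le> b" using Dk[OF tk(1)] by blast
        have tab: "t \<in> {a..b}" using k by auto
        have "k \<subseteq> ball t (d t / 2)" using fineD[OF f12(2) tk(1)] tk tab by (simp add: \<gamma>2_def)
        moreover have "u \<in> k" "v \<in> k" using k by auto
        ultimately have "u \<in> ball t (d t / 2)" "v \<in> ball t (d t / 2)" by blast+
        then have "\<bar>t - u\<bar> < d t / 2" "\<bar>t - v\<bar> < d t / 2" by (simp_all add: dist_real_def)
        then have "v - u < d t" by linarith
        from d(2)[OF tab tk(2) k(4,2,3,5) this]
        show "f (Sup (snd p)) - f (Inf (snd p)) \<le> measure lborel (snd p) * g (fst p) + \<epsilon> * measure lborel (snd p)"
          using k by (simp add: pk algebra_simps)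
      qed
      also have "\<dots> = (\<Sum>p\<in>D' - DN. measure lborel (snd p) * g (fst p)) + \<epsilon> * (\<Sum>p\<in>D' - DN. measure lborel (snd p))"
        by (simp add: sum.distrib sum_distrib_left)
      also have "(\<Sum>p\<in>D' - DN. measure lborel (snd p)) \<le> (\<Sum>p\<in>D. measure lborel (snd p))"
        by (rule sum_mono2[OF finD]) (use D'D in auto)
      also have "(\<Sum>p\<in>D. measure lborel (snd p)) = b - a"
        using additive_content_tagged_division[of D a b] D(1) ab by (simp add: case_prod_beta')
      finally show ?thesis using \<epsilon> by simp
    qed
    have bad: "(\<Sum>p\<in>DN. f (Sup (snd p)) - f (Inf (snd p))) \<le> \<epsilon>"
    proof -
      define e where "e p = (Inf (snd p), Sup (snd p))" for p :: "real \<times> real set"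
      have DNk: "\<exists>u v. snd p = {u..v} \<and> u < v \<and> a \<le> u \<and> v \<le> b \<and> e p = (u, v) \<and> {u..v} \<subseteq> U" if "p \<in> DN" for p
      proof -
        have "(fst p, snd p) \<in> D" "fst p \<in> N" "Inf (snd p) < Sup (snd p)"
          using \<open>p \<in> DN\<close> by (auto simp: DN_def D'_def)
        moreover from this have "snd p \<subseteq> U" using fineD[OF f12(2)] by (fastforce simp: \<gamma>2_def)
        ultimately show ?thesis using Dk[of "fst p" "snd p"] by (auto simp: e_def)
      qed
      have inj_e: "inj_on e DN"
      proof (rule inj_onI)
        fix p p' assume p: "p \<in> DN" "p' \<in> DN" "e p = e p'"
        then have "snd p = snd p'" using DNk[OF p(1)] DNk[OF p(2)] by auto
        then show "p = p'" using inj p D'D by (auto dest: inj_onD)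
      qed
      have div: "snd ` DN division_of \<Union>(snd ` DN)"
      proof (rule division_of_subset)
        have dv: "snd ` D division_of {a..b}" by (rule division_of_tagged_division[OF D(1)])
        then show "snd ` D division_of \<Union>(snd ` D)" by (simp add: division_ofD(6))
        show "snd ` DN \<subseteq> snd ` D" using D'D by auto
      qed
      have "(\<Sum>(x, y)\<in>e ` DN. y - x) = (\<Sum>p\<in>DN. measure lebesgue (snd p))"
      proof -
        have "(\<Sum>(x, y)\<in>e ` DN. y - x) = (\<Sum>p\<in>DN. snd (e p) - fst (e p))"
          by (simp add: sum.reindex[OF inj_e] case_prod_beta')
        also have "\<dots> = (\<Sum>p\<in>DN. measure lebesgue (snd p))"
          by (rule sum.cong) (use DNk in fastforce)+
        finally show ?thesis .
      qed
      also have "\<dots> = (\<Sum>k\<in>snd ` DN. measure lebesgue k)"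
        using sum.reindex[OF inj_on_subset[OF inj D'D(2)], of "measure lebesgue"] by simp
      also have "\<dots> = measure lebesgue (\<Union>(snd ` DN))"
        by (rule content_division[OF div])
      also have "\<dots> \<le> measure lebesgue U"
      proof (rule measure_mono_fmeasurable[OF _ _ Ul])
        show "\<Union>(snd ` DN) \<subseteq> U" using DNk by fastforce
        show "\<Union>(snd ` DN) \<in> sets lebesgue" using lmeasurable_division[OF div] by auto
      qed
      finally have small: "(\<Sum>(x, y)\<in>e ` DN. y - x) < \<delta>" using mU by simp
      have "(\<Sum>(x, y)\<in>e ` DN. q (c y - c x)) < \<epsilon>"
      proof (rule \<delta>(2)[OF _ small], unfold interval_family_def, intro conjI)
        show "finite (e ` DN)" using fin by simp
        show "\<forall>(x, y)\<in>e ` DN. x \<le> y \<and> {x..y} \<subseteq> {a..b}" using DNk by fastforce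
        show "pairwise (\<lambda>i j. {fst i<..<snd i} \<inter> {fst j<..<snd j} = {}) (e ` DN)"
        proof (rule pairwiseI)
          fix i j assume ij: "i \<in> e ` DN" "j \<in> e ` DN" "i \<noteq> j"
          then obtain p p' where p: "p \<in> DN" "p' \<in> DN" "i = e p" "j = e p'" "p \<noteq> p'" by auto
          have "(fst p, snd p) \<in> D" "(fst p', snd p') \<in> D" using p(1,2) D'D by auto
          moreover have "(fst p, snd p) \<noteq> (fst p', snd p')" using p(5) by simp
          ultimately have "interior (snd p) \<inter> interior (snd p') = {}"
            by (rule tagged_division_ofD(5)[OF D(1)])
          then show "{fst i<..<snd i} \<inter> {fst j<..<snd j} = {}"
            using DNk[OF p(1)] DNk[OF p(2)] p by auto
        qed
      qed
      moreover have "(\<Sum>p\<in>DN. f (Sup (snd p)) - f (Inf (snd p))) \<le> (\<Sum>p\<in>DN. q (c (snd (e p)) - c (fst (e p))))"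
      proof (rule sum_mono)
        fix p assume "p \<in> DN"
        then show "f (Sup (snd p)) - f (Inf (snd p)) \<le> q (c (snd (e p)) - c (fst (e p)))"
          using DNk[of p] fc by auto
      qed
      moreover have "(\<Sum>p\<in>DN. q (c (snd (e p)) - c (fst (e p)))) = (\<Sum>(x, y)\<in>e ` DN. q (c y - c x))"
        by (simp add: sum.reindex[OF inj_e] case_prod_beta')
      ultimately show ?thesis by simp
    qed
    have "f b - f a = (\<Sum>p\<in>D' - DN. f (Sup (snd p)) - f (Inf (snd p))) + (\<Sum>p\<in>DN. f (Sup (snd p)) - f (Inf (snd p)))"
      unfolding sum1 by (rule sum.subset_diff[OF D'D(2) fin(1)])
    also have "\<dots> \<le> (\<Sum>p\<in>D' - DN. measure lborel (snd p) * g (fst p)) + \<epsilon> * (b - a) + \<epsilon>"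
      using good bad by linarith
    also have "(\<Sum>p\<in>D' - DN. measure lborel (snd p) * g (fst p)) \<le> I + \<epsilon>"
      using \<gamma>1(2)[OF D(1) f12(1)] unfolding sum2 by (simp add: abs_less_iff)
    finally show ?thesis by (simp add: algebra_simps)
  qed
  show ?thesis
    unfolding I_def[symmetric]
  proof (rule field_le_epsilon)
    fix e :: real assume e: "e > 0"
    have "f b - f a \<le> I + e / (b - a + 2) * (b - a + 2)"
      by (rule main) (use e ab in simp)
    then show "f b - f a \<le> I + e" using ab by simp
  qed
qed

definition ac_wrt :: "('e \<Rightarrow> real) \<Rightarrow> real set \<Rightarrow> (real \<Rightarrow> 'e::{real_vector,topological_space}) \<Rightarrow> bool"
  where "ac_wrt p J f \<longleftrightarrow> (\<forall>\<epsilon>>0. \<exists>\<delta>>0.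
    \<forall>I. interval_family J I \<and> (\<Sum>(x, y)\<in>I. y - x) < \<delta> \<longrightarrow> (\<Sum>(x, y)\<in>I. p (f y - f x)) < \<epsilon>)"

lemma abs_continuous_on_iff_ac_wrt:
  "abs_continuous_on J f \<longleftrightarrow> (\<forall>p. continuous_seminorm p \<longrightarrow> ac_wrt p J f)"
  by (simp add: abs_continuous_on_iff ac_wrt_def)

text \<open>Makes the truncation of intervals at a point injective, so that sums over the truncated
  family can be reindexed.\<close>

lemma interval_family_eqI:
  assumes I: "interval_family J I" and "(x, y) \<in> I" "(x', y') \<in> I" "x < y" "x' < y'" "x = x' \<or> y = y'"
  shows "(x, y) = (x', y')"
proof (rule ccontr)
  assume "(x, y) \<noteq> (x', y')"
  with I assms(2,3) have "{x<..<y} \<inter> {x'<..<y'} = {}"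
    unfolding interval_family_def pairwise_def by fastforce
  then have "{max x x'<..<min y y'} = {}" by (simp add: greaterThanLessThan_def lessThan_def greaterThan_def set_eq_iff)
  then show False using assms(4-6) by (auto simp: greaterThanLessThan_empty_iff)
qed

lemma interval_family_image:
  assumes I: "interval_family J I"
    and e: "\<And>x y. (x, y) \<in> I' \<Longrightarrow> (x, y) \<in> I \<and> x \<le> fst (e (x, y)) \<and> fst (e (x, y)) \<le> snd (e (x, y)) \<and>
      snd (e (x, y)) \<le> y \<and> {fst (e (x, y))..snd (e (x, y))} \<subseteq> J'"
  shows "interval_family J' (e ` I')"
  unfolding interval_family_def
proof (intro conjI)
  have "I' \<subseteq> I" using e by auto
  then show "finite (e ` I')" using I finite_subset by (auto simp: interval_family_def)
  have "fst (e k) \<le> snd (e k) \<and> {fst (e k)..snd (e k)} \<subseteq> J'" if "k \<in> I'" for k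
    using e[of "fst k" "snd k"] that by simp
  then show "\<forall>(x, y)\<in>e ` I'. x \<le> y \<and> {x..y} \<subseteq> J'" by (auto simp: case_prod_beta')
  show "pairwise (\<lambda>i j. {fst i<..<snd i} \<inter> {fst j<..<snd j} = {}) (e ` I')"
  proof (rule pairwiseI)
    fix i j assume "i \<in> e ` I'" "j \<in> e ` I'" "i \<noteq> j"
    then obtain k l where kl: "k \<in> I'" "l \<in> I'" "i = e k" "j = e l" "k \<noteq> l" by auto
    have k: "k \<in> I" "fst k \<le> fst (e k)" "snd (e k) \<le> snd k" using e[of "fst k" "snd k"] kl(1) by auto
    have l: "l \<in> I" "fst l \<le> fst (e l)" "snd (e l) \<le> snd l" using e[of "fst l" "snd l"] kl(2) by auto
    have "{fst k<..<snd k} \<inter> {fst l<..<snd l} = {}"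
      using I k(1) l(1) kl(5) unfolding interval_family_def pairwise_def by blast
    moreover have "{fst i<..<snd i} \<subseteq> {fst k<..<snd k}" "{fst j<..<snd j} \<subseteq> {fst l<..<snd l}"
      using k l kl by auto
    ultimately show "{fst i<..<snd i} \<inter> {fst j<..<snd j} = {}" by blast
  qed
qed

text \<open>Every interval of the family is cut at \<open>v\<close>. The left and right parts form
  families in the two halves, and the triangle inequality bounds the increment over an interval that
  contains \<open>v\<close> in its interior.\<close>

lemma ac_wrt_join:
  assumes p: "continuous_seminorm p" and uvw: "u \<le> v" "v \<le> w"
    and 1: "ac_wrt p {u..v} f" and 2: "ac_wrt p {v..w} f"
  shows "ac_wrt p {u..w} f"
  unfolding ac_wrt_def
proof (intro allI impI)
  fix \<epsilon> :: real assume "\<epsilon> > 0"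
  then have e2: "\<epsilon> / 2 > 0" by simp
  obtain \<delta>1 where \<delta>1: "\<delta>1 > 0" "\<And>I. interval_family {u..v} I \<Longrightarrow> (\<Sum>(x, y)\<in>I. y - x) < \<delta>1 \<Longrightarrow>
      (\<Sum>(x, y)\<in>I. p (f y - f x)) < \<epsilon> / 2" using 1 e2 unfolding ac_wrt_def by blast
  obtain \<delta>2 where \<delta>2: "\<delta>2 > 0" "\<And>I. interval_family {v..w} I \<Longrightarrow> (\<Sum>(x, y)\<in>I. y - x) < \<delta>2 \<Longrightarrow>
      (\<Sum>(x, y)\<in>I. p (f y - f x)) < \<epsilon> / 2" using 2 e2 unfolding ac_wrt_def by blast
  have "(\<Sum>(x, y)\<in>I. p (f y - f x)) < \<epsilon>"
    if I: "interval_family {u..w} I" and len: "(\<Sum>(x, y)\<in>I. y - x) < min \<delta>1 \<delta>2" for I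
  proof -
    have fin: "finite I" and Ixy: "\<And>x y. (x, y) \<in> I \<Longrightarrow> x \<le> y \<and> u \<le> x \<and> y \<le> w"
      using I unfolding interval_family_def by fastforce+
    define e1 where "e1 i = (fst i, min (snd i) v)" for i :: "real \<times> real"
    define e2 where "e2 i = (max (fst i) v, snd i)" for i :: "real \<times> real"
    \<comment> \<open>Degenerate intervals and those without a proper part on the given side are
      left out; a truncated interval is then determined by its untouched endpoint.\<close>
    define I1 where "I1 = {i \<in> I. fst i < snd i \<and> fst i < v}"
    define I2 where "I2 = {i \<in> I. fst i < snd i \<and> v < snd i}"
    have sub: "I1 \<subseteq> I" "I2 \<subseteq> I" by (auto simp: I1_def I2_def)
    have inj1: "inj_on e1 I1"
    proof (rule inj_onI)
      fix i j assume ij: "i \<in> I1" "j \<in> I1" "e1 i = e1 j"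
      then have "(fst i, snd i) \<in> I" "(fst j, snd j) \<in> I" "fst i < snd i" "fst j < snd j"
        by (auto simp: I1_def)
      then have "(fst i, snd i) = (fst j, snd j)"
        by (rule interval_family_eqI[OF I]) (use ij(3) in \<open>simp add: e1_def\<close>)
      then show "i = j" by simp
    qed
    have inj2: "inj_on e2 I2"
    proof (rule inj_onI)
      fix i j assume ij: "i \<in> I2" "j \<in> I2" "e2 i = e2 j"
      then have "(fst i, snd i) \<in> I" "(fst j, snd j) \<in> I" "fst i < snd i" "fst j < snd j"
        by (auto simp: I2_def)
      then have "(fst i, snd i) = (fst j, snd j)"
        by (rule interval_family_eqI[OF I]) (use ij(3) in \<open>simp add: e2_def\<close>)
      then show "i = j" by simp
    qed
    have F1: "interval_family {u..v} (e1 ` I1)"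
      by (rule interval_family_image[OF I]) (use Ixy in \<open>auto simp: I1_def e1_def\<close>)
    have F2: "interval_family {v..w} (e2 ` I2)"
      by (rule interval_family_image[OF I]) (use Ixy in \<open>auto simp: I2_def e2_def\<close>)
    have "(\<Sum>(x, y)\<in>e1 ` I1. y - x) = (\<Sum>i\<in>I1. min (snd i) v - fst i)"
      by (subst sum.reindex[OF inj1]) (simp add: case_prod_beta' e1_def)
    also have "\<dots> \<le> (\<Sum>i\<in>I1. snd i - fst i)" by (rule sum_mono) simp
    also have "\<dots> \<le> (\<Sum>i\<in>I. snd i - fst i)"
      by (rule sum_mono2[OF fin sub(1)]) (use Ixy in force)
    also have "\<dots> < \<delta>1" using len by (simp add: case_prod_beta')
    finally have L1: "(\<Sum>(x, y)\<in>e1 ` I1. y - x) < \<delta>1" .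
    have "(\<Sum>(x, y)\<in>e2 ` I2. y - x) = (\<Sum>i\<in>I2. snd i - max (fst i) v)"
      by (subst sum.reindex[OF inj2]) (simp add: case_prod_beta' e2_def)
    also have "\<dots> \<le> (\<Sum>i\<in>I2. snd i - fst i)" by (rule sum_mono) simp
    also have "\<dots> \<le> (\<Sum>i\<in>I. snd i - fst i)"
      by (rule sum_mono2[OF fin sub(2)]) (use Ixy in force)
    also have "\<dots> < \<delta>2" using len by (simp add: case_prod_beta')
    finally have L2: "(\<Sum>(x, y)\<in>e2 ` I2. y - x) < \<delta>2" .
    have "(\<Sum>(x, y)\<in>I. p (f y - f x)) = (\<Sum>i\<in>I. p (f (snd i) - f (fst i)))"
      by (simp add: case_prod_beta')
    also have "\<dots> \<le> (\<Sum>i\<in>I. (if fst i < snd i \<and> fst i < v then p (f (min (snd i) v) - f (fst i)) else 0) +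
        (if fst i < snd i \<and> v < snd i then p (f (snd i) - f (max (fst i) v)) else 0))"
    proof (rule sum_mono)
      fix i assume "i \<in> I"
      then have le: "fst i \<le> snd i" using Ixy[of "fst i" "snd i"] by simp
      note nn = seminorm_nonneg[OF p] and z = seminorm_zero[OF p]
      consider "fst i = snd i" | "fst i < snd i" "snd i \<le> v" | "fst i < snd i" "v \<le> fst i"
        | "fst i < v" "v < snd i" using le by linarith
      then show "p (f (snd i) - f (fst i)) \<le> (if fst i < snd i \<and> fst i < v then p (f (min (snd i) v) - f (fst i)) else 0) +
        (if fst i < snd i \<and> v < snd i then p (f (snd i) - f (max (fst i) v)) else 0)"
      proof cases
        case 4
        then show ?thesis
          using seminorm_triangle[OF p, of "f v - f (fst i)" "f (snd i) - f v"] by simp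
      qed (auto simp: z nn)
    qed
    also have "\<dots> = (\<Sum>i\<in>I1. p (f (min (snd i) v) - f (fst i))) + (\<Sum>i\<in>I2. p (f (snd i) - f (max (fst i) v)))"
      unfolding sum.distrib I1_def I2_def by (simp only: sum.inter_filter[OF fin])
    also have "\<dots> = (\<Sum>(x, y)\<in>e1 ` I1. p (f y - f x)) + (\<Sum>(x, y)\<in>e2 ` I2. p (f y - f x))"
      by (subst sum.reindex[OF inj1], subst sum.reindex[OF inj2]) (simp add: case_prod_beta' e1_def e2_def)
    also have "\<dots> < \<epsilon> / 2 + \<epsilon> / 2"
      by (rule add_strict_mono[OF \<delta>1(2)[OF F1 L1] \<delta>2(2)[OF F2 L2]])
    finally show ?thesis by simp
  qed
  then show "\<exists>\<delta>>0. \<forall>I. interval_family {u..w} I \<and> (\<Sum>(x, y)\<in>I. y - x) < \<delta> \<longrightarrow> (\<Sum>(x, y)\<in>I. p (f y - f x)) < \<epsilon>"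
    using \<delta>1(1) \<delta>2(1) by (intro exI[of _ "min \<delta>1 \<delta>2"]) auto
qed

lemma abs_continuous_on_join:
  "u \<le> v \<Longrightarrow> v \<le> w \<Longrightarrow> abs_continuous_on {u..v} f \<Longrightarrow> abs_continuous_on {v..w} f \<Longrightarrow> abs_continuous_on {u..w} f"
  unfolding abs_continuous_on_iff_ac_wrt using ac_wrt_join by blast

lemma abs_continuous_on_cong:
  assumes "abs_continuous_on J f" "\<And>x. x \<in> J \<Longrightarrow> f x = g x"
  shows "abs_continuous_on J g"
  unfolding abs_continuous_on_iff
proof (intro allI impI)
  fix p :: "'a \<Rightarrow> real" and \<epsilon> :: real assume "continuous_seminorm p" "\<epsilon> > 0"
  then obtain \<delta> where \<delta>: "\<delta> > 0" "\<And>I. interval_family J I \<Longrightarrow> (\<Sum>(x, y)\<in>I. y - x) < \<delta> \<Longrightarrow>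
      (\<Sum>(x, y)\<in>I. p (f y - f x)) < \<epsilon>"
    using abs_continuous_onD[OF assms(1)] by blast
  have "(\<Sum>(x, y)\<in>I. p (g y - g x)) = (\<Sum>(x, y)\<in>I. p (f y - f x))" if I: "interval_family J I" for I
  proof (rule sum.cong)
    fix i assume "i \<in> I"
    then have "fst i \<in> J" "snd i \<in> J" using I unfolding interval_family_def by fastforce+
    then show "(case i of (x, y) \<Rightarrow> p (g y - g x)) = (case i of (x, y) \<Rightarrow> p (f y - f x))"
      by (simp add: case_prod_beta' assms(2))
  qed simp
  with \<delta> show "\<exists>\<delta>>0. \<forall>I. interval_family J I \<and> (\<Sum>(x, y)\<in>I. y - x) < \<delta> \<longrightarrow> (\<Sum>(x, y)\<in>I. p (g y - g x)) < \<epsilon>"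
    by (intro exI[of _ \<delta>]) simp
qed

lemma sdiff_locally_lipschitz:
  fixes G :: "'e::hausdorff_lcs \<Rightarrow> 'f::hausdorff_lcs"
  assumes G: "sdiff G y0 D" and \<nu>: "continuous_on UNIV \<nu>" "\<And>h x. h \<ge> 0 \<Longrightarrow> \<nu> (h *\<^sub>R x) = h * \<nu> x"
  obtains q U where "continuous_seminorm q" "open U" "y0 \<in> U"
    "\<And>y y'. y \<in> U \<Longrightarrow> y' \<in> U \<Longrightarrow> \<nu> (G y' - G y) \<le> q (y' - y)"
proof -
  let ?F = "nhds y0 \<times>\<^sub>F nhds 0 \<times>\<^sub>F at (0::real)"
  have "((\<lambda>(y, w, h). (G (y + h *\<^sub>R w) - G y) /\<^sub>R h) \<longlongrightarrow> 0) ?F"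
    using G[unfolded sdiff_def, rule_format, of 0] unfolding sdiff_zero[OF G] .
  moreover have "isCont \<nu> 0" using \<nu>(1) by (simp add: continuous_on_eq_continuous_at)
  moreover have \<nu>0: "\<nu> 0 = 0" using \<nu>(2)[of 0 0] by simp
  ultimately have "((\<lambda>p. \<nu> (case p of (y, w, h) \<Rightarrow> (G (y + h *\<^sub>R w) - G y) /\<^sub>R h)) \<longlongrightarrow> 0) ?F"
    using isCont_tendsto_compose[of 0 \<nu>] by fastforce
  then have "eventually (\<lambda>p. \<nu> (case p of (y, w, h) \<Rightarrow> (G (y + h *\<^sub>R w) - G y) /\<^sub>R h) < 1) ?F"
    by (rule order_tendstoD(2)) simp
  then obtain P Q where P: "eventually P (nhds y0)" and Q: "eventually Q (nhds 0 \<times>\<^sub>F at (0::real))"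
    and PQ: "\<And>y x. P y \<Longrightarrow> Q x \<Longrightarrow> \<nu> (case (y, x) of (y, w, h) \<Rightarrow> (G (y + h *\<^sub>R w) - G y) /\<^sub>R h) < 1"
    unfolding eventually_prod_filter by blast
  from Q obtain Q1 Q2 where Q1: "eventually Q1 (nhds 0)" and Q2: "eventually Q2 (at (0::real))"
    and Q12: "\<And>w h. Q1 w \<Longrightarrow> Q2 h \<Longrightarrow> Q (w, h)"
    unfolding eventually_prod_filter by blast
  obtain U1 where U1: "open U1" "y0 \<in> U1" "\<And>y. y \<in> U1 \<Longrightarrow> P y"
    using P unfolding eventually_nhds by blast
  obtain V where V: "open V" "0 \<in> V" "\<And>w. w \<in> V \<Longrightarrow> Q1 w"
    using Q1 unfolding eventually_nhds by blast
  obtain \<delta> where \<delta>: "\<delta> > 0" "\<And>h. h \<noteq> 0 \<Longrightarrow> dist h 0 < \<delta> \<Longrightarrow> Q2 h"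
    using Q2 unfolding eventually_at by blast
  obtain q where q: "continuous_seminorm q" "\<And>x. q x < 1 \<Longrightarrow> x \<in> V"
    using ex_continuous_seminorm[OF V(1,2)] by blast
  note qt = seminorm_triangle[OF q(1)] and qs = seminorm_scale[OF q(1)] and qn = seminorm_nonneg[OF q(1)]
  \<comment> \<open>Two points of \<open>U\<close> then differ by less than \<delta> in
    \<open>q\<close>, which leaves room for an increment \<open>h\<close> between
    \<open>q (y' - y)\<close> and \<delta>.\<close>
  define U where "U = U1 \<inter> {y. q (y - y0) < \<delta> / 2}"
  have "continuous_on UNIV (\<lambda>y. q (y - y0))"
    by (rule continuous_on_compose2[OF seminorm_continuous[OF q(1)]])
      (auto simp: continuous_on_def intro!: tendsto_intros)
  then have oU: "open U" unfolding U_def using U1(1) by (intro open_Int open_Collect_less continuous_on_const)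
  have yU: "y0 \<in> U" using U1(2) \<delta>(1) by (simp add: U_def seminorm_zero[OF q(1)])
  have lip: "\<nu> (G y' - G y) \<le> q (y' - y)" if y: "y \<in> U" "y' \<in> U" for y y'
  proof -
    have "q (y' - y) \<le> q (y' - y0) + q (y0 - y)" using qt[of "y' - y0" "y0 - y"] by simp
    also have "q (y0 - y) = q (y - y0)" by (rule seminorm_minus[OF q(1)])
    also have "q (y' - y0) + q (y - y0) < \<delta>" using y by (simp add: U_def)
    finally have lt: "q (y' - y) < \<delta>" .
    show ?thesis
    proof (rule dense_ge_bounded[OF lt])
      fix h assume h: "q (y' - y) < h" "h < \<delta>"
      have h0: "h > 0" using h qn[of "y' - y"] by linarith
      have "q ((y' - y) /\<^sub>R h) = q (y' - y) / h" using qs[of "inverse h" "y' - y"] h0 by (simp add: divide_inverse mult.commute)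
      then have "q ((y' - y) /\<^sub>R h) < 1" using h h0 by simp
      then have "Q ((y' - y) /\<^sub>R h, h)" using h h0 by (intro Q12 V(3) q(2) \<delta>(2)) auto
      from PQ[OF U1(3) this, of y] y have "\<nu> ((G y' - G y) /\<^sub>R h) < 1"
        using h0 by (simp add: U_def)
      then have "\<nu> (h *\<^sub>R ((G y' - G y) /\<^sub>R h)) \<le> h"
        using h0 by (subst \<nu>(2)) auto
      then show "\<nu> (G y' - G y) \<le> h" using h0 by simp
    qed
  qed
  show ?thesis by (rule that[OF q(1) oU yU lip])
qed

text \<open>The seminorm that dominates the increments of \<open>G\<close> depends on the place, so
  absolute continuity is proved near each parameter and joined by bisection.\<close>

lemma abs_continuous_on_sdiff_compose:
  fixes G :: "'e::hausdorff_lcs \<Rightarrow> 'f::hausdorff_lcs"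
  assumes ac: "abs_continuous_on {s..t} c" and cont: "continuous_on {s..t} c"
    and G: "\<And>r. r \<in> {s..t} \<Longrightarrow> \<exists>D. sdiff G (c r) D"
  shows "abs_continuous_on {s..t} (\<lambda>r. G (c r))"
proof (cases "s \<le> t")
  case False
  then have "I = {}" if "interval_family {s..t} I" for I
    using that unfolding interval_family_def by fastforce
  then show ?thesis
    unfolding abs_continuous_on_iff by (metis sum.empty zero_less_one)
next
  case st: True
  show ?thesis
    unfolding abs_continuous_on_iff_ac_wrt
  proof (intro allI impI)
    fix p :: "'f \<Rightarrow> real" assume p: "continuous_seminorm p"
    define P where "P u v \<longleftrightarrow> (s \<le> u \<and> v \<le> t \<longrightarrow> ac_wrt p {u..v} (\<lambda>r. G (c r)))" for u v
    have "P s t"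
      using st
    proof (induction rule: Bolzano)
      case (trans u v w)
      then show ?case using ac_wrt_join[OF p, of u v w] by (auto simp: P_def)
    next
      case (local r)
      then have r: "r \<in> {s..t}" by simp
      obtain D where D: "sdiff G (c r) D" using G[OF r] by blast
      obtain q U where q: "continuous_seminorm q" and U: "open U" "c r \<in> U"
        and lip: "\<And>y y'. y \<in> U \<Longrightarrow> y' \<in> U \<Longrightarrow> p (G y' - G y) \<le> q (y' - y)"
        using sdiff_locally_lipschitz[OF D seminorm_continuous[OF p]] seminorm_scale[OF p] by auto
      have "eventually (\<lambda>x. c x \<in> U) (at r within {s..t})"
        using cont r U by (intro topological_tendstoD[of c "c r"]) (auto simp: continuous_on_def)
      then obtain d where d: "d > 0" "\<And>x. x \<in> {s..t} \<Longrightarrow> x \<noteq> r \<Longrightarrow> dist x r < d \<Longrightarrow> c x \<in> U"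
        unfolding eventually_at by blast
      have cU: "c x \<in> U" if "x \<in> {s..t}" "\<bar>x - r\<bar> < d" for x
        using d(2)[of x] that U(2) by (cases "x = r") (auto simp: dist_real_def)
      have "ac_wrt p {u..v} (\<lambda>r. G (c r))" if uv: "u \<le> r" "r \<le> v" "v - u < d" "s \<le> u" "v \<le> t" for u v
        unfolding ac_wrt_def
      proof (intro allI impI)
        fix \<epsilon> :: real assume "\<epsilon> > 0"
        then obtain \<delta> where \<delta>: "\<delta> > 0" "\<And>I. interval_family {u..v} I \<Longrightarrow> (\<Sum>(x, y)\<in>I. y - x) < \<delta> \<Longrightarrow>
            (\<Sum>(x, y)\<in>I. q (c y - c x)) < \<epsilon>"
          using abs_continuous_onD[OF abs_continuous_on_subset[OF ac] q, of "{u..v}"] uv by auto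
        have "(\<Sum>(x, y)\<in>I. p (G (c y) - G (c x))) \<le> (\<Sum>(x, y)\<in>I. q (c y - c x))" if I: "interval_family {u..v} I" for I
        proof (rule sum_mono)
          fix i assume "i \<in> I"
          then have "fst i \<in> {u..v}" "snd i \<in> {u..v}" using I unfolding interval_family_def by fastforce+
          then have "c (fst i) \<in> U" "c (snd i) \<in> U" using uv by (intro cU; auto)+
          then show "(case i of (x, y) \<Rightarrow> p (G (c y) - G (c x))) \<le> (case i of (x, y) \<Rightarrow> q (c y - c x))"
            using lip by (simp add: case_prod_beta')
        qed
        then have "(\<Sum>(x, y)\<in>I. p (G (c y) - G (c x))) < \<epsilon>"
          if "interval_family {u..v} I" "(\<Sum>(x, y)\<in>I. y - x) < \<delta>" for I
          by (rule le_less_trans[OF _ \<delta>(2)[OF that]]) (rule that(1))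
        with \<delta>(1) show "\<exists>\<delta>>0. \<forall>I. interval_family {u..v} I \<and> (\<Sum>(x, y)\<in>I. y - x) < \<delta> \<longrightarrow>
            (\<Sum>(x, y)\<in>I. p (G (c y) - G (c x))) < \<epsilon>" by blast
      qed
      then show ?case by (intro exI[of _ d] conjI d(1)) (simp add: P_def)
    qed
    then show "ac_wrt p {s..t} (\<lambda>r. G (c r))" by (simp add: P_def)
  qed
qed

lemma abs_continuous_on_ident: "abs_continuous_on J (\<lambda>t::real. t)"
  unfolding abs_continuous_on_iff
proof (intro allI impI)
  fix p :: "real \<Rightarrow> real" and \<epsilon> :: real assume p: "continuous_seminorm p" and \<epsilon>: "\<epsilon> > 0"
  have p1: "p x = \<bar>x\<bar> * p 1" for x using seminorm_scale[OF p, of x 1] by simp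
  have n: "0 \<le> p 1" by (rule seminorm_nonneg[OF p])
  show "\<exists>\<delta>>0. \<forall>I. interval_family J I \<and> (\<Sum>(x, y)\<in>I. y - x) < \<delta> \<longrightarrow> (\<Sum>(x, y)\<in>I. p (y - x)) < \<epsilon>"
  \<comment> \<open>A seminorm on the real line is \<open>p 1\<close> times the absolute value; the
    added 1 covers the case that \<open>p 1\<close> is 0.\<close>
  proof (intro exI[of _ "\<epsilon> / (p 1 + 1)"] conjI allI impI)
    show "0 < \<epsilon> / (p 1 + 1)" using \<epsilon> n by (intro divide_pos_pos) linarith+
    fix I assume I: "interval_family J I \<and> (\<Sum>(x, y)\<in>I. y - x) < \<epsilon> / (p 1 + 1)"
    have "(\<Sum>(x, y)\<in>I. p (y - x)) = (\<Sum>(x, y)\<in>I. (y - x) * p 1)"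
    proof (rule sum.cong)
      fix i assume "i \<in> I"
      then have "fst i \<le> snd i" using I unfolding interval_family_def by fastforce
      then show "(case i of (x, y) \<Rightarrow> p (y - x)) = (case i of (x, y) \<Rightarrow> (y - x) * p 1)"
        using p1[of "snd i - fst i"] by (simp add: case_prod_beta')
    qed simp
    also have "\<dots> = (\<Sum>(x, y)\<in>I. y - x) * p 1" by (simp add: sum_distrib_right case_prod_beta')
    also have "\<dots> \<le> (\<epsilon> / (p 1 + 1)) * p 1" using I n by (intro mult_right_mono) auto
    also have "\<dots> < \<epsilon>" using \<epsilon> n by (simp add: field_simps)
    finally show "(\<Sum>(x, y)\<in>I. p (y - x)) < \<epsilon>" .
  qed
qed

section \<open>Lengths of arcs\<close>

text \<open>Holds even where the arcs are not differentiable, because the difference quotients agree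
  eventually and so have the same \<open>Lim\<close>, whatever value that is.\<close>

lemma speed_cong:
  fixes \<gamma> :: "real \<Rightarrow> 'k::t2_space" and G :: "'k monoid" and A :: "('k, 'e::hausdorff_lcs) chart set"
  assumes "eventually (\<lambda>s. \<gamma> s = \<gamma>' s) (nhds t)"
  shows "speed G A c0 \<mu> \<gamma> t = speed G A c0 \<mu> \<gamma>' t"
proof -
  have eq: "\<gamma> t = \<gamma>' t" using assms by (rule eventually_nhds_x_imp_x)
  have "((\<lambda>h. t + h) \<longlongrightarrow> t + 0) (at 0)" by (intro tendsto_intros)
  then have "filterlim (\<lambda>h. t + h) (nhds t) (at 0)" by simp
  from eventually_compose_filterlim[OF assms this]
  have ev: "eventually (\<lambda>h. ((snd c \<circ> \<gamma>) (t + h *\<^sub>R 1) - (snd c \<circ> \<gamma>) t) /\<^sub>R h =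
      ((snd c \<circ> \<gamma>') (t + h *\<^sub>R 1) - (snd c \<circ> \<gamma>') t) /\<^sub>R h) (at 0)" for c :: "('k, 'e) chart"
    by eventually_elim (simp add: eq)
  have "dir_deriv (snd c \<circ> \<gamma>) t 1 = dir_deriv (snd c \<circ> \<gamma>') t 1" for c :: "('k, 'e) chart"
    unfolding dir_deriv_def t2_space_class.Lim_def using tendsto_cong[OF ev[of c]] by (simp only:)
  then show ?thesis by (simp add: speed_def eq)
qed

context lie_finsler
begin

section \<open>The speed as the norm of the left logarithmic derivative\<close>

abbreviation spd :: "(real \<Rightarrow> 'k) \<Rightarrow> real \<Rightarrow> real" where "spd \<equiv> speed K A c0 \<mu>"
abbreviation len :: "real \<Rightarrow> real \<Rightarrow> (real \<Rightarrow> 'k) \<Rightarrow> real" where "len \<equiv> arc_length K A c0 \<mu>"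
abbreviation rect :: "real \<Rightarrow> real \<Rightarrow> (real \<Rightarrow> 'k) \<Rightarrow> bool" where "rect \<equiv> rectifiable K A c0 \<mu>"

text \<open>Moving \<open>\<gamma> t\<close> to the identity by left translation makes the velocity
  an element of the Lie algebra, read in the one chart \<open>c0\<close>, without any choice of a
  chart at \<open>\<gamma> t\<close>.\<close>

definition vel :: "(real \<Rightarrow> 'k) \<Rightarrow> real \<Rightarrow> 'e \<Rightarrow> bool"
  where "vel \<gamma> t u \<longleftrightarrow> cdiff c0 (\<lambda>s. iv (\<gamma> t) \<cdot> \<gamma> s) t u"

text \<open>The derivative may be given in any chart, while \<open>speed\<close> reads it in the
  chart picked by \<open>chart_at\<close>. After the change of chart both are images under the
  derivative of the same left translation.\<close>

lemma vel_speed: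
  assumes "cdiff d \<gamma> t w" "d \<in> A"
  obtains u where "vel \<gamma> t u" "spd \<gamma> t = \<mu> u"
proof -
  define c where "c = chart_at A (\<gamma> t)"
  have "\<exists>c. c \<in> A \<and> \<gamma> t \<in> fst c" using chart_ex by blast
  then have c: "c \<in> A" "\<gamma> t \<in> fst c" unfolding c_def chart_at_def by (metis (mono_tags, lifting) someI_ex)+
  obtain w' where w': "cdiff c \<gamma> t w'" by (rule cdiff_change_chart[OF assms c])
  have "mdf c (\<lambda>x. iv (\<gamma> t) \<cdot> x) (\<gamma> t)"
    by (intro mdf_mul mdf_const mdf_id) (use c in auto)
  then obtain D where D: "mdiff c c0 (\<lambda>x. iv (\<gamma> t) \<cdot> x) (\<gamma> t) D"
    by (rule mdfD[OF _ chartA[OF c(1)] c0]) (use one_c0 in simp)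
  have "vel \<gamma> t (D w')" unfolding vel_def by (rule cdiff_mdiff[OF w' D chartA[OF c(1)]])
  moreover have "spd \<gamma> t = \<mu> (D w')"
  proof -
    have "dir_deriv (snd c \<circ> \<gamma>) t 1 = w'" using w' by (intro dir_deriv_eqI) (simp add: cdiff_def)
    then show ?thesis
      using mdiff_imp_dir_deriv[OF D] by (simp add: speed_def c_def[symmetric] tangent_norm_def)
  qed
  ultimately show ?thesis by (rule that)
qed

lemma vel_cdiff:
  assumes "vel \<gamma> t u" "c \<in> A" "\<gamma> t \<in> fst c"
  obtains w where "cdiff c \<gamma> t w"
proof -
  have "mdf c0 (\<lambda>x. \<gamma> t \<cdot> x) one"
    by (intro mdf_mul mdf_const mdf_id) (auto simp: c0 one_c0)
  then obtain D where D: "mdiff c0 c (\<lambda>x. \<gamma> t \<cdot> x) one D"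
    by (rule mdfD[OF _ chart_c0 assms(2)]) (use assms in simp)
  then have "mdiff c0 c (\<lambda>x. \<gamma> t \<cdot> x) (iv (\<gamma> t) \<cdot> \<gamma> t) D" by simp
  from cdiff_mdiff[OF assms(1)[unfolded vel_def] this chart_c0]
  have "cdiff c \<gamma> t (D u)" by simp
  then show ?thesis by (rule that)
qed

lemma speed_eq:
  assumes "vel \<gamma> t u"
  shows "spd \<gamma> t = \<mu> u"
proof -
  obtain c where c: "c \<in> A" "\<gamma> t \<in> fst c" by (rule chart_ex)
  obtain w where "cdiff c \<gamma> t w" by (rule vel_cdiff[OF assms c])
  then obtain u' where u': "vel \<gamma> t u'" "spd \<gamma> t = \<mu> u'" by (rule vel_speed[OF _ c(1)])
  moreover have "u' = u" using u'(1) assms unfolding vel_def by (rule cdiff_unique)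
  ultimately show ?thesis by simp
qed

lemma speed_nonneg: "0 \<le> spd \<gamma> t"
  by (simp add: speed_def Let_def tangent_norm_def)

lemma rect_continuous: "rect a b \<gamma> \<Longrightarrow> continuous_on {a..b} \<gamma>"
  and rect_ac: "rect a b \<gamma> \<Longrightarrow> chart_abs_continuous A a b \<gamma>"
  and rect_integrable: "rect a b \<gamma> \<Longrightarrow> set_integrable lebesgue {a..b} (spd \<gamma>)"
  by (simp_all add: rectifiable_def)

text \<open>The endpoints are excluded because \<gamma> is only known to be continuous on the closed
  interval, whereas \<open>vel\<close> is two-sided.\<close>

lemma rect_vel:
  assumes r: "rect a b \<gamma>"
  obtains N where "negligible N" "\<And>t. a < t \<Longrightarrow> t < b \<Longrightarrow> t \<notin> N \<Longrightarrow> \<exists>u. vel \<gamma> t u \<and> spd \<gamma> t = \<mu> u"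
proof -
  have "AE t in lebesgue. t \<in> {a..b} \<longrightarrow>
      (\<exists>c\<in>A. \<gamma> t \<in> fst c \<and> (\<exists>w. has_dir_deriv (snd c \<circ> \<gamma>) t 1 w))"
    using r by (simp add: rectifiable_def)
  then obtain N where N: "N \<in> null_sets lebesgue" "{t \<in> space lebesgue. \<not> (t \<in> {a..b} \<longrightarrow>
      (\<exists>c\<in>A. \<gamma> t \<in> fst c \<and> (\<exists>w. has_dir_deriv (snd c \<circ> \<gamma>) t 1 w)))} \<subseteq> N"
    unfolding eventually_ae_filter by blast
  show ?thesis
  proof
    show "negligible N" using N(1) by (simp add: negligible_iff_null_sets)
    fix t assume t: "a < t" "t < b" "t \<notin> N"
    then have "t \<in> {a..b}" by simp
    moreover have "t \<in> space lebesgue" by simp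
    ultimately obtain c w where c: "c \<in> A" "\<gamma> t \<in> fst c" "has_dir_deriv (snd c \<circ> \<gamma>) t 1 w"
      using N(2) t(3) by blast
    have "isCont \<gamma> t"
      using continuous_on_interior[OF rect_continuous[OF r], of t] t by simp
    with c have "cdiff c \<gamma> t w" by (simp add: cdiff_def)
    then obtain u where "vel \<gamma> t u" "spd \<gamma> t = \<mu> u" by (rule vel_speed[OF _ c(1)])
    then show "\<exists>u. vel \<gamma> t u \<and> spd \<gamma> t = \<mu> u" by blast
  qed
qed

section \<open>Restricting, altering and joining rectifiable arcs\<close>

lemma rect_sub:
  assumes r: "rect a b \<gamma>" and st: "a \<le> s" "t \<le> b"
  shows "rect s t \<gamma>"
  unfolding rectifiable_def
proof (intro conjI)
  have sub: "{s..t} \<subseteq> {a..b}" using st by auto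
  show "continuous_on {s..t} \<gamma>" by (rule continuous_on_subset[OF rect_continuous[OF r] sub])
  show "set_integrable lebesgue {s..t} (spd \<gamma>)"
    by (rule set_integrable_subset[OF rect_integrable[OF r] _ sub]) simp
  have "AE t in lebesgue. t \<in> {a..b} \<longrightarrow>
      (\<exists>c\<in>A. \<gamma> t \<in> fst c \<and> (\<exists>w. has_dir_deriv (snd c \<circ> \<gamma>) t 1 w))"
    using r by (simp add: rectifiable_def)
  then show "AE x in lebesgue. x \<in> {s..t} \<longrightarrow>
      (\<exists>c\<in>A. \<gamma> x \<in> fst c \<and> (\<exists>w. has_dir_deriv (snd c \<circ> \<gamma>) x 1 w))"
    by eventually_elim (use st in auto)
  show "chart_abs_continuous A s t \<gamma>"
    unfolding chart_abs_continuous_def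
  proof
    fix x assume "x \<in> {s..t}"
    then obtain \<epsilon> c where c: "\<epsilon> > 0" "c \<in> A" "\<gamma> ` ({a..b} \<inter> {x - \<epsilon>..x + \<epsilon>}) \<subseteq> fst c"
        "abs_continuous_on ({a..b} \<inter> {x - \<epsilon>..x + \<epsilon>}) (snd c \<circ> \<gamma>)"
      using rect_ac[OF r] sub unfolding chart_abs_continuous_def by blast
    have "abs_continuous_on ({s..t} \<inter> {x - \<epsilon>..x + \<epsilon>}) (snd c \<circ> \<gamma>)"
      by (rule abs_continuous_on_subset[OF c(4)]) (use sub in auto)
    moreover have "\<gamma> ` ({s..t} \<inter> {x - \<epsilon>..x + \<epsilon>}) \<subseteq> fst c" using c(3) sub by blast
    ultimately show "\<exists>\<epsilon>>0. \<exists>c\<in>A. \<gamma> ` ({s..t} \<inter> {x - \<epsilon>..x + \<epsilon>}) \<subseteq> fst c \<and>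
        abs_continuous_on ({s..t} \<inter> {x - \<epsilon>..x + \<epsilon>}) (snd c \<circ> \<gamma>)"
      using c(1,2) by blast
  qed
qed

lemma len_eq_integral: "rect a b \<gamma> \<Longrightarrow> len a b \<gamma> = integral {a..b} (spd \<gamma>)"
  unfolding arc_length_def by (rule set_lebesgue_integral_eq_integral(2)[OF rect_integrable])

lemma speed_integrable_on: "rect a b \<gamma> \<Longrightarrow> spd \<gamma> integrable_on {a..b}"
  by (rule set_lebesgue_integral_eq_integral(1)[OF rect_integrable])

lemma len_add:
  assumes "rect u w \<gamma>" "u \<le> v" "v \<le> w"
  shows "len u w \<gamma> = len u v \<gamma> + len v w \<gamma>"
  using Henstock_Kurzweil_Integration.integral_combine[OF assms(2,3) speed_integrable_on[OF assms(1)]]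
    len_eq_integral[OF assms(1)] len_eq_integral[OF rect_sub[OF assms(1) order_refl assms(3)]]
    len_eq_integral[OF rect_sub[OF assms(1,2) order_refl]] by simp

lemma len_nonneg: "rect a b \<gamma> \<Longrightarrow> 0 \<le> len a b \<gamma>"
  unfolding len_eq_integral by (rule Henstock_Kurzweil_Integration.integral_nonneg[OF speed_integrable_on speed_nonneg])

lemma len_continuous:
  assumes "rect a b \<gamma>"
  shows "continuous_on {a..b} (\<lambda>t. len a t \<gamma>)"
proof -
  have "continuous_on {a..b} (\<lambda>t. integral {a..t} (spd \<gamma>))"
    by (rule indefinite_integral_continuous_1[OF speed_integrable_on[OF assms]])
  then show ?thesis
    by (rule continuous_on_eq) (use len_eq_integral[OF rect_sub[OF assms order_refl]] in auto)
qed

lemma len_same: "rect a b \<gamma> \<Longrightarrow> t \<in> {a..b} \<Longrightarrow> len t t \<gamma> = 0"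
  using len_add[of t t \<gamma> t] rect_sub[of a b \<gamma> t t] by simp

text \<open>Changes of chart are strictly differentiable and so preserve absolute continuity. This
  is needed where two arcs meet, as each may come with its own chart there.\<close>

lemma chart_ac_change:
  assumes ac: "chart_abs_continuous A a b \<gamma>" and cont: "continuous_on {a..b} \<gamma>"
    and t: "t \<in> {a..b}" and c: "c \<in> A" "\<gamma> t \<in> fst c"
  obtains \<epsilon> where "\<epsilon> > 0" "\<gamma> ` ({a..b} \<inter> {t - \<epsilon>..t + \<epsilon>}) \<subseteq> fst c"
    "abs_continuous_on ({a..b} \<inter> {t - \<epsilon>..t + \<epsilon>}) (snd c \<circ> \<gamma>)"
proof -
  obtain \<epsilon>1 d where d: "\<epsilon>1 > 0" "d \<in> A" "\<gamma> ` ({a..b} \<inter> {t - \<epsilon>1..t + \<epsilon>1}) \<subseteq> fst d"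
      "abs_continuous_on ({a..b} \<inter> {t - \<epsilon>1..t + \<epsilon>1}) (snd d \<circ> \<gamma>)"
    using ac t unfolding chart_abs_continuous_def by blast
  have "(\<gamma> \<longlongrightarrow> \<gamma> t) (at t within {a..b})" using cont t by (simp add: continuous_on_def)
  then have "eventually (\<lambda>x. \<gamma> x \<in> fst c) (at t within {a..b})"
    by (rule topological_tendstoD) (use c in \<open>auto intro: chart_open\<close>)
  then obtain \<epsilon>2 where e2: "\<epsilon>2 > 0" "\<And>x. x \<in> {a..b} \<Longrightarrow> x \<noteq> t \<Longrightarrow> dist x t < \<epsilon>2 \<Longrightarrow> \<gamma> x \<in> fst c"
    unfolding eventually_at by blast
  define \<epsilon> where "\<epsilon> = min \<epsilon>1 (\<epsilon>2 / 2)"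
  define J where "J = {a..b} \<inter> {t - \<epsilon>..t + \<epsilon>}"
  have J: "J = {max a (t - \<epsilon>)..min b (t + \<epsilon>)}" by (auto simp: J_def)
  have Jc: "\<gamma> x \<in> fst c" if "x \<in> J" for x
  proof (cases "x = t")
    case False
    have "\<bar>x - t\<bar> < \<epsilon>2" using that e2(1) by (auto simp: J_def \<epsilon>_def)
    then show ?thesis using e2(2)[of x] False that by (auto simp: J_def dist_real_def)
  qed (use c in simp)
  have J1: "J \<subseteq> {a..b} \<inter> {t - \<epsilon>1..t + \<epsilon>1}" by (auto simp: J_def \<epsilon>_def)
  have Jd: "\<gamma> x \<in> fst d" if "x \<in> J" for x using d(3) J1 that by blast
  have "abs_continuous_on J (\<lambda>r. (snd c \<circ> (\<lambda>y. y) \<circ> chart_inv d) ((snd d \<circ> \<gamma>) r))"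
    unfolding J
  proof (rule abs_continuous_on_sdiff_compose[where G="snd c \<circ> (\<lambda>y. y) \<circ> chart_inv d" and c="snd d \<circ> \<gamma>"], unfold J[symmetric])
    show "abs_continuous_on J (snd d \<circ> \<gamma>)" by (rule abs_continuous_on_subset[OF d(4) J1])
    have "continuous_on J \<gamma>" by (rule continuous_on_subset[OF cont]) (auto simp: J_def)
    then show "continuous_on J (snd d \<circ> \<gamma>)"
      by (rule continuous_on_compose) (rule continuous_on_subset[OF continuous_on_chart[OF chartA[OF d(2)]]], use Jd in auto)
    fix r assume r: "r \<in> J"
    obtain D where "mdiff d c (\<lambda>y. y) (\<gamma> r) D"
      by (rule mdfD[OF mdf_id[OF d(2) Jd[OF r]] chartA[OF d(2)] c(1) Jc[OF r]])
    then have "sdiff (snd c \<circ> (\<lambda>y. y) \<circ> chart_inv d) ((snd d \<circ> \<gamma>) r) D" by (simp add: mdiff_def)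
    then show "\<exists>D. sdiff (snd c \<circ> (\<lambda>y. y) \<circ> chart_inv d) ((snd d \<circ> \<gamma>) r) D" by blast
  qed
  then have "abs_continuous_on J (snd c \<circ> \<gamma>)"
    by (rule abs_continuous_on_cong) (use Jd d in auto)
  moreover have "\<epsilon> > 0" using d e2 by (simp add: \<epsilon>_def)
  moreover have "\<gamma> ` J \<subseteq> fst c" using Jc by auto
  ultimately show ?thesis using that[of \<epsilon>] by (simp add: J_def)
qed

text \<open>The arcs may differ outside the interval, which affects the two-sided derivatives at
  \<open>a\<close> and \<open>b\<close>; these two parameters form a negligible set.\<close>

lemma rect_cong:
  assumes r: "rect a b \<gamma>" and eq: "\<And>t. t \<in> {a..b} \<Longrightarrow> \<gamma> t = \<gamma>' t"
  shows "rect a b \<gamma>'" "len a b \<gamma>' = len a b \<gamma>"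
proof -
  have ev: "eventually (\<lambda>s. \<gamma> s = \<gamma>' s) (nhds t)" if "t \<in> {a..b} - {a, b}" for t
  proof -
    have "eventually (\<lambda>s. s \<in> {a<..<b}) (nhds t)"
      by (rule eventually_nhds_in_open) (use that in auto)
    then show ?thesis by eventually_elim (use eq in auto)
  qed
  have N: "negligible {a, b}" by simp
  have sp: "spd \<gamma>' t = spd \<gamma> t" if "t \<in> {a..b} - {a, b}" for t
    using speed_cong[OF ev[OF that], of K A c0 \<mu>] by simp
  have int: "set_integrable lebesgue {a..b} (spd \<gamma>')"
    by (rule absolutely_integrable_spike[OF rect_integrable[OF r] N sp])
  show "rect a b \<gamma>'"
    unfolding rectifiable_def
  proof (intro conjI int)
    show "continuous_on {a..b} \<gamma>'" by (rule continuous_on_eq[OF rect_continuous[OF r] eq])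
    show "chart_abs_continuous A a b \<gamma>'"
      unfolding chart_abs_continuous_def
    proof
      fix x assume "x \<in> {a..b}"
      then obtain \<epsilon> c where c: "\<epsilon> > 0" "c \<in> A" "\<gamma> ` ({a..b} \<inter> {x - \<epsilon>..x + \<epsilon>}) \<subseteq> fst c"
          "abs_continuous_on ({a..b} \<inter> {x - \<epsilon>..x + \<epsilon>}) (snd c \<circ> \<gamma>)"
        using rect_ac[OF r] unfolding chart_abs_continuous_def by blast
      have "abs_continuous_on ({a..b} \<inter> {x - \<epsilon>..x + \<epsilon>}) (snd c \<circ> \<gamma>')"
        by (rule abs_continuous_on_cong[OF c(4)]) (simp add: eq)
      moreover have "\<gamma>' ` ({a..b} \<inter> {x - \<epsilon>..x + \<epsilon>}) \<subseteq> fst c"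
        using c(3) eq by (auto simp: image_subset_iff)
      ultimately show "\<exists>\<epsilon>>0. \<exists>c\<in>A. \<gamma>' ` ({a..b} \<inter> {x - \<epsilon>..x + \<epsilon>}) \<subseteq> fst c \<and>
          abs_continuous_on ({a..b} \<inter> {x - \<epsilon>..x + \<epsilon>}) (snd c \<circ> \<gamma>')"
        using c(1,2) by blast
    qed
    obtain N where N: "negligible N" "\<And>t. a < t \<Longrightarrow> t < b \<Longrightarrow> t \<notin> N \<Longrightarrow> \<exists>u. vel \<gamma> t u \<and> spd \<gamma> t = \<mu> u"
      using rect_vel[OF r] by blast
    have "N \<union> {a, b} \<in> null_sets lebesgue"
      using N(1) by (simp add: negligible_Un flip: negligible_iff_null_sets)
    moreover have "\<exists>c\<in>A. \<gamma>' t \<in> fst c \<and> (\<exists>w. has_dir_deriv (snd c \<circ> \<gamma>') t 1 w)"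
      if t: "t \<notin> N \<union> {a, b}" "t \<in> {a..b}" for t
    proof -
      obtain u where u: "vel \<gamma> t u" using N(2)[of t] t by auto
      obtain c where c: "c \<in> A" "\<gamma> t \<in> fst c" by (rule chart_ex)
      obtain w where w: "cdiff c \<gamma> t w" by (rule vel_cdiff[OF u c])
      have "cdiff c \<gamma>' t w" by (rule cdiff_cong[OF w ev]) (use t in auto)
      then show ?thesis using c(1) unfolding cdiff_def by blast
    qed
    ultimately show "AE t in lebesgue. t \<in> {a..b} \<longrightarrow>
        (\<exists>c\<in>A. \<gamma>' t \<in> fst c \<and> (\<exists>w. has_dir_deriv (snd c \<circ> \<gamma>') t 1 w))"
      by (intro AE_I'[of "N \<union> {a, b}"]) auto
  qed
  note r' = this
  show "len a b \<gamma>' = len a b \<gamma>"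
    unfolding len_eq_integral[OF r] len_eq_integral[OF r']
    by (rule integral_spike[OF N sp[symmetric]])
qed

lemma rect_join:
  assumes r1: "rect a s \<gamma>" and r2: "rect s b \<gamma>" and s: "a \<le> s" "s \<le> b"
  shows "rect a b \<gamma>"
  unfolding rectifiable_def
proof (intro conjI)
  have U: "{a..b} = {a..s} \<union> {s..b}" using s by auto
  show "continuous_on {a..b} \<gamma>"
    unfolding U by (rule continuous_on_closed_Un) (use r1 r2 rect_continuous in auto)
  show "set_integrable lebesgue {a..b} (spd \<gamma>)"
    unfolding U by (rule set_integrable_Un) (use r1 r2 rect_integrable in auto)
  have "AE t in lebesgue. t \<in> {a..s} \<longrightarrow> (\<exists>c\<in>A. \<gamma> t \<in> fst c \<and> (\<exists>w. has_dir_deriv (snd c \<circ> \<gamma>) t 1 w))"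
    "AE t in lebesgue. t \<in> {s..b} \<longrightarrow> (\<exists>c\<in>A. \<gamma> t \<in> fst c \<and> (\<exists>w. has_dir_deriv (snd c \<circ> \<gamma>) t 1 w))"
    using r1 r2 by (simp_all add: rectifiable_def)
  then show "AE t in lebesgue. t \<in> {a..b} \<longrightarrow> (\<exists>c\<in>A. \<gamma> t \<in> fst c \<and> (\<exists>w. has_dir_deriv (snd c \<circ> \<gamma>) t 1 w))"
    unfolding U by eventually_elim blast
  show "chart_abs_continuous A a b \<gamma>"
    unfolding chart_abs_continuous_def
  proof
    fix x assume x: "x \<in> {a..b}"
    \<comment> \<open>A chart fixed in advance, in which both halves are then shown to be absolutely
      continuous near \<open>x\<close>.\<close>
    obtain c where c: "c \<in> A" "\<gamma> x \<in> fst c" by (rule chart_ex)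
    have 1: "\<exists>\<epsilon>>0. \<gamma> ` ({a..s} \<inter> {x - \<epsilon>..x + \<epsilon>}) \<subseteq> fst c \<and>
        abs_continuous_on ({a..s} \<inter> {x - \<epsilon>..x + \<epsilon>}) (snd c \<circ> \<gamma>)" if "x \<le> s"
      using chart_ac_change[OF rect_ac[OF r1] rect_continuous[OF r1] _ c] that x by fastforce
    have 2: "\<exists>\<epsilon>>0. \<gamma> ` ({s..b} \<inter> {x - \<epsilon>..x + \<epsilon>}) \<subseteq> fst c \<and>
        abs_continuous_on ({s..b} \<inter> {x - \<epsilon>..x + \<epsilon>}) (snd c \<circ> \<gamma>)" if "s \<le> x"
      using chart_ac_change[OF rect_ac[OF r2] rect_continuous[OF r2] _ c] that x by fastforce
    have sub: "\<gamma> ` ({a..b} \<inter> {x - \<epsilon>..x + \<epsilon>}) \<subseteq> fst c \<and>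
        abs_continuous_on ({a..b} \<inter> {x - \<epsilon>..x + \<epsilon>}) (snd c \<circ> \<gamma>)"
      if "\<gamma> ` J \<subseteq> fst c" "abs_continuous_on J (snd c \<circ> \<gamma>)" "{a..b} \<inter> {x - \<epsilon>..x + \<epsilon>} \<subseteq> J" for \<epsilon> J
      using that abs_continuous_on_subset by blast
    have "\<exists>\<epsilon>>0. \<gamma> ` ({a..b} \<inter> {x - \<epsilon>..x + \<epsilon>}) \<subseteq> fst c \<and>
        abs_continuous_on ({a..b} \<inter> {x - \<epsilon>..x + \<epsilon>}) (snd c \<circ> \<gamma>)"
    proof -
      consider "x < s" | "s < x" | "x = s" by linarith
      then show ?thesis
      proof cases
        assume xs: "x < s"
        then obtain \<epsilon> where e: "\<epsilon> > 0" "\<gamma> ` ({a..s} \<inter> {x - \<epsilon>..x + \<epsilon>}) \<subseteq> fst c"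
          "abs_continuous_on ({a..s} \<inter> {x - \<epsilon>..x + \<epsilon>}) (snd c \<circ> \<gamma>)" using 1 by auto
        show ?thesis
          by (rule exI[of _ "min \<epsilon> (s - x)"], rule conjI, use e(1) xs in simp, rule sub[OF e(2,3)]) auto
      next
        assume xs: "s < x"
        then obtain \<epsilon> where e: "\<epsilon> > 0" "\<gamma> ` ({s..b} \<inter> {x - \<epsilon>..x + \<epsilon>}) \<subseteq> fst c"
          "abs_continuous_on ({s..b} \<inter> {x - \<epsilon>..x + \<epsilon>}) (snd c \<circ> \<gamma>)" using 2 by auto
        show ?thesis
          by (rule exI[of _ "min \<epsilon> (x - s)"], rule conjI, use e(1) xs in simp, rule sub[OF e(2,3)]) auto
      next
        assume xs: "x = s"
        obtain \<epsilon>1 where e1: "\<epsilon>1 > 0" "\<gamma> ` ({a..s} \<inter> {x - \<epsilon>1..x + \<epsilon>1}) \<subseteq> fst c"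
          "abs_continuous_on ({a..s} \<inter> {x - \<epsilon>1..x + \<epsilon>1}) (snd c \<circ> \<gamma>)" using 1 xs by auto
        obtain \<epsilon>2 where e2: "\<epsilon>2 > 0" "\<gamma> ` ({s..b} \<inter> {x - \<epsilon>2..x + \<epsilon>2}) \<subseteq> fst c"
          "abs_continuous_on ({s..b} \<inter> {x - \<epsilon>2..x + \<epsilon>2}) (snd c \<circ> \<gamma>)" using 2 xs by auto
        let ?l = "max a (s - \<epsilon>1)" and ?u = "min b (s + \<epsilon>2)"
        have le: "?l \<le> s" "s \<le> ?u" using s e1 e2 by auto
        have "abs_continuous_on {?l..s} (snd c \<circ> \<gamma>)"
          by (rule abs_continuous_on_subset[OF e1(3)]) (use xs e1(1) in auto)
        moreover have "abs_continuous_on {s..?u} (snd c \<circ> \<gamma>)"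
          by (rule abs_continuous_on_subset[OF e2(3)]) (use xs e2(1) in auto)
        ultimately have ac: "abs_continuous_on {?l..?u} (snd c \<circ> \<gamma>)"
          by (rule abs_continuous_on_join[OF le])
        have "{?l..?u} \<subseteq> ({a..s} \<inter> {x - \<epsilon>1..x + \<epsilon>1}) \<union> ({s..b} \<inter> {x - \<epsilon>2..x + \<epsilon>2})"
          using xs e1(1) e2(1) by auto
        then have im: "\<gamma> ` {?l..?u} \<subseteq> fst c" using e1(2) e2(2) by blast
        show ?thesis
          by (rule exI[of _ "min \<epsilon>1 \<epsilon>2"], rule conjI, use e1(1) e2(1) in simp, rule sub[OF im ac]) (use xs in auto)
      qed
    qed
    then show "\<exists>\<epsilon>>0. \<exists>c\<in>A. \<gamma> ` ({a..b} \<inter> {x - \<epsilon>..x + \<epsilon>}) \<subseteq> fst c \<and>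
        abs_continuous_on ({a..b} \<inter> {x - \<epsilon>..x + \<epsilon>}) (snd c \<circ> \<gamma>)"
      using c(1) by blast
  qed
qed

section \<open>Translates of one-parameter groups as arcs\<close>

lemma ex_curve_vel: "vel (\<lambda>r. g \<cdot> ex ((r - s) *\<^sub>R w)) r w"
proof -
  have "cdiff c0 (\<lambda>t. ex (t *\<^sub>R w)) (r + - r) w" using ex_cdiff_0[of w] by simp
  from cdiff_shift[OF this] have "cdiff c0 (\<lambda>x. ex ((x + - r) *\<^sub>R w)) r w" .
  moreover have "iv (g \<cdot> ex ((r - s) *\<^sub>R w)) \<cdot> (g \<cdot> ex ((x - s) *\<^sub>R w)) = ex ((x + - r) *\<^sub>R w)" for x
  proof -
    have "ex ((x - s) *\<^sub>R w) = ex ((r - s) *\<^sub>R w) \<cdot> ex ((x + - r) *\<^sub>R w)"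
      using ex_add[of "r - s" "x + - r" w] by simp
    then show ?thesis by (simp add: mul_assoc)
  qed
  ultimately show ?thesis by (simp add: vel_def)
qed

text \<open>These arcs have the constant speed \<open>\<mu> w\<close>. They replace pieces of a
  short arc and also serve as test arcs for \<open>norm_log_le_len\<close>.\<close>

lemma rect_ex_curve:
  shows "rect s t (\<lambda>r. g \<cdot> ex ((r - s') *\<^sub>R w))" (is "rect s t ?\<sigma>")
    and "s \<le> t \<Longrightarrow> len s t (\<lambda>r. g \<cdot> ex ((r - s') *\<^sub>R w)) = (t - s) * \<mu> w"
proof -
  have sp: "spd ?\<sigma> r = \<mu> w" for r by (rule speed_eq[OF ex_curve_vel])
  have md: "mdf (vchart :: (real, real) chart) ?\<sigma> r" for r
  proof -
    have m: "mdiff (vchart :: (real, real) chart) vchart (\<lambda>r. (r - s') *\<^sub>R w) r (\<lambda>k. k *\<^sub>R w)"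
      by (simp add: mdiff_vchart sdiff_real_scaleR)
        (auto simp: isCont_def intro!: tendsto_scaleR_lcs tendsto_diff tendsto_const tendsto_ident_at)
    show ?thesis
      by (intro mdf_mul mdf_const mdf_compose[OF m] mdf_ex) auto
  qed
  have cont: "isCont ?\<sigma> r" for r using md[of r] by (auto simp: mdf_def mdiff_def)
  show rect: "rect s t ?\<sigma>"
    unfolding rectifiable_def
  proof (intro conjI)
    show "continuous_on {s..t} ?\<sigma>" using cont by (simp add: continuous_at_imp_continuous_on)
    show "set_integrable lebesgue {s..t} (spd ?\<sigma>)"
      unfolding sp[abs_def] set_integrable_def by (simp add: fmeasurable_compact lmeasurable_iff_integrable[symmetric])
    show "AE x in lebesgue. x \<in> {s..t} \<longrightarrow> (\<exists>c\<in>A. ?\<sigma> x \<in> fst c \<and> (\<exists>w. has_dir_deriv (snd c \<circ> ?\<sigma>) x 1 w))"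
    proof (rule AE_I2, rule impI)
      fix x
      obtain c where c: "c \<in> A" "?\<sigma> x \<in> fst c" by (rule chart_ex)
      obtain w' where "cdiff c ?\<sigma> x w'" by (rule vel_cdiff[OF ex_curve_vel c])
      then show "\<exists>c\<in>A. ?\<sigma> x \<in> fst c \<and> (\<exists>w. has_dir_deriv (snd c \<circ> ?\<sigma>) x 1 w)"
        using c unfolding cdiff_def by blast
    qed
    show "chart_abs_continuous A s t ?\<sigma>"
      unfolding chart_abs_continuous_def
    proof
      fix x assume x: "x \<in> {s..t}"
      obtain c where c: "c \<in> A" "?\<sigma> x \<in> fst c" by (rule chart_ex)
      have "eventually (\<lambda>r. ?\<sigma> r \<in> fst c) (nhds x)"
        by (rule isCont_eventually[OF cont, where P="\<lambda>z. z \<in> fst c"])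
          (rule eventually_nhds_in_open[OF chart_open[OF chartA[OF c(1)]] c(2)])
      then obtain d where d: "d > 0" "\<And>r. dist r x < d \<Longrightarrow> ?\<sigma> r \<in> fst c"
        unfolding eventually_nhds_metric by blast
      have J: "?\<sigma> r \<in> fst c" if "r \<in> {x - d/2..x + d/2}" for r
        by (rule d(2)) (use that d(1) in \<open>auto simp: dist_real_def\<close>)
      have "abs_continuous_on {x - d/2..x + d/2} (\<lambda>r. (snd c \<circ> ?\<sigma>) r)"
      proof (rule abs_continuous_on_sdiff_compose[OF abs_continuous_on_ident continuous_on_id])
        fix r assume r: "r \<in> {x - d/2..x + d/2}"
        obtain D where "mdiff vchart c ?\<sigma> r D"
          by (rule mdfD[OF md is_chart_vchart c(1) J[OF r]])
        then show "\<exists>D. sdiff (snd c \<circ> ?\<sigma>) r D" by (auto simp: mdiff_def)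
      qed
      then have "abs_continuous_on {x - d/2..x + d/2} (snd c \<circ> ?\<sigma>)" by (simp add: comp_def)
      from abs_continuous_on_subset[OF this Int_lower2]
      have "abs_continuous_on ({s..t} \<inter> {x - d/2..x + d/2}) (snd c \<circ> ?\<sigma>)" .
      moreover have "?\<sigma> ` ({s..t} \<inter> {x - d/2..x + d/2}) \<subseteq> fst c" using J by blast
      moreover have "d / 2 > 0" using d(1) by simp
      ultimately show "\<exists>\<epsilon>>0. \<exists>c\<in>A. ?\<sigma> ` ({s..t} \<inter> {x - \<epsilon>..x + \<epsilon>}) \<subseteq> fst c \<and>
          abs_continuous_on ({s..t} \<inter> {x - \<epsilon>..x + \<epsilon>}) (snd c \<circ> ?\<sigma>)"
        using c(1) by blast
    qed
  qed
  show "len s t ?\<sigma> = (t - s) * \<mu> w" if "s \<le> t"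
    unfolding len_eq_integral[OF rect] sp[abs_def] using that by simp
qed

text \<open>Where \<gamma> has velocity \<open>u\<close>, the logarithm moves with velocity
  \<open>Dop\<close> of \<open>u\<close>, along which \<mu> grows at a rate of at most
  \<open>\<mu> u\<close>, the speed; the translation by \<open>iv g\<close> does not alter
  \<open>u\<close>. To integrate this, the logarithm must be controlled on the exceptional null set:
  near each parameter its increments are dominated by a continuous seminorm of those of \<gamma> in
  a chart, and there \<open>ftc_ac_inequality\<close> applies. Additivity of length joins the local
  bounds.\<close>

lemma norm_log_le_len:
  assumes r: "rect s t \<gamma>" and st: "s \<le> t" and V: "\<And>x. x \<in> {s..t} \<Longrightarrow> iv g \<cdot> \<gamma> x \<in> V"
  shows "\<mu> (lg (iv g \<cdot> \<gamma> t)) - \<mu> (lg (iv g \<cdot> \<gamma> s)) \<le> len s t \<gamma>"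
proof -
  define \<Gamma> where "\<Gamma> x = lg (iv g \<cdot> \<gamma> x)" for x
  define P where "P u v \<longleftrightarrow> (s \<le> u \<and> v \<le> t \<longrightarrow> \<mu> (\<Gamma> v) - \<mu> (\<Gamma> u) \<le> len u v \<gamma>)" for u v
  obtain N where N: "negligible N" "\<And>x. s < x \<Longrightarrow> x < t \<Longrightarrow> x \<notin> N \<Longrightarrow> \<exists>u. vel \<gamma> x u \<and> spd \<gamma> x = \<mu> u"
    using rect_vel[OF r] by blast
  have N': "negligible (N \<union> {s, t})" using N(1) by (simp add: negligible_Un)
  have deriv: "\<exists>d>0. \<forall>h. 0 \<le> h \<and> h < d \<longrightarrow> \<mu> (\<Gamma> (x + h)) - \<mu> (\<Gamma> x) \<le> (spd \<gamma> x + \<epsilon>) * h \<and>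
      \<mu> (\<Gamma> x) - \<mu> (\<Gamma> (x - h)) \<le> (spd \<gamma> x + \<epsilon>) * h"
    if x: "x \<in> {s..t}" "x \<notin> N \<union> {s, t}" and \<epsilon>: "\<epsilon> > 0" for x \<epsilon>
  proof -
    obtain u where u: "vel \<gamma> x u" "spd \<gamma> x = \<mu> u" using N(2)[of x] x by auto
    have y: "\<mu> (\<Gamma> x) < R" unfolding \<Gamma>_def by (rule lg_V(2)[OF V[OF x(1)]])
    have "cdiff vchart (\<lambda>r. lg (ex (\<Gamma> x) \<cdot> (iv (\<gamma> x) \<cdot> \<gamma> r))) x (Dop (\<Gamma> x) u)"
      by (rule cdiff_lg_mul[OF y u(1)[unfolded vel_def]]) simp
    moreover have "ex (\<Gamma> x) \<cdot> (iv (\<gamma> x) \<cdot> \<gamma> r) = iv g \<cdot> \<gamma> r" for r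
      using lg_V(1)[OF V[OF x(1)]] by (simp add: \<Gamma>_def mul_assoc)
    ultimately have D: "has_dir_deriv \<Gamma> x 1 (Dop (\<Gamma> x) u)"
      by (simp add: cdiff_vchart \<Gamma>_def[abs_def])
    let ?n = "norm_deriv \<mu> (\<Gamma> x)" and ?v = "Dop (\<Gamma> x) u"
    have n1: "?n ?v \<le> \<mu> u" using norm_deriv_Dop_le[OF y, of u] norm_deriv_le_mu[of "\<Gamma> x" u] by simp
    \<comment> \<open>By subadditivity the left derivative of \<mu> along the curve never exceeds
      the right one, so the same bound serves on both sides.\<close>
    have "?n (?v + - ?v) \<le> ?n ?v + ?n (- ?v)" by (rule norm_deriv_add)
    moreover have "?n (?v + - ?v) = 0" by (simp add: norm_deriv_def)
    ultimately have n2: "- ?n (- ?v) \<le> \<mu> u" using n1 by simp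
    have "eventually (\<lambda>h. (\<mu> (\<Gamma> (x + h)) - \<mu> (\<Gamma> x)) / h < \<mu> u + \<epsilon>) (at_right 0)"
      by (rule order_tendstoD(2)[OF norm_deriv_curve(1)[OF D]]) (use n1 \<epsilon> in simp)
    moreover have "eventually (\<lambda>h. (\<mu> (\<Gamma> x) - \<mu> (\<Gamma> (x - h))) / h < \<mu> u + \<epsilon>) (at_right 0)"
      by (rule order_tendstoD(2)[OF norm_deriv_curve(2)[OF D]]) (use n2 \<epsilon> in simp)
    ultimately have "eventually (\<lambda>h. (\<mu> (\<Gamma> (x + h)) - \<mu> (\<Gamma> x)) / h < \<mu> u + \<epsilon> \<and>
        (\<mu> (\<Gamma> x) - \<mu> (\<Gamma> (x - h))) / h < \<mu> u + \<epsilon>) (at_right 0)"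
      by (rule eventually_conj)
    then obtain d where d: "d > 0" "\<And>h. 0 < h \<Longrightarrow> h < d \<Longrightarrow> (\<mu> (\<Gamma> (x + h)) - \<mu> (\<Gamma> x)) / h < \<mu> u + \<epsilon> \<and>
        (\<mu> (\<Gamma> x) - \<mu> (\<Gamma> (x - h))) / h < \<mu> u + \<epsilon>"
      unfolding eventually_at_right_field by auto
    have "\<mu> (\<Gamma> (x + h)) - \<mu> (\<Gamma> x) \<le> (\<mu> u + \<epsilon>) * h \<and> \<mu> (\<Gamma> x) - \<mu> (\<Gamma> (x - h)) \<le> (\<mu> u + \<epsilon>) * h"
      if h: "0 \<le> h" "h < d" for h
    proof (cases "h = 0")
      case False
      then have "h > 0" using h by simp
      with d(2)[OF this h(2)] show ?thesis by (simp add: divide_less_eq less_imp_le)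
    qed simp
    with d(1) u(2) show ?thesis by auto
  qed
  have "P s t"
    using st
  proof (induction rule: Bolzano)
    case (trans u v w)
    show ?case
      unfolding P_def
    proof
      assume sw: "s \<le> u \<and> w \<le> t"
      then have "rect u w \<gamma>" by (intro rect_sub[OF r]) auto
      from len_add[OF this trans(3,4)] trans sw show "\<mu> (\<Gamma> w) - \<mu> (\<Gamma> u) \<le> len u w \<gamma>"
        by (simp add: P_def)
    qed
  next
    case (local x)
    then have x: "x \<in> {s..t}" by simp
    obtain \<epsilon> c where c: "\<epsilon> > 0" "c \<in> A" "\<gamma> ` ({s..t} \<inter> {x - \<epsilon>..x + \<epsilon>}) \<subseteq> fst c"
        "abs_continuous_on ({s..t} \<inter> {x - \<epsilon>..x + \<epsilon>}) (snd c \<circ> \<gamma>)"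
      using rect_ac[OF r] x unfolding chart_abs_continuous_def by blast
    have gx: "\<gamma> x \<in> fst c" using c(1,3) x by auto
    have "mdf c (\<lambda>y. iv g \<cdot> y) (\<gamma> x)"
      by (intro mdf_mul mdf_const mdf_id) (use c gx in auto)
    then obtain D where D: "mdiff c vchart (\<lambda>y. lg (iv g \<cdot> y)) (\<gamma> x) D"
      by (rule mdiff_lg_compose) (use V[OF x] c in auto)
    let ?G = "snd vchart \<circ> (\<lambda>y. lg (iv g \<cdot> y)) \<circ> chart_inv c"
    have sG: "sdiff ?G (snd c (\<gamma> x)) D" using D by (simp add: mdiff_def)
    obtain q U where q: "continuous_seminorm q" and U: "open U" "snd c (\<gamma> x) \<in> U"
      and lip: "\<And>y y'. y \<in> U \<Longrightarrow> y' \<in> U \<Longrightarrow> \<mu> (?G y' - ?G y) \<le> q (y' - y)"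
      using sdiff_locally_lipschitz[OF sG mu_cont mu_scale] by blast
    have "continuous_on ({s..t} \<inter> {x - \<epsilon>..x + \<epsilon>}) (snd c \<circ> \<gamma>)"
      by (rule continuous_on_compose[OF continuous_on_subset[OF rect_continuous[OF r] Int_lower1]
            continuous_on_subset[OF continuous_on_chart[OF chartA[OF c(2)]] c(3)]])
    then have "((snd c \<circ> \<gamma>) \<longlongrightarrow> (snd c \<circ> \<gamma>) x) (at x within ({s..t} \<inter> {x - \<epsilon>..x + \<epsilon>}))"
      using x c(1) unfolding continuous_on_def by (elim bspec) simp
    then have "eventually (\<lambda>y. (snd c \<circ> \<gamma>) y \<in> U) (at x within ({s..t} \<inter> {x - \<epsilon>..x + \<epsilon>}))"
      by (rule topological_tendstoD) (use U in auto)
    then obtain d where d: "d > 0" "\<And>y. y \<in> {s..t} \<inter> {x - \<epsilon>..x + \<epsilon>} \<Longrightarrow> y \<noteq> x \<Longrightarrow> dist y x < d \<Longrightarrow> (snd c \<circ> \<gamma>) y \<in> U"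
      unfolding eventually_at by blast
    have inU: "snd c (\<gamma> y) \<in> U" "\<gamma> y \<in> fst c" if "y \<in> {s..t}" "\<bar>y - x\<bar> < min d \<epsilon>" for y
    proof -
      have y: "y \<in> {s..t} \<inter> {x - \<epsilon>..x + \<epsilon>}" using that by auto
      then show "\<gamma> y \<in> fst c" using c(3) by blast
      show "snd c (\<gamma> y) \<in> U"
        using d(2)[OF y] U(2) that by (cases "y = x") (auto simp: dist_real_def)
    qed
    have "\<mu> (\<Gamma> v) - \<mu> (\<Gamma> u) \<le> len u v \<gamma>"
      if uv: "u \<le> x" "x \<le> v" "v - u < min d \<epsilon>" "s \<le> u" "v \<le> t" for u v
      unfolding arc_length_def
    proof (rule ftc_ac_inequality[OF _ _ q _ N'])
      show "u \<le> v" using uv by simp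
      show "abs_continuous_on {u..v} (snd c \<circ> \<gamma>)"
        by (rule abs_continuous_on_subset[OF c(4)]) (use uv in auto)
      show "set_integrable lebesgue {u..v} (spd \<gamma>)"
        by (rule rect_integrable[OF rect_sub[OF r uv(4,5)]])
      show "\<mu> (\<Gamma> z) - \<mu> (\<Gamma> y) \<le> q ((snd c \<circ> \<gamma>) z - (snd c \<circ> \<gamma>) y)" if "u \<le> y" "y \<le> z" "z \<le> v" for y z
      proof -
        have y: "y \<in> {s..t}" "\<bar>y - x\<bar> < min d \<epsilon>" and z: "z \<in> {s..t}" "\<bar>z - x\<bar> < min d \<epsilon>"
          using that uv by auto
        have "\<mu> (\<Gamma> z) - \<mu> (\<Gamma> y) \<le> \<mu> (\<Gamma> z - \<Gamma> y)" by (rule mu_diff_le)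
        also have "\<Gamma> z - \<Gamma> y = ?G (snd c (\<gamma> z)) - ?G (snd c (\<gamma> y))"
          using inU(2)[OF y] inU(2)[OF z] c(2) by (simp add: \<Gamma>_def)
        also have "\<mu> (?G (snd c (\<gamma> z)) - ?G (snd c (\<gamma> y))) \<le> q (snd c (\<gamma> z) - snd c (\<gamma> y))"
          by (rule lip[OF inU(1)[OF y] inU(1)[OF z]])
        finally show ?thesis by simp
      qed
      fix y e :: real assume y: "y \<in> {u..v}" "y \<notin> N \<union> {s, t}" "e > 0"
      then have "y \<in> {s..t}" using uv by auto
      from deriv[OF this y(2,3)] obtain d' where d': "d' > 0"
        "\<And>h. 0 \<le> h \<Longrightarrow> h < d' \<Longrightarrow> \<mu> (\<Gamma> (y + h)) - \<mu> (\<Gamma> y) \<le> (spd \<gamma> y + e) * h"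
        "\<And>h. 0 \<le> h \<Longrightarrow> h < d' \<Longrightarrow> \<mu> (\<Gamma> y) - \<mu> (\<Gamma> (y - h)) \<le> (spd \<gamma> y + e) * h" by blast
      \<comment> \<open>The interval is split at its tag \<open>y\<close>: the right part obeys the
        first one-sided bound, the left part the second, and both have the same rate.\<close>
      have "\<mu> (\<Gamma> k) - \<mu> (\<Gamma> l) \<le> (spd \<gamma> y + e) * (k - l)" if "l \<le> y" "y \<le> k" "k - l < d'" for k l
        using d'(2)[of "k - y"] d'(3)[of "y - l"] that by (simp add: algebra_simps)
      with d'(1) show "\<exists>d>0. \<forall>l k. u \<le> l \<and> l \<le> y \<and> y \<le> k \<and> k \<le> v \<and> k - l < d \<longrightarrow>
          \<mu> (\<Gamma> k) - \<mu> (\<Gamma> l) \<le> (spd \<gamma> y + e) * (k - l)" by blast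
    qed
    moreover have "min d \<epsilon> > 0" using d(1) c(1) by simp
    ultimately show ?case by (intro exI[of _ "min d \<epsilon>"]) (auto simp: P_def)
  qed
  then show ?thesis by (simp add: P_def \<Gamma>_def)
qed

end

section \<open>Short arcs\<close>

context lie_finsler
begin

section \<open>Continuity of the group operations and a neighbourhood with logarithms of
  products\<close>

lemma tendsto_quot:
  assumes "(f \<longlongrightarrow> x) F" "(g \<longlongrightarrow> y) F"
  shows "((\<lambda>t. f t \<cdot> iv (g t)) \<longlongrightarrow> x \<cdot> iv y) F"
proof -
  have "isCont (\<lambda>(x, y). x \<cdot> iv y) (x, y)"
    using quot_mfd by (simp add: mfd_map_def continuous_on_eq_continuous_at)
  from isCont_tendsto_compose[OF this tendsto_Pair[OF assms]] show ?thesis by simp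
qed

lemma tendsto_inv: "(g \<longlongrightarrow> y) F \<Longrightarrow> ((\<lambda>t. iv (g t)) \<longlongrightarrow> iv y) F"
  using tendsto_quot[OF tendsto_const, of g y F one] by simp

lemma tendsto_mul:
  assumes "(f \<longlongrightarrow> x) F" "(g \<longlongrightarrow> y) F"
  shows "((\<lambda>t. f t \<cdot> g t) \<longlongrightarrow> x \<cdot> y) F"
  using tendsto_quot[OF assms(1) tendsto_inv[OF assms(2)]] by simp

text \<open>\<open>W\<close> is a neighbourhood for the topology of \<open>'e\<close> rather than a
  \<mu>-ball. Convexity keeps \<open>\<tau> y\<close> in \<open>W\<close> for \<open>y\<close> in
  \<open>W\<close> and \<tau> between 0 and 1, so products along a whole segment have
  logarithms.\<close>

lemma ex_small_nbhd:
  obtains W where "convex W" "0 \<in> W" "\<forall>x\<in>W. \<mu> x < R"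
    "\<forall>x\<in>W. \<forall>y\<in>W. ex x \<cdot> ex y \<in> V" "open (ex ` W)"
proof -
  have "continuous_on UNIV (\<lambda>p. ex (fst p) \<cdot> ex (snd p))"
    unfolding continuous_on_def
  proof
    fix p :: "'e \<times> 'e"
    show "((\<lambda>p. ex (fst p) \<cdot> ex (snd p)) \<longlongrightarrow> ex (fst p) \<cdot> ex (snd p)) (at p within UNIV)"
      by (intro tendsto_mul isCont_tendsto_compose[OF isCont_ex] tendsto_fst tendsto_snd tendsto_ident_at)
  qed
  then have "open ((\<lambda>p. ex (fst p) \<cdot> ex (snd p)) -` V)" by (rule open_vimage[OF open_V])
  moreover have "(0, 0) \<in> (\<lambda>p. ex (fst p) \<cdot> ex (snd p)) -` V" using one_in_V by simp
  ultimately obtain A B where AB: "open A" "open B" "(0, 0) \<in> A \<times> B"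
      "A \<times> B \<subseteq> (\<lambda>p. ex (fst p) \<cdot> ex (snd p)) -` V"
    by (rule open_prod_elim)
  have oO: "open (A \<inter> B \<inter> {v. \<mu> v < R})" and mO: "0 \<in> A \<inter> B \<inter> {v. \<mu> v < R}"
    using AB R by (auto intro: open_Int open_mu_less)
  obtain W where W: "open W" "0 \<in> W" "convex W" "\<And>y. y - 0 \<in> W \<Longrightarrow> y \<in> A \<inter> B \<inter> {v. \<mu> v < R}"
    using open_convex_nbhd_diff[OF oO mO] by blast
  have WA: "x \<in> A" "x \<in> B" "\<mu> x < R" if "x \<in> W" for x using W(4)[of x] that by auto
  have "ex ` W = lg -` W \<inter> V"
  proof
    show "ex ` W \<subseteq> lg -` W \<inter> V" using WA(3) ex_in_V by auto
    show "lg -` W \<inter> V \<subseteq> ex ` W"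
    proof
      fix g assume g: "g \<in> lg -` W \<inter> V"
      then have "g = ex (lg g)" using lg_V(1) by simp
      then show "g \<in> ex ` W" using g by blast
    qed
  qed
  moreover have "continuous_on V lg" using lg_C1 by (simp add: mfd_map_def)
  from continuous_on_open_vimage[OF open_V, THEN iffD1, rule_format, OF this W(1)]
  have "open (lg -` W \<inter> V)" .
  ultimately have "open (ex ` W)" by simp
  moreover have "ex x \<cdot> ex y \<in> V" if "x \<in> W" "y \<in> W" for x y
    using AB(4) WA(1)[OF that(1)] WA(2)[OF that(2)] by auto
  ultimately show ?thesis using that[of W] W(2,3) WA(3) by blast
qed

lemma parallel_of_additive:
  assumes sc: "strictly_convex \<mu>" and x: "\<mu> x < R"
    and xy: "\<And>\<tau>. 0 \<le> \<tau> \<Longrightarrow> \<tau> \<le> 1 \<Longrightarrow> ex x \<cdot> ex (\<tau> *\<^sub>R y) \<in> V"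
    and add: "\<mu> (lg (ex x \<cdot> ex y)) = \<mu> x + \<mu> y" and ne: "x \<noteq> 0" "y \<noteq> 0"
  obtains r where "r > 0" "y = r *\<^sub>R x"
proof -
  define f where "f \<tau> = \<mu> (lg (ex x \<cdot> ex (\<tau> *\<^sub>R y)))" for \<tau>
  \<comment> \<open>From \<tau> to 1 the norm of the logarithm grows by at most
    \<open>(1 - \<tau>) \<mu> y\<close>. Since the value at 1 is as large as possible, the growth
    from 0 to \<tau> must already be at least \<open>\<tau> \<mu> y\<close>.\<close>
  have low: "\<mu> x + \<tau> * \<mu> y \<le> f \<tau>" if \<tau>: "0 \<le> \<tau>" "\<tau> \<le> 1" for \<tau>
  proof -
    have "\<mu> (lg (iv one \<cdot> (ex x \<cdot> ex ((1 - 0) *\<^sub>R y)))) - \<mu> (lg (iv one \<cdot> (ex x \<cdot> ex ((\<tau> - 0) *\<^sub>R y))))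
        \<le> len \<tau> 1 (\<lambda>r. ex x \<cdot> ex ((r - 0) *\<^sub>R y))"
      by (rule norm_log_le_len[OF rect_ex_curve(1) \<tau>(2)]) (use xy \<tau> in auto)
    also have "\<dots> = (1 - \<tau>) * \<mu> y" by (rule rect_ex_curve(2)[OF \<tau>(2)])
    finally show ?thesis using add by (simp add: f_def algebra_simps)
  qed
  have "cdiff vchart (\<lambda>\<tau>. lg (ex x \<cdot> ex (\<tau> *\<^sub>R y))) 0 (Dop x y)"
    by (rule cdiff_lg_mul[OF x ex_cdiff_0]) simp
  then have "has_dir_deriv (\<lambda>\<tau>. lg (ex x \<cdot> ex (\<tau> *\<^sub>R y))) 0 1 (Dop x y)" by (simp add: cdiff_vchart)
  from norm_deriv_curve(1)[OF this]
  have lim: "((\<lambda>h. (f h - \<mu> x) / h) \<longlongrightarrow> norm_deriv \<mu> x (Dop x y)) (at_right 0)"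
    using x by (simp add: f_def)
  have "\<mu> y \<le> norm_deriv \<mu> x (Dop x y)"
  proof (rule tendsto_lowerbound[OF lim])
    have "eventually (\<lambda>h. h \<in> {0<..<1}) (at_right (0::real))" by (rule eventually_at_right_real) simp
    then show "eventually (\<lambda>h. \<mu> y \<le> (f h - \<mu> x) / h) (at_right 0)"
    proof eventually_elim
      case (elim h)
      then show ?case using low[of h] by (simp add: le_divide_eq mult.commute)
    qed
  qed simp
  also have "\<dots> \<le> norm_deriv \<mu> x y" by (rule norm_deriv_Dop_le[OF x])
  also have "\<dots> \<le> \<mu> (x + y) - \<mu> x" using norm_deriv_le[of 1 x y] by simp
  finally have "\<mu> (x + y) = \<mu> x + \<mu> y" using mu_triangle[of x y] by simp
  with sc ne that show ?thesis unfolding strictly_convex_def by blast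
qed

text \<open>For uniqueness: \<open>z\<close> is not known to be small, so its norm cannot be read
  off from a single logarithm. On short pieces the logarithm is a small multiple of
  \<open>z\<close>, and the bounds for the pieces add up.\<close>

lemma segment_norm_le_len:
  assumes r: "rect a b \<gamma>" and ab: "a < b"
    and s: "continuous_on {a..b} s" "mono_on {a..b} s" "s a = 0" "s b = 1"
    and \<gamma>: "\<And>t. t \<in> {a..b} \<Longrightarrow> \<gamma> t = g \<cdot> ex (s t *\<^sub>R z)"
  shows "\<mu> z \<le> len a b \<gamma>"
proof -
  define P where "P u v \<longleftrightarrow> (a \<le> u \<and> v \<le> b \<longrightarrow> (s v - s u) * \<mu> z \<le> len u v \<gamma>)" for u v
  have "P a b"
    using less_imp_le[OF ab]
  proof (induction rule: Bolzano)
    case (trans u v w)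
    show ?case
      unfolding P_def
    proof
      assume sw: "a \<le> u \<and> w \<le> b"
      then have "rect u w \<gamma>" by (intro rect_sub[OF r]) auto
      from len_add[OF this trans(3,4)] trans sw show "(s w - s u) * \<mu> z \<le> len u w \<gamma>"
        by (simp add: P_def algebra_simps)
    qed
  next
    case (local x)
    then have x: "x \<in> {a..b}" by simp
    have "((\<lambda>y. (s y - s x) * \<mu> z) \<longlongrightarrow> (s x - s x) * \<mu> z) (at x within {a..b})"
      using s(1) x by (intro tendsto_intros) (simp add: continuous_on_def)
    then have "((\<lambda>y. \<bar>(s y - s x) * \<mu> z\<bar>) \<longlongrightarrow> 0) (at x within {a..b})"
      by (simp add: tendsto_rabs_zero)
    \<comment> \<open>Half of \<open>R\<close> on either side of \<open>x\<close>, so that the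
      increment between any two nearby parameters has norm below \<open>R\<close>.\<close>
    then have "eventually (\<lambda>y. \<bar>(s y - s x) * \<mu> z\<bar> < R / 2) (at x within {a..b})"
      using R by (intro order_tendstoD(2)) auto
    then obtain d where d: "d > 0" "\<And>y. y \<in> {a..b} \<Longrightarrow> y \<noteq> x \<Longrightarrow> dist y x < d \<Longrightarrow> \<bar>(s y - s x) * \<mu> z\<bar> < R / 2"
      unfolding eventually_at by blast
    have near: "\<bar>(s y - s x) * \<mu> z\<bar> < R / 2" if "y \<in> {a..b}" "\<bar>y - x\<bar> < d" for y
      using d(2)[of y] that R by (cases "y = x") (auto simp: dist_real_def)
    have "(s v - s u) * \<mu> z \<le> len u v \<gamma>" if uv: "u \<le> x" "x \<le> v" "v - u < d" "a \<le> u" "v \<le> b" for u v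
    proof -
      have lg: "iv (\<gamma> u) \<cdot> \<gamma> y = ex ((s y - s u) *\<^sub>R z)" "\<mu> ((s y - s u) *\<^sub>R z) = (s y - s u) * \<mu> z"
          "\<mu> ((s y - s u) *\<^sub>R z) < R" if y: "y \<in> {u..v}" for y
      proof -
        have yab: "y \<in> {a..b}" "u \<in> {a..b}" using y uv by auto
        have "ex (s y *\<^sub>R z) = ex (s u *\<^sub>R z) \<cdot> ex ((s y - s u) *\<^sub>R z)"
          using ex_add[of "s u" "s y - s u" z] by simp
        then show "iv (\<gamma> u) \<cdot> \<gamma> y = ex ((s y - s u) *\<^sub>R z)"
          using \<gamma>[OF yab(1)] \<gamma>[OF yab(2)] by (simp add: mul_assoc)
        have "s u \<le> s y" by (rule mono_onD[OF s(2)]) (use yab y in auto)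
        then show m: "\<mu> ((s y - s u) *\<^sub>R z) = (s y - s u) * \<mu> z" by (simp add: mu_scale)
        have "\<bar>(s y - s x) * \<mu> z\<bar> < R / 2" "\<bar>(s u - s x) * \<mu> z\<bar> < R / 2"
          using near yab y uv by auto
        moreover have "(s y - s u) * \<mu> z = (s y - s x) * \<mu> z - (s u - s x) * \<mu> z"
          by (simp add: algebra_simps)
        ultimately show "\<mu> ((s y - s u) *\<^sub>R z) < R" unfolding m by linarith
      qed
      have uv': "u \<le> v" using uv by simp
      have "\<mu> (lg (iv (\<gamma> u) \<cdot> \<gamma> v)) - \<mu> (lg (iv (\<gamma> u) \<cdot> \<gamma> u)) \<le> len u v \<gamma>"
      proof (rule norm_log_le_len[OF rect_sub[OF r uv(4,5)] uv'])
        show "iv (\<gamma> u) \<cdot> \<gamma> y \<in> V" if "y \<in> {u..v}" for y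
          unfolding lg(1)[OF that] by (rule ex_in_V[OF lg(3)[OF that]])
      qed
      moreover have "lg (iv (\<gamma> u) \<cdot> \<gamma> u) = 0" using lg_ex[of 0] R by simp
      moreover have v: "v \<in> {u..v}" using uv' by simp
      ultimately show ?thesis using lg(1)[OF v] lg_ex[OF lg(3)[OF v]] lg(2)[OF v] by simp
    qed
    then show ?case by (intro exI[of _ d] conjI d(1)) (simp add: P_def)
  qed
  then show ?thesis using s by (simp add: P_def)
qed

lemma short_arc_le_log:
  assumes r: "rect a b \<gamma>" and ab: "a < b" and short: "short K A c0 \<mu> a b \<gamma>"
    and st: "a \<le> s" "s \<le> t" "t \<le> b" and V: "iv (\<gamma> s) \<cdot> \<gamma> t \<in> V"
  shows "len s t \<gamma> \<le> \<mu> (lg (iv (\<gamma> s) \<cdot> \<gamma> t))"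
proof (cases "s = t")
  case True
  then show ?thesis using len_same[OF r, of s] st by simp
next
  case False
  then have st': "s < t" using st by simp
  define w where "w = lg (iv (\<gamma> s) \<cdot> \<gamma> t)"
  \<comment> \<open>The competitor runs over the same parameter interval as the piece that it
    replaces, so it can be inserted without a change of parameter.\<close>
  define \<sigma> where "\<sigma> r = \<gamma> s \<cdot> ex ((r - s) *\<^sub>R (w /\<^sub>R (t - s)))" for r
  have \<sigma>s: "\<sigma> s = \<gamma> s" by (simp add: \<sigma>_def)
  have \<sigma>t: "\<sigma> t = \<gamma> t"
    using st' lg_V(1)[OF V] by (simp add: \<sigma>_def w_def)
  have lw: "len s t \<sigma> = \<mu> w"
    using rect_ex_curve(2)[OF st(2), of "\<gamma> s" s "w /\<^sub>R (t - s)"] st' by (simp add: \<sigma>_def[abs_def] mu_scale)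
  have rw: "rect s t \<sigma>" unfolding \<sigma>_def by (rule rect_ex_curve(1))
  define \<gamma>' where "\<gamma>' r = (if s \<le> r \<and> r \<le> t then \<sigma> r else \<gamma> r)" for r
  have ras: "rect a s \<gamma>" and rtb: "rect t b \<gamma>" and rsb: "rect s b \<gamma>"
    using rect_sub[OF r] st by auto
  have e1: "\<gamma> x = \<gamma>' x" if "x \<in> {a..s}" for x using that \<sigma>s by (cases "x = s") (auto simp: \<gamma>'_def)
  have e2: "\<sigma> x = \<gamma>' x" if "x \<in> {s..t}" for x using that by (simp add: \<gamma>'_def)
  have e3: "\<gamma> x = \<gamma>' x" if "x \<in> {t..b}" for x using that \<sigma>t by (cases "x = t") (auto simp: \<gamma>'_def)
  note c1 = rect_cong[OF ras e1] and c2 = rect_cong[OF rw e2] and c3 = rect_cong[OF rtb e3]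
  have r2: "rect s b \<gamma>'" by (rule rect_join[OF c2(1) c3(1) st(2,3)])
  have sb: "s \<le> b" using st by simp
  have r': "rect a b \<gamma>'" by (rule rect_join[OF c1(1) r2 st(1) sb])
  have "len a b \<gamma>' = len a s \<gamma>' + len s b \<gamma>'" by (rule len_add[OF r' st(1) sb])
  also have "len s b \<gamma>' = len s t \<gamma>' + len t b \<gamma>'" by (rule len_add[OF r2 st(2,3)])
  finally have L': "len a b \<gamma>' = len a s \<gamma> + \<mu> w + len t b \<gamma>"
    using c1(2) c2(2) c3(2) lw by simp
  have "len a b \<gamma> = len a s \<gamma> + len s b \<gamma>" by (rule len_add[OF r st(1) sb])
  also have "len s b \<gamma> = len s t \<gamma> + len t b \<gamma>" by (rule len_add[OF rsb st(2,3)])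
  finally have L: "len a b \<gamma> = len a s \<gamma> + len s t \<gamma> + len t b \<gamma>" by simp
  have "finsler_dist K A c0 \<mu> (\<gamma> a) (\<gamma> b) \<le> ereal (len a b \<gamma>')"
    unfolding finsler_dist_def
    by (rule Inf_lower) (use ab r' e1[of a] e3[of b] st in auto)
  then have "len a b \<gamma> \<le> len a b \<gamma>'"
    using short unfolding short_def by (metis ereal_less_eq(3))
  then show ?thesis using L L' by (simp add: w_def)
qed

text \<open>The ordered pairs whose quotient lies outside \<open>U\<close> form a compact set, on
  which \<open>f t - f s\<close> attains its minimum. This minimum is positive, as pairs with no
  increase of \<open>f\<close> have quotient \<open>one\<close>. The function \<open>f\<close> is
  the parameter in the first use and arc length in the second.\<close>

lemma uniformly_near:
  fixes \<gamma> :: "real \<Rightarrow> 'k" and f :: "real \<Rightarrow> real"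
  assumes \<gamma>: "continuous_on {a..b} \<gamma>" and f: "continuous_on {a..b} f"
    and eq: "\<And>s t. a \<le> s \<Longrightarrow> s \<le> t \<Longrightarrow> t \<le> b \<Longrightarrow> f t \<le> f s \<Longrightarrow> \<gamma> s = \<gamma> t"
    and U: "open U" "one \<in> U"
  obtains \<eta> :: real where "\<eta> > 0" "\<And>s t. a \<le> s \<Longrightarrow> s \<le> t \<Longrightarrow> t \<le> b \<Longrightarrow> f t - f s < \<eta> \<Longrightarrow> iv (\<gamma> s) \<cdot> \<gamma> t \<in> U"
proof -
  define T where "T = {p \<in> {a..b} \<times> {a..b}. fst p \<le> snd p}"
  have "closed {p :: real \<times> real. fst p \<le> snd p}"
    by (rule closed_Collect_le[OF continuous_on_fst[OF continuous_on_id] continuous_on_snd[OF continuous_on_id]])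
  from compact_Int_closed[OF compact_Times[OF compact_Icc[of a b] compact_Icc[of a b]] this]
  have "compact (({a..b} \<times> {a..b}) \<inter> {p. fst p \<le> snd p})" .
  moreover have "({a..b} \<times> {a..b}) \<inter> {p. fst p \<le> snd p} = T" unfolding T_def by blast
  ultimately have cT: "compact T" by simp
  have c1: "continuous_on T (\<lambda>p. \<gamma> (fst p))" "continuous_on T (\<lambda>p. f (fst p))"
    by (rule continuous_on_compose2[OF \<gamma> continuous_on_fst[OF continuous_on_id]]
        continuous_on_compose2[OF f continuous_on_fst[OF continuous_on_id]], auto simp: T_def)+
  have c2: "continuous_on T (\<lambda>p. \<gamma> (snd p))" "continuous_on T (\<lambda>p. f (snd p))"
    by (rule continuous_on_compose2[OF \<gamma> continuous_on_snd[OF continuous_on_id]]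
        continuous_on_compose2[OF f continuous_on_snd[OF continuous_on_id]], auto simp: T_def)+
  define h where "h p = iv (\<gamma> (fst p)) \<cdot> \<gamma> (snd p)" for p
  have "continuous_on T h"
    unfolding h_def continuous_on_def
  proof
    fix p assume p: "p \<in> T"
    show "((\<lambda>p. iv (\<gamma> (fst p)) \<cdot> \<gamma> (snd p)) \<longlongrightarrow> iv (\<gamma> (fst p)) \<cdot> \<gamma> (snd p)) (at p within T)"
      by (rule tendsto_mul[OF tendsto_inv[OF c1(1)[unfolded continuous_on_def, rule_format, OF p]]
            c2(1)[unfolded continuous_on_def, rule_format, OF p]])
  qed
  then have "closedin (top_of_set T) (T \<inter> h -` (- U))"
    by (rule continuous_closedin_preimage) (use U in auto)
  then have cB: "compact (T \<inter> h -` (- U))" by (rule closedin_compact[OF cT])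
  have near: "iv (\<gamma> s) \<cdot> \<gamma> t \<in> U" if "a \<le> s" "s \<le> t" "t \<le> b" "(s, t) \<notin> T \<inter> h -` (- U)" for s t
    using that by (auto simp: T_def h_def)
  show ?thesis
  proof (cases "T \<inter> h -` (- U) = {}")
    case True
    then show ?thesis using near that[of 1] by auto
  next
    case False
    have "continuous_on (T \<inter> h -` (- U)) (\<lambda>p. f (snd p) - f (fst p))"
      using continuous_on_diff[OF c2(2) c1(2)] by (rule continuous_on_subset) auto
    from continuous_attains_inf[OF cB False this]
    obtain p where p: "p \<in> T \<inter> h -` (- U)" "\<And>q. q \<in> T \<inter> h -` (- U) \<Longrightarrow> f (snd p) - f (fst p) \<le> f (snd q) - f (fst q)"
      by blast
    have "f (snd p) - f (fst p) > 0"
    proof (rule ccontr)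
      assume "\<not> f (snd p) - f (fst p) > 0"
      then have "\<gamma> (fst p) = \<gamma> (snd p)" using p(1) by (intro eq) (auto simp: T_def)
      then show False using p(1) U(2) by (auto simp: h_def)
    qed
    moreover have "iv (\<gamma> s) \<cdot> \<gamma> t \<in> U" if "a \<le> s" "s \<le> t" "t \<le> b" "f t - f s < f (snd p) - f (fst p)" for s t
      by (rule near[OF that(1-3)]) (use p(2)[of "(s, t)"] that(4) in auto)
    ultimately show ?thesis by (rule that)
  qed
qed

lemma short_arc_is_segment:
  assumes sc: "strictly_convex \<mu>"
    and r: "rect a b \<gamma>" and ab: "a < b" and short: "short K A c0 \<mu> a b \<gamma>"
  obtains z where "\<gamma> b = \<gamma> a \<cdot> ex z" "reparametrization a b \<gamma> (segment K ex (\<gamma> a) z)"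
proof -
  obtain W where W: "convex W" "0 \<in> W" "\<forall>x\<in>W. \<mu> x < R"
    "\<forall>x\<in>W. \<forall>y\<in>W. ex x \<cdot> ex y \<in> V" "open (ex ` W)"
    by (rule ex_small_nbhd)
  note W = W(1,2) W(3)[rule_format] W(4)[rule_format] W(5)
  have oneW: "one \<in> ex ` W" using W(2) by (metis ex_zero imageI)
  have WV: "ex ` W \<subseteq> V" using W(3) ex_in_V by auto
  define w where "w s t = lg (iv (\<gamma> s) \<cdot> \<gamma> t)" for s t
  define L where "L t = len a t \<gamma>" for t
  note cont = rect_continuous[OF r]
  have Lc: "continuous_on {a..b} L" unfolding L_def[abs_def] by (rule len_continuous[OF r])
  have Lst: "len s t \<gamma> = L t - L s" if "a \<le> s" "s \<le> t" "t \<le> b" for s t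
    using len_add[OF rect_sub[OF r order_refl that(3)] that(1,2)] by (simp add: L_def)
  have Lmono: "L s \<le> L t" if "a \<le> s" "s \<le> t" "t \<le> b" for s t
    using Lst[OF that] len_nonneg[OF rect_sub[OF r that(1,3)]] by simp
  have La: "L a = 0" unfolding L_def by (rule len_same[OF r]) (use ab in simp)
  have wV: "ex (w s t) = iv (\<gamma> s) \<cdot> \<gamma> t" "w s t \<in> W" if near: "iv (\<gamma> s) \<cdot> \<gamma> t \<in> ex ` W" for s t
  proof -
    show "ex (w s t) = iv (\<gamma> s) \<cdot> \<gamma> t" unfolding w_def by (rule lg_V(1)) (use near WV in auto)
    obtain x where x: "x \<in> W" "iv (\<gamma> s) \<cdot> \<gamma> t = ex x" using near by blast
    then show "w s t \<in> W" using W(3) by (simp add: w_def)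
  qed
  have len_eq: "\<mu> (w s t) = L t - L s"
    if st: "a \<le> s" "s \<le> t" "t \<le> b" and near: "\<And>x. x \<in> {s..t} \<Longrightarrow> iv (\<gamma> s) \<cdot> \<gamma> x \<in> ex ` W" for s t
  proof (rule antisym)
    have "\<mu> (lg (iv (\<gamma> s) \<cdot> \<gamma> t)) - \<mu> (lg (iv (\<gamma> s) \<cdot> \<gamma> s)) \<le> len s t \<gamma>"
      by (rule norm_log_le_len[OF rect_sub[OF r st(1,3)] st(2)]) (use near WV in auto)
    moreover have "lg (iv (\<gamma> s) \<cdot> \<gamma> s) = 0" using lg_ex[of 0] R by simp
    ultimately show "\<mu> (w s t) \<le> L t - L s" using Lst[OF st] by (simp add: w_def)
    have "iv (\<gamma> s) \<cdot> \<gamma> t \<in> V" using near[of t] st WV by auto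
    from short_arc_le_log[OF r ab short st this] show "L t - L s \<le> \<mu> (w s t)"
      using Lst[OF st] by (simp add: w_def)
  qed
  \<comment> \<open>Closeness in terms of the parameter. The analogue for arc length presupposes
    that stretches of zero length are rests, which is derived from this one.\<close>
  obtain \<eta>0 where \<eta>0: "\<eta>0 > 0" "\<And>s t. a \<le> s \<Longrightarrow> s \<le> t \<Longrightarrow> t \<le> b \<Longrightarrow> t - s < \<eta>0 \<Longrightarrow> iv (\<gamma> s) \<cdot> \<gamma> t \<in> ex ` W"
    by (rule uniformly_near[OF cont continuous_on_id _ W(5) oneW]) auto
  \<comment> \<open>On pieces short enough to have logarithms in \<open>W\<close>, zero length means
    that the logarithm has norm 0, hence vanishes by nondegeneracy.\<close>
  have rest: "\<gamma> s = \<gamma> t" if st: "a \<le> s" "s \<le> t" "t \<le> b" "L t \<le> L s" for s t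
  proof -
    define P where "P u v \<longleftrightarrow> (s \<le> u \<and> v \<le> t \<longrightarrow> \<gamma> u = \<gamma> v)" for u v
    have "P s t"
      using st(2)
    proof (induction rule: Bolzano)
      case (trans u v w)
      then show ?case by (auto simp: P_def)
    next
      case (local x)
      have "\<gamma> u = \<gamma> v" if uv: "u \<le> x" "x \<le> v" "v - u < \<eta>0" "s \<le> u" "v \<le> t" for u v
      proof -
        have ord: "a \<le> u" "u \<le> v" "v \<le> b" using uv st by auto
        have near: "iv (\<gamma> u) \<cdot> \<gamma> y \<in> ex ` W" if "y \<in> {u..v}" for y
          by (rule \<eta>0(2)) (use that uv ord in auto)
        have "L s \<le> L u" "L v \<le> L t" using Lmono uv st ord by auto
        then have "\<mu> (w u v) \<le> 0" using len_eq[OF ord near] st(4) by simp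
        then have "w u v = 0" using mu_eq_0D mu_nonneg antisym by metis
        then have "iv (\<gamma> u) \<cdot> \<gamma> v = one" using wV(1)[OF near[of v]] ord by simp
        then have "\<gamma> u \<cdot> (iv (\<gamma> u) \<cdot> \<gamma> v) = \<gamma> u" by simp
        then show ?thesis by simp
      qed
      then show ?case by (intro exI[of _ \<eta>0] conjI \<eta>0(1)) (simp add: P_def)
    qed
    then show ?thesis by (simp add: P_def)
  qed
  obtain \<eta> where \<eta>: "\<eta> > 0" "\<And>s t. a \<le> s \<Longrightarrow> s \<le> t \<Longrightarrow> t \<le> b \<Longrightarrow> L t - L s < \<eta> \<Longrightarrow> iv (\<gamma> s) \<cdot> \<gamma> t \<in> ex ` W"
    by (rule uniformly_near[OF cont Lc rest W(5) oneW]) auto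
  have close: "\<mu> (w s t) = L t - L s" "w s t \<in> W" "\<gamma> t = \<gamma> s \<cdot> ex (w s t)"
    if st: "a \<le> s" "s \<le> t" "t \<le> b" "L t - L s < \<eta>" for s t
  proof -
    have near: "iv (\<gamma> s) \<cdot> \<gamma> x \<in> ex ` W" if "x \<in> {s..t}" for x
      using Lmono[of x t] that st by (intro \<eta>(2)) auto
    show "\<mu> (w s t) = L t - L s" by (rule len_eq[OF st(1-3) near])
    show "w s t \<in> W" "\<gamma> t = \<gamma> s \<cdot> ex (w s t)" using wV[OF near[of t]] st by auto
  qed
  \<comment> \<open>Lengths add and equal the norms of logarithms over \<open>u\<close> to
    \<open>s\<close>, \<open>s\<close> to \<open>t\<close> and \<open>u\<close> to \<open>t\<close>,
    so \<open>parallel_of_additive\<close> applies; the factor is found by comparing norms.\<close>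
  have par: "w s t = ((L t - L s) / (L s - L u)) *\<^sub>R w u s"
    if ust: "a \<le> u" "u \<le> s" "s \<le> t" "t \<le> b" "L t - L u < \<eta>" and lt: "L u < L s" "L s < L t" for u s t
  proof -
    have us: "a \<le> u" "u \<le> s" "s \<le> b" "L s - L u < \<eta>" and st: "a \<le> s" "s \<le> t" "t \<le> b" "L t - L s < \<eta>"
      and ut: "a \<le> u" "u \<le> t" "t \<le> b" "L t - L u < \<eta>" using ust lt by auto
    let ?x = "w u s" and ?y = "w s t"
    have xy: "ex ?x \<cdot> ex ?y = iv (\<gamma> u) \<cdot> \<gamma> t"
      using close(3)[OF us] close(3)[OF st] by (metis mul_assoc mul_inv_cancel(2))
    have eq: "\<mu> (lg (ex ?x \<cdot> ex ?y)) = \<mu> ?x + \<mu> ?y"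
      unfolding xy w_def[of u t, symmetric] close(1)[OF us] close(1)[OF st] close(1)[OF ut] by simp
    have ne: "?x \<noteq> 0" "?y \<noteq> 0" using close(1)[OF us] close(1)[OF st] lt by auto
    have V: "ex ?x \<cdot> ex (\<tau> *\<^sub>R ?y) \<in> V" if "0 \<le> \<tau>" "\<tau> \<le> 1" for \<tau>
    proof (rule W(4)[OF close(2)[OF us]])
      have "(1 - \<tau>) *\<^sub>R 0 + \<tau> *\<^sub>R ?y \<in> W"
        by (rule convexD[OF W(1,2) close(2)[OF st]]) (use that in auto)
      then show "\<tau> *\<^sub>R ?y \<in> W" by simp
    qed
    obtain l where l: "l > 0" "?y = l *\<^sub>R ?x"
      by (rule parallel_of_additive[OF sc W(3)[OF close(2)[OF us]] V eq ne])
    have "L t - L s = l * (L s - L u)"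
      using close(1)[OF st] close(1)[OF us] l by (simp add: mu_scale)
    then have "l = (L t - L s) / (L s - L u)" using lt by simp
    with l(2) show ?thesis by simp
  qed
  have surj: "\<exists>t. a \<le> t \<and> t \<le> b \<and> L t = c" if "0 \<le> c" "c \<le> L b" for c
    using IVT'[of L a c b] that La Lc ab by auto
  show ?thesis
  proof (cases "L b = 0")
    case True
    have const: "\<gamma> a = \<gamma> t" if "t \<in> {a..b}" for t
    proof (rule rest)
      show "L t \<le> L a" using Lmono[of t b] that True La by simp
    qed (use that in auto)
    \<comment> \<open>The arc is constant. Normalized arc length would divide by zero here, so an
      affine change of parameter is taken.\<close>
    have "reparametrization a b \<gamma> (segment K ex (\<gamma> a) 0)"
      unfolding reparametrization_def
    proof (intro exI[of _ "\<lambda>t. (t - a) / (b - a)"] conjI ballI)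
      show "continuous_on {a..b} (\<lambda>t. (t - a) / (b - a))" by (intro continuous_intros) (use ab in auto)
      show "mono_on {a..b} (\<lambda>t. (t - a) / (b - a))"
        using ab by (intro mono_onI divide_right_mono) auto
    qed (use ab const in \<open>auto simp: segment_def\<close>)
    moreover have "\<gamma> b = \<gamma> a \<cdot> ex 0" using const[of b] ab by simp
    ultimately show ?thesis by (intro that)
  next
    case False
    then have Lb: "L b > 0" using Lmono[of a b] La ab by simp
    \<comment> \<open>With a third of \<eta>, two consecutive pieces of length \<delta> together
      stay below \<eta>; and \<delta> is at most the total length, so a first piece exists.\<close>
    define \<delta> where "\<delta> = min (\<eta> / 3) (L b)"
    have \<delta>: "\<delta> > 0" "2 * \<delta> < \<eta>" "\<delta> \<le> L b" using \<eta>(1) Lb by (auto simp: \<delta>_def)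
    obtain t1 where t1: "a \<le> t1" "t1 \<le> b" "L t1 = \<delta>" using surj[of \<delta>] \<delta> by auto
    have at1: "a \<le> a" "a \<le> t1" "t1 \<le> b" "L t1 - L a < \<eta>" using t1 \<delta> La by auto
    define v where "v = w a t1 /\<^sub>R \<delta>"
    have wv: "w a t1 = \<delta> *\<^sub>R v" using \<delta>(1) by (simp add: v_def)
    have \<mu>v: "\<mu> v = 1" using close(1)[OF at1] t1(3) La \<delta>(1) by (simp add: v_def mu_scale)
    have \<delta>R: "\<delta> < R" using W(3)[OF close(2)[OF at1]] close(1)[OF at1] t1(3) La by simp
    \<comment> \<open>The first piece: its two parts on either side of \<open>t\<close> are parallel
      by \<open>par\<close>, so both are multiples of the logarithm \<open>\<delta> v\<close> of the
      whole piece.\<close>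
    have base: "\<gamma> t = \<gamma> a \<cdot> ex (L t *\<^sub>R v)" if t: "a \<le> t" "t \<le> b" "L t \<le> \<delta>" for t
    proof -
      consider "L t = 0" | "L t = \<delta>" | "0 < L t" "L t < \<delta>" using Lmono[of a t] La t by fastforce
      then show ?thesis
      proof cases
        case 1
        then have "\<gamma> a = \<gamma> t" using La t by (intro rest) auto
        then show ?thesis using 1 by simp
      next
        case 2
        have "\<gamma> t = \<gamma> t1"
        proof (cases "t \<le> t1")
          case True
          show ?thesis by (rule rest[OF t(1) True t1(2)]) (simp add: 2 t1(3))
        next
          case False
          then have "t1 \<le> t" by simp
          from rest[OF t1(1) this t(2)] show ?thesis using 2 t1(3) by simp
        qed
        then show ?thesis using close(3)[OF at1] 2 by (simp add: wv)
      next
        case 3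
        have tt: "t \<le> t1" using Lmono[of t1 t] 3 t t1 by (cases "t \<le> t1") auto
        have p: "w t t1 = ((\<delta> - L t) / L t) *\<^sub>R w a t"
          using par[of a t t1] t t1 tt 3 La \<delta> by simp
        have at: "a \<le> a" "a \<le> t" "t \<le> b" "L t - L a < \<eta>" and tt1: "a \<le> t" "t \<le> t1" "t1 \<le> b" "L t1 - L t < \<eta>"
          using t t1 tt 3 La \<delta> by auto
        let ?c = "\<delta> / L t"
        have "ex (w a t1) = ex (w a t) \<cdot> ex (w t t1)"
          using close(3)[OF at1] close(3)[OF at] close(3)[OF tt1] by (metis mul_assoc mul_inv_cancel(2))
        also have "\<dots> = ex (?c *\<^sub>R w a t)"
          using ex_add[of 1 "(\<delta> - L t) / L t" "w a t"] 3 by (simp add: p diff_divide_distrib)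
        finally have e: "ex (w a t1) = ex (?c *\<^sub>R w a t)" .
        \<comment> \<open>Its norm \<delta> is below \<open>R\<close>, so injectivity of
          \<open>ex\<close> turns the equality of exponentials into one of vectors.\<close>
        have "\<mu> (?c *\<^sub>R w a t) = \<delta>" using close(1)[OF at] 3 La \<delta> by (simp add: mu_scale)
        then have "lg (ex (?c *\<^sub>R w a t)) = ?c *\<^sub>R w a t" using \<delta>R by simp
        moreover have "lg (ex (w a t1)) = w a t1" using W(3)[OF close(2)[OF at1]] by simp
        ultimately have "w a t1 = ?c *\<^sub>R w a t" using e by simp
        then have "(L t / \<delta>) *\<^sub>R w a t1 = w a t" using 3 \<delta> by simp
        then have "w a t = L t *\<^sub>R v" using \<delta>(1) by (simp add: wv)
        then show ?thesis using close(3)[OF at] by simp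
      qed
    qed
    \<comment> \<open>The count starts at one piece, the case of \<open>base\<close>. In the step
      the direction \<open>v\<close> is passed on from the piece between lengths
      \<open>i \<delta>\<close> and \<open>(i + 1) \<delta>\<close>, where the formula is known at
      both ends, to what follows. Up to \<open>t\<close> this spans at most
      \<open>2 \<delta>\<close>, which is below \<eta>.\<close>
    have all: "\<gamma> t = \<gamma> a \<cdot> ex (L t *\<^sub>R v)" if "a \<le> t" "t \<le> b" "L t \<le> real (Suc i) * \<delta>" for i t
      using that
    proof (induction i arbitrary: t)
      case 0
      then show ?case using base[of t] by simp
    next
      case (Suc i)
      show ?case
      proof (cases "L t \<le> real (Suc i) * \<delta>")
        case True
        then show ?thesis using Suc by blast
      next
        case F: False
        have tb: "L t \<le> L b" using Lmono[of t b] Suc.prems by simp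
        have pos: "0 \<le> real i * \<delta>" "real i * \<delta> < real (Suc i) * \<delta>" using \<delta>(1) by (simp_all add: algebra_simps)
        obtain u where u: "a \<le> u" "u \<le> b" "L u = real i * \<delta>" using surj[of "real i * \<delta>"] pos F tb by auto
        obtain s where s: "a \<le> s" "s \<le> b" "L s = real (Suc i) * \<delta>" using surj[of "real (Suc i) * \<delta>"] pos F tb by auto
        have lt: "L u < L s" "L s < L t" using u s pos F by auto
        have us: "u \<le> s" using Lmono[of s u] lt u s by (cases "u \<le> s") auto
        have st: "s \<le> t" using Lmono[of t s] lt Suc.prems s by (cases "s \<le> t") auto
        have d: "L s - L u = \<delta>" "L t - L u < \<eta>"
          using u s Suc.prems(3) \<delta> by (auto simp: algebra_simps)
        have \<gamma>u: "\<gamma> u = \<gamma> a \<cdot> ex (L u *\<^sub>R v)" using Suc.IH[of u] u pos by simp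
        have \<gamma>s: "\<gamma> s = \<gamma> a \<cdot> ex (L s *\<^sub>R v)" using Suc.IH[of s] s by simp
        have "iv (\<gamma> u) \<cdot> \<gamma> s = ex (\<delta> *\<^sub>R v)"
        proof -
          have "L u + \<delta> = L s" using d(1) by simp
          then have "ex (L s *\<^sub>R v) = ex (L u *\<^sub>R v) \<cdot> ex (\<delta> *\<^sub>R v)" using ex_add[of "L u" \<delta> v] by simp
          then show ?thesis by (simp add: \<gamma>u \<gamma>s mul_assoc)
        qed
        then have wus: "w u s = \<delta> *\<^sub>R v" using \<delta> \<delta>R \<mu>v by (simp add: w_def mu_scale)
        have "w s t = ((L t - L s) / \<delta>) *\<^sub>R w u s"
          using par[OF u(1) us st Suc.prems(2) d(2) lt] d(1) by simp
        then have wst: "w s t = (L t - L s) *\<^sub>R v" using \<delta>(1) by (simp add: wus)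
        have "\<gamma> t = \<gamma> s \<cdot> ex (w s t)" by (rule close(3)[OF s(1) st Suc.prems(2)]) (use d lt in simp)
        also have "\<dots> = \<gamma> a \<cdot> ex (L t *\<^sub>R v)"
          using ex_add[of "L s" "L t - L s" v] by (simp add: wst \<gamma>s mul_assoc)
        finally show ?thesis .
      qed
    qed
    have seg: "\<gamma> t = \<gamma> a \<cdot> ex (L t *\<^sub>R v)" if t: "t \<in> {a..b}" for t
    proof -
      obtain i where "L t / \<delta> \<le> real i" using real_arch_simple by blast
      then have "L t \<le> real i * \<delta>" using \<delta>(1) by (simp add: divide_le_eq)
      also have "\<dots> \<le> real (Suc i) * \<delta>" using \<delta>(1) by (simp add: algebra_simps)
      finally show ?thesis using all[of t i] t by auto
    qed
    have "reparametrization a b \<gamma> (segment K ex (\<gamma> a) (L b *\<^sub>R v))"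
      unfolding reparametrization_def
    proof (intro exI[of _ "\<lambda>t. L t / L b"] conjI ballI)
      show "continuous_on {a..b} (\<lambda>t. L t / L b)" by (intro continuous_intros Lc) (use Lb in auto)
      show "mono_on {a..b} (\<lambda>t. L t / L b)"
      proof (intro mono_onI divide_right_mono)
        fix s t assume "s \<in> {a..b}" "t \<in> {a..b}" "s \<le> t"
        then show "L s \<le> L t" by (intro Lmono) auto
      qed (use Lb in simp)
      show "\<gamma> t = segment K ex (\<gamma> a) (L b *\<^sub>R v) (L t / L b)" if "t \<in> {a..b}" for t
        using seg[OF that] Lb by (simp add: segment_def)
    qed (use Lb La in simp_all)
    moreover have "\<gamma> b = \<gamma> a \<cdot> ex (L b *\<^sub>R v)" by (rule seg) (use ab in simp)
    ultimately show ?thesis by (rule that[rotated])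
  qed
qed

end

text \<open>Uniqueness is stated for vectors realized by short arcs, since \<open>ex\<close> is
  injective only on the ball of radius \<open>R\<close>: in a circle group longer vectors have the
  same exponential.\<close>

theorem theorem4p15:
  fixes K :: "'k::t2_space monoid"
    and A :: "('k, 'e::hausdorff_lcs) chart set"
    and c0 :: "('k, 'e) chart"
    and ex :: "'e \<Rightarrow> 'k"
    and \<mu> :: "'e \<Rightarrow> real"
    and R a b :: real
    and u0 u1 :: 'k
    and \<gamma> :: "real \<Rightarrow> 'k"
  assumes "lie_group K A"
    and "c0 \<in> A" and "\<one>\<^bsub>K\<^esub> \<in> fst c0"
    and "is_exponential K A c0 ex"
    and "mfd_map C2_on vector_atlas UNIV A ex"
    and "finsler_norm \<mu>" and "Ad_invariant K c0 \<mu>"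
    and "R > 0"
    and "C1_diffeo_onto_open vector_atlas {v. \<mu> v < R} A ex"
    and "strictly_convex \<mu>"
    and "a < b"
    and "rectifiable K A c0 \<mu> a b \<gamma>" and "short K A c0 \<mu> a b \<gamma>"
    and "\<gamma> a = u0" and "\<gamma> b = u1"
  shows "\<exists>z. u1 = u0 \<otimes>\<^bsub>K\<^esub> ex z \<and>
      reparametrization a b \<gamma> (segment K ex u0 z) \<and>
      (finsler_dist K A c0 \<mu> u0 u1 < ereal R \<longrightarrow>
        (\<forall>a' b' \<gamma>' z'. a' < b' \<and> rectifiable K A c0 \<mu> a' b' \<gamma>' \<and> short K A c0 \<mu> a' b' \<gamma>' \<and>
            \<gamma>' a' = u0 \<and> \<gamma>' b' = u1 \<and> u1 = u0 \<otimes>\<^bsub>K\<^esub> ex z' \<and>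
            reparametrization a' b' \<gamma>' (segment K ex u0 z') \<longrightarrow>
          z' = z))"
proof -
  interpret lie_finsler K A c0 ex \<mu> R
    by unfold_locales (use assms in auto)
  obtain z where z: "\<gamma> b = u0 \<otimes>\<^bsub>K\<^esub> ex z" "reparametrization a b \<gamma> (segment K ex u0 z)"
    using short_arc_is_segment[OF assms(10,12,11,13)] assms(14) by blast
  \<comment> \<open>The norm of a realized vector is at most the length of its arc, which is the
    distance and so below \<open>R\<close>. This holds for \<open>z\<close> and for its competitor,
    and \<open>lg\<close> then separates them.\<close>
  have small: "\<mu> z' < R"
    if d: "finsler_dist K A c0 \<mu> u0 u1 < ereal R"
      and g: "a' < b'" "rectifiable K A c0 \<mu> a' b' \<gamma>'" "short K A c0 \<mu> a' b' \<gamma>'" "\<gamma>' a' = u0" "\<gamma>' b' = u1"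
        "reparametrization a' b' \<gamma>' (segment K ex u0 z')" for a' b' \<gamma>' z'
  proof -
    obtain s where s: "continuous_on {a'..b'} s" "mono_on {a'..b'} s" "s a' = 0" "s b' = 1"
      "\<And>t. t \<in> {a'..b'} \<Longrightarrow> \<gamma>' t = segment K ex u0 z' (s t)"
      using g(6) unfolding reparametrization_def by blast
    have "\<mu> z' \<le> arc_length K A c0 \<mu> a' b' \<gamma>'"
      by (rule segment_norm_le_len[OF g(2,1) s(1-4)]) (use s(5) in \<open>simp add: segment_def\<close>)
    moreover have "ereal (arc_length K A c0 \<mu> a' b' \<gamma>') < ereal R"
      using g(3-5) d by (simp add: short_def)
    ultimately show ?thesis by simp
  qed
  have "z' = z"
    if d: "finsler_dist K A c0 \<mu> u0 u1 < ereal R"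
      and g: "a' < b'" "rectifiable K A c0 \<mu> a' b' \<gamma>'" "short K A c0 \<mu> a' b' \<gamma>'" "\<gamma>' a' = u0" "\<gamma>' b' = u1"
        "u1 = u0 \<otimes>\<^bsub>K\<^esub> ex z'" "reparametrization a' b' \<gamma>' (segment K ex u0 z')" for a' b' \<gamma>' z'
  proof -
    have 1: "\<mu> z' < R" by (rule small[OF d g(1-5,7)])
    have 2: "\<mu> z < R" by (rule small[OF d assms(11-15) z(2)])
    have "inv\<^bsub>K\<^esub> u0 \<otimes>\<^bsub>K\<^esub> (u0 \<otimes>\<^bsub>K\<^esub> ex z') = inv\<^bsub>K\<^esub> u0 \<otimes>\<^bsub>K\<^esub> (u0 \<otimes>\<^bsub>K\<^esub> ex z)"
      using g(6) z(1) assms(15) by simp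
    then have "ex z' = ex z" by simp
    then have "lg (ex z') = lg (ex z)" by simp
    then show ?thesis using 1 2 by simp
  qed
  with z assms(15) show ?thesis by blast
qed

end
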